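(* Let $M$ be a two-dimensional Riemannian manifold whose Gaussian curvature is bounded above by $1/R^2$, where $R>0$. Let $ABC$ be a geodesic triangle on $M$, contained in a neighborhood $\mathcal{U}$ as described in the context, whose three angles $\angle BAC$, $\angle CBA$, $\angle ACB$ each measure less than $2\pi/3$. If the maximum geodesic distance $d(P,Q)$ between two points $P,Q$ in the domain of the triangle $ABC$ is less than $R\pi/2$, then there exists a balanced point of the triangle $ABC$.
   Context: Standing assumption: $\mathcal{U}\subset M$ is a neighborhood of a point of the surface $M$, homeomorphic to an open disk in $\mathbb{R}^2$, such that for any two points $P,Q\in\mathcal{U}$ there is exactly one geodesic from $P$ to $Q$ lying inside $\mathcal{U}$, and it is the shortest curve in $M$ connecting them. This geodesic is denoted $\gamma_{P,Q}$, and $d(P,Q)$ is the geodesic distance in $M$ (the length of the shortest curve joining $P$ and $Q$). For distinct points $P,X,Q$ in $\mathcal{U}$ with $X\neq P,Q$, the angle $\angle PXQ$ is the smaller of the two angles in $T_XM$ between the tangent vectors at $X$ of $\gamma_{X,P}$ and $\gamma_{X,Q}$; $m(\angle PXQ)\in[0,\pi]$ is its measure. The triangle $ABC$ has distinct vertices $A,B,C\in\mathcal{U}$ and sides $\gamma_{A,B},\gamma_{B,C},\gamma_{C,A}$; its domain is the closed region in $\mathcal{U}$ bounded by the three sides. A balanced point of the triangle $ABC$ is a point $T$ lying inside the triangle such that $m(\angle ATB)=m(\angle BTC)=m(\angle CTA)=2\pi/3$. *)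

theory Defs
  imports "HOL-Analysis.Analysis"
begin

primrec Ck_on :: "nat \<Rightarrow> 'a::euclidean_space set \<Rightarrow> ('a \<Rightarrow> 'b::real_normed_vector) \<Rightarrow> bool" where
  "Ck_on 0 S f \<longleftrightarrow> continuous_on S f"
| "Ck_on (Suc k) S f \<longleftrightarrow> (\<forall>x\<in>S. f differentiable (at x)) \<and>
     (\<forall>v. Ck_on k S (\<lambda>x. frechet_derivative f (at x) v))"

text \<open>Intended for open sets only, since the derivatives are not taken relative to the set.\<close>

definition smooth_on :: "'a::euclidean_space set \<Rightarrow> ('a \<Rightarrow> 'b::real_normed_vector) \<Rightarrow> bool" where
  "smooth_on S f \<longleftrightarrow> (\<forall>k. Ck_on k S f)"


section \<open>Two-dimensional Riemannian manifolds\<close>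

text \<open>A chart is a pair of its domain and its coordinate map; the coordinate map is
  irrelevant outside the domain.\<close>

type_synonym 'a chart = "'a set \<times> ('a \<Rightarrow> real^2)"

definition coord_image :: "'a chart \<Rightarrow> (real^2) set" where
  "coord_image c = snd c ` fst c"

definition transition :: "'a chart \<Rightarrow> 'a chart \<Rightarrow> real^2 \<Rightarrow> real^2" where
  "transition c c' = snd c' \<circ> inv_into (fst c) (snd c)"

text \<open>The manifold is the whole type \<open>'a\<close>. The matrix \<open>gcoeff M c x\<close> consists of the
  coefficients of the metric in the chart \<open>c\<close>, at the point with coordinates \<open>x\<close>.\<close>

record 'a surface =
  charts :: "'a chart set"
  gcoeff :: "'a chart \<Rightarrow> real^2 \<Rightarrow> real^2^2"

locale riemannian_surface =
  fixes M :: "'a::{t2_space, second_countable_topology} surface"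
  assumes charts_cover: "(\<Union>c\<in>charts M. fst c) = UNIV"
    and chart_open: "c \<in> charts M \<Longrightarrow> open (fst c) \<and> open (coord_image c)"
    and chart_homeomorphism: "c \<in> charts M \<Longrightarrow>
      homeomorphism (fst c) (coord_image c) (snd c) (inv_into (fst c) (snd c))"
    and transition_smooth: "\<lbrakk>c \<in> charts M; c' \<in> charts M\<rbrakk> \<Longrightarrow>
      smooth_on (snd c ` (fst c \<inter> fst c')) (transition c c')"
    and gcoeff_smooth: "c \<in> charts M \<Longrightarrow> smooth_on (coord_image c) (gcoeff M c)"
    and gcoeff_sym: "\<lbrakk>c \<in> charts M; x \<in> coord_image c\<rbrakk> \<Longrightarrow>
      transpose (gcoeff M c x) = gcoeff M c x"
    and gcoeff_pos: "\<lbrakk>c \<in> charts M; x \<in> coord_image c; v \<noteq> 0\<rbrakk> \<Longrightarrow>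
      0 < v \<bullet> (gcoeff M c x *v v)"
    and gcoeff_transform: "\<lbrakk>c \<in> charts M; c' \<in> charts M; p \<in> fst c \<inter> fst c';
        J = matrix (frechet_derivative (transition c c') (at (snd c p)))\<rbrakk> \<Longrightarrow>
      gcoeff M c (snd c p) = transpose J ** gcoeff M c' (snd c' p) ** J"

text \<open>A tangent vector at \<open>p\<close> is represented by its components in a chart around \<open>p\<close>.
  Lengths and angles do not depend on which one, so an arbitrary chart is fixed for
  each point.\<close>

definition chart_at :: "'a surface \<Rightarrow> 'a \<Rightarrow> 'a chart" where
  "chart_at M p = (SOME c. c \<in> charts M \<and> p \<in> fst c)"

definition tangent_inner :: "'a surface \<Rightarrow> 'a \<Rightarrow> real^2 \<Rightarrow> real^2 \<Rightarrow> real" where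
  "tangent_inner M p u v = u \<bullet> (gcoeff M (chart_at M p) (snd (chart_at M p) p) *v v)"

definition tangent_norm :: "'a surface \<Rightarrow> 'a \<Rightarrow> real^2 \<Rightarrow> real" where
  "tangent_norm M p v = sqrt (tangent_inner M p v v)"

text \<open>The derivative is one-sided at the end points of the unit interval.\<close>

definition velocity :: "'a surface \<Rightarrow> (real \<Rightarrow> 'a) \<Rightarrow> real \<Rightarrow> real^2" where
  "velocity M \<gamma> t =
     vector_derivative (snd (chart_at M (\<gamma> t)) \<circ> \<gamma>) (at t within {0..1})"


section \<open>Christoffel symbols and Gaussian curvature\<close>

definition pderiv_coord :: "2 \<Rightarrow> (real^2 \<Rightarrow> real) \<Rightarrow> real^2 \<Rightarrow> real" where
  "pderiv_coord i f x = frechet_derivative f (at x) (axis i 1)"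

text \<open>\<open>christoffel G k i j\<close> is $\Gamma^k_{ij}$, for the metric with coefficients \<open>G\<close>.\<close>

definition christoffel :: "(real^2 \<Rightarrow> real^2^2) \<Rightarrow> 2 \<Rightarrow> 2 \<Rightarrow> 2 \<Rightarrow> real^2 \<Rightarrow> real" where
  "christoffel G k i j x =
     (\<Sum>l\<in>UNIV. matrix_inv (G x) $ k $ l *
        (pderiv_coord i (\<lambda>y. G y $ j $ l) x + pderiv_coord j (\<lambda>y. G y $ i $ l) x
          - pderiv_coord l (\<lambda>y. G y $ i $ j) x)) / 2"

text \<open>\<open>riemann G l i j k\<close> is the \<open>l\<close>-th component of $R(\partial_i, \partial_j)\partial_k$,
  where $R(X,Y)Z = \nabla_X\nabla_Y Z - \nabla_Y\nabla_X Z - \nabla_{[X,Y]}Z$.\<close>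

definition riemann :: "(real^2 \<Rightarrow> real^2^2) \<Rightarrow> 2 \<Rightarrow> 2 \<Rightarrow> 2 \<Rightarrow> 2 \<Rightarrow> real^2 \<Rightarrow> real" where
  "riemann G l i j k x =
     pderiv_coord i (christoffel G l j k) x - pderiv_coord j (christoffel G l i k) x
     + (\<Sum>m\<in>UNIV. christoffel G m j k x * christoffel G l i m x
          - christoffel G m i k x * christoffel G l j m x)"

text \<open>$K = \langle R(\partial_1,\partial_2)\partial_2, \partial_1\rangle / \det G$.\<close>

definition gauss_curvature :: "(real^2 \<Rightarrow> real^2^2) \<Rightarrow> real^2 \<Rightarrow> real" where
  "gauss_curvature G x = (\<Sum>l\<in>UNIV. G x $ 1 $ l * riemann G l 1 2 2 x) / det (G x)"

text \<open>The curvature at a point has the same value in every chart around the point.\<close>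

definition curvature_le :: "'a surface \<Rightarrow> real \<Rightarrow> bool" where
  "curvature_le M \<kappa> \<longleftrightarrow>
     (\<forall>c\<in>charts M. \<forall>p\<in>fst c. gauss_curvature (gcoeff M c) (snd c p) \<le> \<kappa>)"


section \<open>Lengths, distance and geodesics\<close>

text \<open>At the end points of \<open>{a..b}\<close> the derivative is one-sided, and \<open>v\<close> is continuous
  there; hence piecewise \<open>C1\<close> curves have finite length.\<close>

definition C1_curve_on :: "'a::topological_space surface \<Rightarrow> real \<Rightarrow> real \<Rightarrow> (real \<Rightarrow> 'a) \<Rightarrow> bool" where
  "C1_curve_on M a b \<sigma> \<longleftrightarrow> continuous_on {a..b} \<sigma> \<and>
     (\<forall>c\<in>charts M. \<forall>s t. a \<le> s \<and> s < t \<and> t \<le> b \<and> \<sigma> ` {s..t} \<subseteq> fst c \<longrightarrow>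
        (\<exists>v. continuous_on {s..t} v \<and>
          (\<forall>r\<in>{s..t}. (snd c \<circ> \<sigma> has_vector_derivative v r) (at r within {s..t}))))"

definition piecewise_C1_curve :: "'a::topological_space surface \<Rightarrow> (real \<Rightarrow> 'a) \<Rightarrow> bool" where
  "piecewise_C1_curve M \<sigma> \<longleftrightarrow> path \<sigma> \<and>
     (\<exists>n \<tau>. \<tau> 0 = 0 \<and> \<tau> n = 1 \<and>
        (\<forall>i<n. \<tau> i < \<tau> (Suc i) \<and> C1_curve_on M (\<tau> i) (\<tau> (Suc i)) \<sigma>))"

definition curve_length :: "'a surface \<Rightarrow> (real \<Rightarrow> 'a) \<Rightarrow> real" where
  "curve_length M \<sigma> = integral {0..1} (\<lambda>t. tangent_norm M (\<sigma> t) (velocity M \<sigma> t))"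

definition joins :: "'a::topological_space surface \<Rightarrow> 'a \<Rightarrow> 'a \<Rightarrow> (real \<Rightarrow> 'a) \<Rightarrow> bool" where
  "joins M P Q \<sigma> \<longleftrightarrow> piecewise_C1_curve M \<sigma> \<and> pathstart \<sigma> = P \<and> pathfinish \<sigma> = Q"

definition geodesic_dist :: "'a::topological_space surface \<Rightarrow> 'a \<Rightarrow> 'a \<Rightarrow> real" where
  "geodesic_dist M P Q = (INF \<sigma>\<in>{\<sigma>. joins M P Q \<sigma>}. curve_length M \<sigma>)"

text \<open>The geodesic equation, so that geodesics are parametrized proportionally to arc length.
  Constant curves count as geodesics.\<close>

definition geodesic :: "'a::topological_space surface \<Rightarrow> (real \<Rightarrow> 'a) \<Rightarrow> bool" where
  "geodesic M \<gamma> \<longleftrightarrow> path \<gamma> \<and>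
     (\<forall>c\<in>charts M. \<forall>s t. 0 \<le> s \<and> s < t \<and> t \<le> 1 \<and> \<gamma> ` {s..t} \<subseteq> fst c \<longrightarrow>
        (\<exists>v. \<forall>r\<in>{s..t}.
          (snd c \<circ> \<gamma> has_vector_derivative v r) (at r within {s..t}) \<and>
          (v has_vector_derivative
            (\<chi> k. - (\<Sum>i\<in>UNIV. \<Sum>j\<in>UNIV.
                christoffel (gcoeff M c) k i j (snd c (\<gamma> r)) * v r $ i * v r $ j)))
            (at r within {s..t})))"

definition geodesic_within ::
    "'a::topological_space surface \<Rightarrow> 'a set \<Rightarrow> 'a \<Rightarrow> 'a \<Rightarrow> (real \<Rightarrow> 'a) \<Rightarrow> bool" where
  "geodesic_within M U P Q \<gamma> \<longleftrightarrow>
     geodesic M \<gamma> \<and> pathstart \<gamma> = P \<and> pathfinish \<gamma> = Q \<and> path_image \<gamma> \<subseteq> U"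

text \<open>The neighbourhoods in which geodesic triangles are considered. Since the
  parametrization is affine on the unit interval, uniqueness of the geodesic as a curve
  is uniqueness of \<open>\<gamma>\<close> on that interval.\<close>

definition geodesic_disk :: "'a::topological_space surface \<Rightarrow> 'a set \<Rightarrow> bool" where
  "geodesic_disk M U \<longleftrightarrow> open U \<and> U homeomorphic ball (0::real^2) 1 \<and>
     (\<forall>P\<in>U. \<forall>Q\<in>U. \<exists>\<gamma>. geodesic_within M U P Q \<gamma> \<and>
        (\<forall>\<gamma>'. geodesic_within M U P Q \<gamma>' \<longrightarrow> (\<forall>t\<in>{0..1}. \<gamma>' t = \<gamma> t)) \<and>
        (\<forall>\<sigma>. joins M P Q \<sigma> \<longrightarrow> curve_length M \<gamma> \<le> curve_length M \<sigma>))"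

definition geod :: "'a::topological_space surface \<Rightarrow> 'a set \<Rightarrow> 'a \<Rightarrow> 'a \<Rightarrow> real \<Rightarrow> 'a" where
  "geod M U P Q = (SOME \<gamma>. geodesic_within M U P Q \<gamma>)"


section \<open>Angles and triangles\<close>

text \<open>The measure of the angle at \<open>X\<close> between the geodesics to \<open>P\<close> and to \<open>Q\<close>.\<close>

definition angle :: "'a::topological_space surface \<Rightarrow> 'a set \<Rightarrow> 'a \<Rightarrow> 'a \<Rightarrow> 'a \<Rightarrow> real" where
  "angle M U P X Q =
     (let u = velocity M (geod M U X P) 0; v = velocity M (geod M U X Q) 0
      in arccos (tangent_inner M X u v / (tangent_norm M X u * tangent_norm M X v)))"

definition triangle_sides :: "'a::topological_space surface \<Rightarrow> 'a set \<Rightarrow> 'a \<Rightarrow> 'a \<Rightarrow> 'a \<Rightarrow> 'a set" where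
  "triangle_sides M U A B C =
     path_image (geod M U A B) \<union> path_image (geod M U B C) \<union> path_image (geod M U C A)"

text \<open>As \<open>U\<close> is homeomorphic to the plane, the points enclosed by the sides are those in
  components of the complement that are relatively compact in \<open>U\<close> (compare \<open>inside\<close>).\<close>

definition triangle_interior :: "'a::topological_space surface \<Rightarrow> 'a set \<Rightarrow> 'a \<Rightarrow> 'a \<Rightarrow> 'a \<Rightarrow> 'a set" where
  "triangle_interior M U A B C =
     {X \<in> U - triangle_sides M U A B C. \<exists>K. compact K \<and> K \<subseteq> U \<and>
        connected_component_set (U - triangle_sides M U A B C) X \<subseteq> K}"

definition triangle_domain :: "'a::topological_space surface \<Rightarrow> 'a set \<Rightarrow> 'a \<Rightarrow> 'a \<Rightarrow> 'a \<Rightarrow> 'a set" where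
  "triangle_domain M U A B C = triangle_sides M U A B C \<union> triangle_interior M U A B C"

definition balanced_point ::
    "'a::topological_space surface \<Rightarrow> 'a set \<Rightarrow> 'a \<Rightarrow> 'a \<Rightarrow> 'a \<Rightarrow> 'a \<Rightarrow> bool" where
  "balanced_point M U A B C T \<longleftrightarrow> T \<in> triangle_interior M U A B C \<and>
     angle M U A T B = 2 * pi / 3 \<and> angle M U B T C = 2 * pi / 3 \<and> angle M U C T A = 2 * pi / 3"

end

theory Submission
  imports Defs "HOL-Complex_Analysis.Winding_Numbers"
begin

text \<open>The balanced point is a minimum of \<open>f(T) = d(T,A) + d(T,B) + d(T,C)\<close>. Cutting the corner
  at the end of a geodesic bounds the one-sided derivative of a distance from above by the first
  variation formula; this inequality is all that is needed, so conjugate points never enter. At a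
  minimum over \<open>U\<close> it shows that the unit vectors towards \<open>A\<close>, \<open>B\<close> and \<open>C\<close> sum to zero, and
  excludes the vertices (because of the angles) and the sides.

  The minimum over the compact domain of the triangle is a minimum over \<open>U\<close>: let \<open>T\<close> lie
  outside. If a geodesic from \<open>T\<close> to a vertex meets the sides before reaching it, the triangle inequality
  gives a better point on the sides. Otherwise the winding number of \<open>ABC\<close>, being the sum of those
  of \<open>TAB\<close>, \<open>TBC\<close> and \<open>TCA\<close>, places one vertex, say \<open>C\<close>, in the triangle \<open>TAB\<close>. Extending
  the geodesic \<open>AC\<close> to the boundary of that triangle gives
  \<open>d(A,C) + d(C,B) \<le> d(A,T) + d(T,B)\<close>, hence \<open>f(C) \<le> f(T)\<close>.

  A geodesic from \<open>A\<close> to \<open>C\<close> extends beyond \<open>C\<close> because the initial velocity of the short geodesic from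
  \<open>C\<close> to a nearby point is close to the coordinate difference of the two points, so that by
  Brouwer's theorem every small vector is such an initial velocity.\<close>

section \<open>Second order equations with quadratic right-hand side\<close>

text \<open>All geodesics come from \<open>geodesic_disk\<close>; of the geodesic equation only
  uniqueness and a priori estimates are used, never solvability. So a geodesic can be continued past
  its end only by finding another geodesic of the disk with the opposite initial velocity, and this
  is why Brouwer's theorem appears. The one-sided bound suffices because a minimum only asks that no
  direction v decrease f: the bound turns this into <S, v> <= 0 for the sum S of the unit vectors,
  and v = S gives S = 0. At a vertex the distance to that vertex itself grows at most like |v|, so
  the other two unit vectors have a sum of length at most 1, that is 2 + 2 cos <= 1: this is the
  origin of the threshold 2 pi / 3. A minimum over the triangle alone would restrict v at the sides
  and the vertices; a minimum over \<open>U\<close> allows every direction. The passage to the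
  complex plane serves the topology (Jordan curves, winding numbers); the metric facts used there
  are the axioms of \<open>geodesic_plane\<close>.\<close>

lemma norm_diff_le_of_vector_derivative:
  fixes f :: "real \<Rightarrow> 'a::real_normed_vector"
  assumes "\<And>r. r \<in> {a..b} \<Longrightarrow> (f has_vector_derivative f' r) (at r within {a..b})"
    and "\<And>r. r \<in> {a..b} \<Longrightarrow> norm (f' r) \<le> B" and "s \<in> {a..b}" "t \<in> {a..b}"
  shows "norm (f t - f s) \<le> B * \<bar>t - s\<bar>"
proof -
  have "norm (f t - f s) \<le> B * norm (t - s)"
  proof (rule differentiable_bound[of "{a..b}" f "\<lambda>r h. h *\<^sub>R f' r"])
    show "onorm (\<lambda>h. h *\<^sub>R f' r) \<le> B" if "r \<in> {a..b}" for r
      using assms(2)[OF that] by (simp add: onorm_scaleR_left onorm_id)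
  qed (use assms in \<open>auto simp: has_vector_derivative_def\<close>)
  then show ?thesis by simp
qed

text \<open>Right-hand sides of the kind \<open>- (\<Sum>i j. \<Gamma> x i j * v i * v j)\<close>, with \<open>\<Gamma>\<close> Lipschitz on \<open>S\<close>.\<close>

locale quadratic_ode =
  fixes F :: "'a::euclidean_space \<Rightarrow> 'a \<Rightarrow> 'a" and S :: "'a set" and K :: real
  assumes K_nonneg: "0 \<le> K"
    and F_zero: "x \<in> S \<Longrightarrow> F x 0 = 0"
    and F_lipschitz: "\<lbrakk>x \<in> S; y \<in> S; norm v \<le> m; norm w \<le> m\<rbrakk> \<Longrightarrow>
      norm (F x v - F y w) \<le> K * (m\<^sup>2 * norm (x - y) + m * norm (v - w))"
begin

definition sol :: "real \<Rightarrow> real \<Rightarrow> (real \<Rightarrow> 'a) \<Rightarrow> (real \<Rightarrow> 'a) \<Rightarrow> bool" where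
  "sol a b x v \<longleftrightarrow> (\<forall>r\<in>{a..b}. x r \<in> S \<and>
     (x has_vector_derivative v r) (at r within {a..b}) \<and>
     (v has_vector_derivative F (x r) (v r)) (at r within {a..b}))"

lemma F_bound: "x \<in> S \<Longrightarrow> norm v \<le> m \<Longrightarrow> norm (F x v) \<le> K * (m * norm v)"
  using F_lipschitz[of x x v m 0] F_zero by (simp add: order_trans[OF norm_ge_zero])

lemma sol_cont:
  assumes "sol a b x v"
  shows "continuous_on {a..b} x" "continuous_on {a..b} v"
  using assms unfolding sol_def continuous_on_eq_continuous_within
  by (meson has_vector_derivative_continuous)+

lemma sol_bounded:
  assumes "sol a b x v"
  obtains m where "0 \<le> m" "\<And>r. r \<in> {a..b} \<Longrightarrow> norm (v r) \<le> m"
proof -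
  have "bounded (v ` {a..b})"
    using sol_cont(2)[OF assms] compact_continuous_image compact_Icc compact_imp_bounded by blast
  then show ?thesis using that unfolding bounded_pos by (metis imageI less_imp_le)
qed

text \<open>Gronwall's argument: for p = x - y and q = v - w the energy |p|^2 + |q|^2 has derivative
  at most C times itself, so after multiplication by exp (- C r) it cannot grow from its initial
  value 0. The common bound m of the velocities exists by continuity on a compact interval.\<close>

lemma sol_unique:
  assumes sol1: "sol a b x v" and sol2: "sol a b y w" and init: "x a = y a" "v a = w a"
    and r: "r \<in> {a..b}"
  shows "x r = y r"
proof -
  obtain m1 m2 where m1: "0 \<le> m1" "\<And>r. r \<in> {a..b} \<Longrightarrow> norm (v r) \<le> m1"
    and m2: "0 \<le> m2" "\<And>r. r \<in> {a..b} \<Longrightarrow> norm (w r) \<le> m2"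
    using sol_bounded sol1 sol2 by metis
  define m where "m = max m1 m2"
  \<comment> \<open>The 1 bounds 2 p.q; by 2 |p| |q| <= |p|^2 + |q|^2 the other two terms bound 2
    q.h.\<close>
  define C where "C = 1 + K * m\<^sup>2 + 2 * K * m"
  have m: "0 \<le> m" "\<And>r. r \<in> {a..b} \<Longrightarrow> norm (v r) \<le> m \<and> norm (w r) \<le> m"
    using m1 m2 unfolding m_def by force+
  define p where "p r = x r - y r" for r
  define q where "q r = v r - w r" for r
  define h where "h r = F (x r) (v r) - F (y r) (w r)" for r
  define \<phi> where "\<phi> r = (p r \<bullet> p r + q r \<bullet> q r) * exp (- C * r)" for r
  have pder: "(p has_vector_derivative q s) (at s within {a..b})"
    and qder: "(q has_vector_derivative h s) (at s within {a..b})"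
    and hb: "norm (h s) \<le> K * (m\<^sup>2 * norm (p s) + m * norm (q s))" if "s \<in> {a..b}" for s
    using sol1 sol2 that m(2)[OF that] unfolding sol_def p_def q_def h_def
    by (auto intro!: has_vector_derivative_diff F_lipschitz)
  have "\<phi> r \<le> \<phi> a"
  proof (rule DERIV_nonpos_imp_decreasing_open[of a r \<phi>])
    show "a \<le> r" using r by simp
    show "\<exists>z. DERIV \<phi> s :> z \<and> z \<le> 0" if "a < s" "s < r" for s
    proof -
      have s: "s \<in> {a..b}" and at: "at s within {a..b} = at s"
        using that r by (auto simp: at_within_Icc_at)
      let ?z = "(2 * (p s \<bullet> q s) + 2 * (q s \<bullet> h s)) * exp (- C * s)
        + (p s \<bullet> p s + q s \<bullet> q s) * (- C * exp (- C * s))"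
      note ip = bounded_bilinear.has_vector_derivative[OF bounded_bilinear_inner]
      have "DERIV (\<lambda>r. p r \<bullet> p r) s :> 2 * (p s \<bullet> q s)" "DERIV (\<lambda>r. q r \<bullet> q r) s :> 2 * (q s \<bullet> h s)"
        using ip[OF pder[OF s] pder[OF s]] ip[OF qder[OF s] qder[OF s]] unfolding at
        by (simp_all add: has_real_derivative_iff_has_vector_derivative inner_commute)
      then have "DERIV \<phi> s :> ?z"
        unfolding \<phi>_def by (auto intro!: derivative_eq_intros)
      moreover have "?z \<le> 0"
      proof -
        have n: "2 * norm (p s) * norm (q s) \<le> norm (p s)^2 + norm (q s)^2"
          using sum_squares_bound[of "norm (p s)" "norm (q s)"] by simp
        have 1: "2 * (p s \<bullet> q s) \<le> norm (p s)^2 + norm (q s)^2"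
          using norm_cauchy_schwarz[of "p s" "q s"] n by linarith
        have "q s \<bullet> h s \<le> norm (q s) * norm (h s)" by (rule norm_cauchy_schwarz)
        also have "\<dots> \<le> norm (q s) * (K * (m\<^sup>2 * norm (p s) + m * norm (q s)))"
          by (intro mult_left_mono hb s) auto
        finally have "2 * (q s \<bullet> h s) \<le> (K * m\<^sup>2) * (2 * norm (p s) * norm (q s)) + 2 * K * m * norm (q s)^2"
          by (simp add: algebra_simps power2_eq_square)
        also have "\<dots> \<le> (K * m\<^sup>2) * (norm (p s)^2 + norm (q s)^2) + 2 * K * m * (norm (p s)^2 + norm (q s)^2)"
          using n K_nonneg m(1) by (intro add_mono mult_left_mono) auto
        finally have 2: "2 * (q s \<bullet> h s) \<le> (K * m\<^sup>2 + 2 * K * m) * (norm (p s)^2 + norm (q s)^2)"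
          by (simp add: algebra_simps)
        have "2 * (p s \<bullet> q s) + 2 * (q s \<bullet> h s) \<le> C * (norm (p s)^2 + norm (q s)^2)"
          using 1 2 unfolding C_def by (simp add: algebra_simps)
        then have "(2 * (p s \<bullet> q s) + 2 * (q s \<bullet> h s) - C * (p s \<bullet> p s + q s \<bullet> q s)) * exp (- C * s) \<le> 0"
          by (intro mult_nonpos_nonneg) (auto simp: power2_norm_eq_inner)
        then show ?thesis by (simp add: algebra_simps)
      qed
      ultimately show ?thesis by blast
    qed
    have "continuous_on {a..b} \<phi>"
      unfolding \<phi>_def p_def q_def by (intro continuous_intros sol_cont[OF sol1] sol_cont[OF sol2])
    then show "continuous_on {a..r} \<phi>" by (rule continuous_on_subset) (use r in auto)
  qed
  moreover have "\<phi> a = 0" using init by (simp add: \<phi>_def p_def q_def)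
  ultimately have "p r \<bullet> p r + q r \<bullet> q r \<le> 0" unfolding \<phi>_def by (simp add: mult_le_0_iff)
  then have "p r \<bullet> p r = 0" using inner_ge_zero[of "p r"] inner_ge_zero[of "q r"] by linarith
  then show ?thesis by (simp add: p_def)
qed

text \<open>The least speed is at most the mean, hence at most l. If m is the greatest speed, the
  velocity changes between the two times by at most the integral of K m |v|, hence by K m l <= m /
  2; so m <= l + m / 2. A short solution is therefore slow at every instant, not only on
  average.\<close>

lemma sol_speed_bound:
  assumes sol: "sol 0 1 x v" and l: "integral {0..1} (\<lambda>r. norm (v r)) \<le> l" "K * l \<le> 1/2"
    and s: "s \<in> {0..1}"
  shows "norm (v s) \<le> 2 * l"
proof -
  have cont: "continuous_on {0..1} (\<lambda>r. norm (v r))"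
    by (intro continuous_intros sol_cont[OF sol])
  have int: "(\<lambda>r. norm (v r)) integrable_on {0..1}"
    using integrable_continuous_real cont by blast
  obtain s0 where s0: "s0 \<in> {0..1}" "\<And>r. r \<in> {0..1} \<Longrightarrow> norm (v s0) \<le> norm (v r)"
    using continuous_attains_inf[OF compact_Icc _ cont] by auto
  obtain s1 where s1: "s1 \<in> {0..1}" "\<And>r. r \<in> {0..1} \<Longrightarrow> norm (v r) \<le> norm (v s1)"
    using continuous_attains_sup[OF compact_Icc _ cont] by auto
  have "integral {0..1::real} (\<lambda>r. norm (v s0)) \<le> integral {0..1} (\<lambda>r. norm (v r))"
    by (rule integral_le) (use int s0 in auto)
  then have low: "norm (v s0) \<le> l" using l by simp
  let ?m = "norm (v s1)"
  have *: "norm (v t - v r) \<le> K * ?m * l" if "0 \<le> r" "r \<le> t" "t \<le> 1" for r t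
  proof -
    have FT: "((\<lambda>r. F (x r) (v r)) has_integral (v t - v r)) {r..t}"
    proof (rule fundamental_theorem_of_calculus)
      fix u assume "u \<in> {r..t}"
      then show "(v has_vector_derivative F (x u) (v u)) (at u within {r..t})"
        using sol that unfolding sol_def
        by (intro has_vector_derivative_within_subset[of v _ u "{0..1}" "{r..t}"]) auto
    qed (use that in simp)
    have int': "(\<lambda>r. norm (v r)) integrable_on {r..t}"
      by (rule integrable_on_subinterval[OF int]) (use that in auto)
    have "norm (v t - v r) \<le> integral {r..t} (\<lambda>r. K * ?m * norm (v r))"
      unfolding integral_unique[OF FT, symmetric]
    proof (rule integral_norm_bound_integral)
      show "(\<lambda>r. F (x r) (v r)) integrable_on {r..t}" using FT by blast
      show "(\<lambda>r. K * ?m * norm (v r)) integrable_on {r..t}" using int' by (rule integrable_on_mult_right)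
      show "norm (F (x u) (v u)) \<le> K * ?m * norm (v u)" if "u \<in> {r..t}" for u
        using F_bound[of "x u" "v u" ?m] s1(2)[of u] sol that \<open>0 \<le> r\<close> \<open>t \<le> 1\<close>
        unfolding sol_def by (auto simp: mult.assoc)
    qed
    also have "\<dots> = K * ?m * integral {r..t} (\<lambda>r. norm (v r))" by simp
    also have "\<dots> \<le> K * ?m * integral {0..1} (\<lambda>r. norm (v r))"
      using K_nonneg that int int'
      by (intro mult_left_mono integral_subset_le) auto
    also have "\<dots> \<le> K * ?m * l" using l K_nonneg by (intro mult_left_mono) auto
    finally show ?thesis .
  qed
  have "norm (v s1 - v s0) \<le> K * ?m * l"
    using *[of s0 s1] *[of s1 s0] s0(1) s1(1) by (cases "s0 \<le> s1") (auto simp: norm_minus_commute)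
  moreover have "K * ?m * l \<le> ?m / 2"
    using mult_right_mono[OF l(2), of ?m] by (simp add: algebra_simps)
  ultimately have "?m \<le> 2 * l"
    using low norm_triangle_ineq2[of "v s1" "v s0"] by linarith
  then show ?thesis using s1(2)[OF s] by linarith
qed

text \<open>The acceleration is at most K m^2, so the velocity stays that close to its initial value
  and x that close to its tangent line. With m proportional to the distance of the end points this
  error is of second order.\<close>

lemma sol_endpoint_approx:
  assumes sol: "sol 0 1 x v" and m: "\<And>r. r \<in> {0..1} \<Longrightarrow> norm (v r) \<le> m"
  shows "norm (x 1 - x 0 - v 0) \<le> K * m\<^sup>2"
proof -
  have m0: "0 \<le> m" using m[of 0] norm_ge_zero[of "v 0"] by (meson atLeastAtMost_iff order_refl order_trans zero_le_one)
  have FB: "norm (F (x r) (v r)) \<le> K * m\<^sup>2" if "r \<in> {0..1}" for r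
  proof -
    have "norm (F (x r) (v r)) \<le> K * (m * norm (v r))"
      using F_bound sol m that unfolding sol_def by blast
    also have "\<dots> \<le> K * (m * m)" using m[OF that] K_nonneg m0 by (intro mult_left_mono)
    finally show ?thesis by (simp add: power2_eq_square)
  qed
  have vB: "norm (v r - v 0) \<le> K * m\<^sup>2" if "r \<in> {0..1}" for r
  proof -
    have "norm (v r - v 0) \<le> (K * m\<^sup>2) * \<bar>r - 0\<bar>"
      by (rule norm_diff_le_of_vector_derivative[of 0 1 v "\<lambda>r. F (x r) (v r)"])
        (use sol that FB in \<open>auto simp: sol_def\<close>)
    also have "\<dots> \<le> K * m\<^sup>2 * 1" using that K_nonneg by (intro mult_left_mono) auto
    finally show ?thesis by simp
  qed
  have "norm ((x 1 - 1 *\<^sub>R v 0) - (x 0 - 0 *\<^sub>R v 0)) \<le> (K * m\<^sup>2) * \<bar>1 - 0\<bar>"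
  proof (rule norm_diff_le_of_vector_derivative[of 0 1 "\<lambda>r. x r - r *\<^sub>R v 0" "\<lambda>r. v r - v 0"])
    show "((\<lambda>r. x r - r *\<^sub>R v 0) has_vector_derivative v r - v 0) (at r within {0..1})" if "r \<in> {0..1}" for r
      using sol that unfolding sol_def by (auto intro!: derivative_eq_intros)
  qed (use vB in auto)
  then show ?thesis by (simp add: algebra_simps)
qed

text \<open>Let mu be the greatest |q|. Then |p| <= mu, and smallness gives |h| <= mu / 4, so q
  stays within mu / 4 of q 0 and mu <= 4/3 |q 0|. Integrating q, p 1 differs from q 0 by at most mu
  / 4 <= |q 0| / 3, which leaves 2/3 |q 0| <= |p 1|.\<close>

lemma sol_initial_velocity_lipschitz:
  assumes sol1: "sol 0 1 x v" and sol2: "sol 0 1 y w" and init: "x 0 = y 0"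
    and m: "\<And>r. r \<in> {0..1} \<Longrightarrow> norm (v r) \<le> m" "\<And>r. r \<in> {0..1} \<Longrightarrow> norm (w r) \<le> m"
    and small: "K * (m\<^sup>2 + m) \<le> 1/4"
  shows "norm (v 0 - w 0) \<le> 3/2 * norm (x 1 - y 1)"
proof -
  define p where "p r = x r - y r" for r
  define q where "q r = v r - w r" for r
  define h where "h r = F (x r) (v r) - F (y r) (w r)" for r
  have m0: "0 \<le> m" using m(1)[of 0] norm_ge_zero[of "v 0"] by (meson atLeastAtMost_iff order_refl order_trans zero_le_one)
  have pder: "(p has_vector_derivative q s) (at s within {0..1})"
    and qder: "(q has_vector_derivative h s) (at s within {0..1})"
    and hb: "norm (h s) \<le> K * (m\<^sup>2 * norm (p s) + m * norm (q s))" if "s \<in> {0..1}" for s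
    using sol1 sol2 that m[OF that] unfolding sol_def p_def q_def h_def
    by (auto intro!: has_vector_derivative_diff F_lipschitz)
  have "continuous_on {0..1} (\<lambda>r. norm (q r))"
    unfolding q_def by (intro continuous_intros sol_cont[OF sol1] sol_cont[OF sol2])
  then obtain s1 where s1: "s1 \<in> {0..1}" "\<And>r. r \<in> {0..1} \<Longrightarrow> norm (q r) \<le> norm (q s1)"
    using continuous_attains_sup[OF compact_Icc, of 0 1 "\<lambda>r. norm (q r)"] by auto
  let ?\<mu> = "norm (q s1)"
  have pB: "norm (p r) \<le> ?\<mu>" if r: "r \<in> {0..1}" for r
  proof -
    have "norm (p r - p 0) \<le> ?\<mu> * \<bar>r - 0\<bar>"
      by (rule norm_diff_le_of_vector_derivative[of 0 1 p q]) (use pder s1 r in auto)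
    also have "\<dots> \<le> ?\<mu> * 1" using r by (intro mult_left_mono) auto
    finally show ?thesis using init by (simp add: p_def)
  qed
  have hB: "norm (h r) \<le> ?\<mu> / 4" if r: "r \<in> {0..1}" for r
  proof -
    have "norm (h r) \<le> K * (m\<^sup>2 * norm (p r) + m * norm (q r))" by (rule hb[OF r])
    also have "\<dots> \<le> K * (m\<^sup>2 * ?\<mu> + m * ?\<mu>)"
      using K_nonneg m0 pB[OF r] s1(2)[OF r] by (intro mult_left_mono add_mono) auto
    also have "\<dots> = K * (m\<^sup>2 + m) * ?\<mu>" by (simp add: algebra_simps)
    also have "\<dots> \<le> 1/4 * ?\<mu>" using small by (intro mult_right_mono) auto
    finally show ?thesis by simp
  qed
  have qB: "norm (q r - q 0) \<le> ?\<mu> / 4" if r: "r \<in> {0..1}" for r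
  proof -
    have "norm (q r - q 0) \<le> ?\<mu> / 4 * \<bar>r - 0\<bar>"
      by (rule norm_diff_le_of_vector_derivative[of 0 1 q h]) (use qder hB r in auto)
    also have "\<dots> \<le> ?\<mu> / 4 * 1" using r by (intro mult_left_mono) auto
    finally show ?thesis by simp
  qed
  have mu: "?\<mu> \<le> 4/3 * norm (q 0)"
    using qB[OF s1(1)] norm_triangle_ineq2[of "q s1" "q 0"] by linarith
  have "norm ((p 1 - 1 *\<^sub>R q 0) - (p 0 - 0 *\<^sub>R q 0)) \<le> (?\<mu> / 4) * \<bar>1 - 0\<bar>"
  proof (rule norm_diff_le_of_vector_derivative[of 0 1 "\<lambda>r. p r - r *\<^sub>R q 0" "\<lambda>r. q r - q 0"])
    show "((\<lambda>r. p r - r *\<^sub>R q 0) has_vector_derivative q r - q 0) (at r within {0..1})" if "r \<in> {0..1}" for r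
      using pder[OF that] by (auto intro!: derivative_eq_intros)
  qed (use qB in auto)
  then have "norm (p 1 - q 0) \<le> ?\<mu> / 4" using init by (simp add: p_def)
  then have "norm (q 0) - norm (p 1) \<le> norm (q 0) / 3"
    using mu norm_triangle_ineq2[of "q 0" "p 1"] by (simp add: norm_minus_commute)
  then show ?thesis unfolding p_def q_def by simp
qed

text \<open>By the two preceding estimates the initial velocity is a Lipschitz function of the end point,
  close to the identity; so Brouwer's theorem shows that it attains all small values.\<close>

lemma sol_with_initial_velocity:
  assumes sols: "\<And>z. z \<in> cball y \<rho> \<Longrightarrow> sol 0 1 (x z) (v z) \<and> x z 0 = y \<and> x z 1 = z \<and>
      (\<forall>r\<in>{0..1}. norm (v z r) \<le> c * norm (z - y))"
    and "0 < \<rho>" "0 < c"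
  shows "\<exists>r>0. \<forall>w. norm w \<le> r \<longrightarrow> (\<exists>z\<in>cball y \<rho>. v z 0 = w)"
proof -
  \<comment> \<open>The first bound keeps to the end points for which solutions are given; 1 / c
    makes c r <= 1, so that (c r)^2 <= c r; the last gives K (c + c^2) r <= 1/8, which serves both
    the Lipschitz estimate and the approximation.\<close>
  define r where "r = min (min \<rho> (1 / c)) (1 / (8 * (K + 1) * (c + c\<^sup>2)))"
  have c2: "0 < (K + 1) * (c + c\<^sup>2)"
    using assms K_nonneg by (intro mult_pos_pos add_nonneg_pos add_pos_nonneg) auto
  then have rpos: "0 < r" using assms by (simp add: r_def mult.assoc del: distrib_left_numeral)
  have r\<rho>: "r \<le> \<rho>" and cr: "c * r \<le> 1"
  proof -
    have "r \<le> 1 / c" unfolding r_def by linarith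
    then show "c * r \<le> 1" using assms by (simp add: field_simps)
  qed (simp add: r_def)
  have r8: "(K + 1) * ((c + c\<^sup>2) * r) \<le> 1/8"
  proof -
    have "r \<le> 1 / (8 * (K + 1) * (c + c\<^sup>2))" unfolding r_def by simp
    with c2 show ?thesis by (simp add: field_simps)
  qed
  have Kr: "K * ((c + c\<^sup>2) * r) \<le> 1/8"
    using r8 rpos assms K_nonneg by (smt (verit, best) mult_right_mono mult_nonneg_nonneg zero_le_power2)
  have Kc: "K * (c\<^sup>2 * r) \<le> 1/8"
    using Kr rpos assms K_nonneg by (smt (verit, best) mult_left_mono mult_right_mono)
  let ?m = "c * r"
  have m: "norm (v z s) \<le> ?m" if "z \<in> cball y r" "s \<in> {0..1}" for z s
  proof -
    have z: "z \<in> cball y \<rho>" using that(1) r\<rho> by auto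
    have "norm (v z s) \<le> c * norm (z - y)" using sols[OF z] that by blast
    also have "\<dots> \<le> c * r" using that(1) assms(3) by (simp add: dist_norm norm_minus_commute)
    finally show ?thesis .
  qed
  have small: "K * (?m\<^sup>2 + ?m) \<le> 1/4"
  proof -
    have "?m\<^sup>2 \<le> ?m" using cr rpos assms by (simp add: power2_eq_square mult_left_le)
    then have "K * (?m\<^sup>2 + ?m) \<le> K * (2 * ?m)" using K_nonneg by (intro mult_left_mono) auto
    also have "\<dots> \<le> 2 * (K * ((c + c\<^sup>2) * r))"
      using K_nonneg rpos by (simp add: algebra_simps)
    finally show ?thesis using Kr by linarith
  qed
  have contV: "continuous_on (cball y r) (\<lambda>z. v z 0)"
  proof (rule lipschitz_on_continuous_on, rule lipschitz_onI)
    fix z z' assume z: "z \<in> cball y r" "z' \<in> cball y r"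
    then have z': "z \<in> cball y \<rho>" "z' \<in> cball y \<rho>" using r\<rho> by auto
    have "norm (v z 0 - v z' 0) \<le> 3/2 * norm (x z 1 - x z' 1)"
      by (rule sol_initial_velocity_lipschitz[where m = ?m]) (use sols[OF z'(1)] sols[OF z'(2)] m z small in auto)
    then show "dist (v z 0) (v z' 0) \<le> 3/2 * dist z z'"
      using sols[OF z'(1)] sols[OF z'(2)] by (simp add: dist_norm)
  qed simp
  have approx: "norm (z - y - v z 0) \<le> r / 2" if z: "z \<in> cball y r" for z
  proof -
    have z': "z \<in> cball y \<rho>" using z r\<rho> by auto
    have "norm (x z 1 - x z 0 - v z 0) \<le> K * ?m\<^sup>2"
      by (rule sol_endpoint_approx) (use sols[OF z'] m z in auto)
    also have "\<dots> = K * (c\<^sup>2 * r) * r" by (simp add: power2_eq_square)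
    also have "\<dots> \<le> 1/8 * r" using Kc rpos by (intro mult_right_mono) auto
    finally show ?thesis using sols[OF z'] rpos by simp
  qed
  have "\<exists>z\<in>cball y \<rho>. v z 0 = w" if w: "norm w \<le> r / 2" for w
  proof -
    \<comment> \<open>A fixed point has initial velocity w. The ball is mapped into itself because
      |w| <= r / 2 and the second-order error is at most r / 2.\<close>
    define \<Phi> where "\<Phi> z = y + w + (z - y - v z 0)" for z
    have "\<Phi> \<in> cball y r \<rightarrow> cball y r"
    proof
      fix z assume "z \<in> cball y r"
      then have "norm (w + (z - y - v z 0)) \<le> r"
        using w approx norm_triangle_ineq[of w "z - y - v z 0"] by fastforce
      moreover have "dist y (\<Phi> z) = norm (w + (z - y - v z 0))"
        unfolding \<Phi>_def dist_norm by (subst norm_minus_commute) (simp add: algebra_simps)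
      ultimately show "\<Phi> z \<in> cball y r" by simp
    qed
    moreover have "continuous_on (cball y r) \<Phi>"
      unfolding \<Phi>_def by (intro continuous_intros contV)
    ultimately obtain z where "z \<in> cball y r" "\<Phi> z = z" using brouwer_ball rpos by blast
    then show ?thesis using r\<rho> by (intro bexI[of _ z]) (auto simp: \<Phi>_def algebra_simps)
  qed
  then show ?thesis using rpos by (intro exI[of _ "r / 2"]) auto
qed

end

section \<open>Uniquely geodesic metrics of the plane\<close>

lemma compact_Un_inside:
  fixes S :: "'a::euclidean_space set"
  assumes "compact S"
  shows "compact (S \<union> inside S)"
proof -
  have "closed (S \<union> inside S)"
    by (simp add: assms compact_imp_closed closed_Compl open_outside union_with_inside)
  then show ?thesis
    using assms by (simp add: bounded_inside compact_eq_bounded_closed)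
qed

text \<open>The winding number of the triangle is the sum of the winding numbers of its three
  subtriangles, so one of these does not vanish on the inside of the triangle.\<close>

lemma inside_subset_inside_subtriangle:
  fixes \<alpha> \<beta> \<kappa> a b c :: "real \<Rightarrow> complex"
  assumes simple: "simple_path (\<alpha> +++ \<beta> +++ \<kappa>)"
    and paths: "path \<alpha>" "path \<beta>" "path \<kappa>" "path a" "path b" "path c"
    and ends: "pathfinish \<alpha> = pathstart \<beta>" "pathfinish \<beta> = pathstart \<kappa>" "pathfinish \<kappa> = pathstart \<alpha>"
      "pathstart b = pathstart a" "pathstart c = pathstart a"
      "pathfinish a = pathstart \<alpha>" "pathfinish b = pathstart \<beta>" "pathfinish c = pathstart \<kappa>"
    and J: "J = path_image \<alpha> \<union> path_image \<beta> \<union> path_image \<kappa>"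
    and disj: "path_image a \<inter> inside J = {}" "path_image b \<inter> inside J = {}" "path_image c \<inter> inside J = {}"
  shows "inside J \<subseteq> inside (path_image a \<union> path_image \<alpha> \<union> path_image b) \<or>
    inside J \<subseteq> inside (path_image b \<union> path_image \<beta> \<union> path_image c) \<or>
    inside J \<subseteq> inside (path_image c \<union> path_image \<kappa> \<union> path_image a)"
proof -
  let ?j = "\<alpha> +++ \<beta> +++ \<kappa>"
  have Jj: "path_image ?j = J"
    using ends by (simp add: path_image_join J Un_assoc)
  have jloop: "pathfinish ?j = pathstart ?j"
    using ends by simp
  note JIO = Jordan_inside_outside[OF simple jloop, unfolded Jj]
  obtain z where z: "z \<in> inside J" using JIO by blast
  have zJ: "z \<notin> path_image \<alpha>" "z \<notin> path_image \<beta>" "z \<notin> path_image \<kappa>"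
    using z inside_no_overlap[of J] unfolding J by blast+
  have zT: "z \<notin> path_image a" "z \<notin> path_image b" "z \<notin> path_image c"
    using z disj by blast+
  let ?w = "\<lambda>p. winding_number p z"
  have step: "?w (p +++ q +++ reversepath r) = ?w p + ?w q - ?w r"
    if "path p" "path q" "path r" "pathfinish p = pathstart q" "pathfinish q = pathfinish r"
      "z \<notin> path_image p" "z \<notin> path_image q" "z \<notin> path_image r" for p q r
    using that by (simp add: winding_number_join winding_number_reversepath not_in_path_image_join)
  have "?w ?j = ?w \<alpha> + ?w \<beta> + ?w \<kappa>"
    using paths ends zJ by (simp add: winding_number_join not_in_path_image_join)
  moreover have "?w ?j \<noteq> 0"
    using simple_closed_path_winding_number_inside[OF simple] z Jj
    by (metis one_neq_zero zero_neq_neg_one)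
  \<comment> \<open>Each of a, b, c occurs once forwards and once backwards, so their contributions
    cancel and the sum is the winding number of the triangle itself.\<close>
  ultimately have "?w (a +++ \<alpha> +++ reversepath b) + ?w (b +++ \<beta> +++ reversepath c)
      + ?w (c +++ \<kappa> +++ reversepath a) \<noteq> 0"
    using paths ends zJ zT by (simp add: step add.assoc)
  then have nz: "?w (a +++ \<alpha> +++ reversepath b) \<noteq> 0 \<or> ?w (b +++ \<beta> +++ reversepath c) \<noteq> 0
      \<or> ?w (c +++ \<kappa> +++ reversepath a) \<noteq> 0"
    by auto
  have "inside J \<subseteq> inside (path_image p \<union> path_image q \<union> path_image r)"
    if "path p" "path q" "path r" "pathfinish p = pathstart q" "pathfinish q = pathfinish r"
      "pathstart p = pathstart r" "?w (p +++ q +++ reversepath r) \<noteq> 0"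
      "path_image p \<inter> inside J = {}" "path_image r \<inter> inside J = {}" "path_image q \<subseteq> J" for p q r
  proof -
    let ?S = "path_image p \<union> path_image q \<union> path_image r"
    have S: "path_image (p +++ q +++ reversepath r) = ?S"
      using that by (simp add: path_image_join Un_assoc)
    have disjS: "inside J \<inter> ?S = {}"
      using that inside_no_overlap[of J] by blast
    have "z \<notin> outside ?S"
      using winding_number_zero_in_outside[of "p +++ q +++ reversepath r" z] that S by auto
    then have zin: "z \<in> inside ?S"
      using disjS z inside_Un_outside[of ?S] by blast
    show ?thesis
    proof
      fix y assume y: "y \<in> inside J"
      \<comment> \<open>\<open>inside J\<close> is connected and misses the subtriangle: p and r by
        assumption, q as a part of \<open>J\<close>. One point with nonzero winding number therefore
        places all of it inside.\<close>
      have "connected_component (- ?S) z y"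
        unfolding connected_component_def using JIO z y disjS by blast
      then show "y \<in> inside ?S"
        using zin by (rule inside_same_component)
    qed
  qed
  note sub = this
  have "path_image \<alpha> \<subseteq> J" "path_image \<beta> \<subseteq> J" "path_image \<kappa> \<subseteq> J"
    unfolding J by auto
  note im = this
  have ends': "pathfinish \<alpha> = pathfinish b" "pathfinish \<beta> = pathfinish c" "pathfinish \<kappa> = pathfinish a"
    "pathstart a = pathstart b" "pathstart b = pathstart c"
    using ends by simp_all
  show ?thesis
    using nz sub[OF paths(4,1,5) ends(6) ends'(1) ends'(4) _ disj(1,2) im(1)]
      sub[OF paths(5,2,6) ends(7) ends'(2) ends'(5) _ disj(2,3) im(2)]
      sub[OF paths(6,3,4) ends(8) ends'(3) ends(5) _ disj(3,1) im(3)]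
    by argo
qed

text \<open>What is kept of distance and geodesics once the disk is identified with the plane;
  complex numbers, because winding numbers are defined there. The axiom \<open>extend\<close> is
  local: it asks only for points arbitrarily close to \<open>y\<close>, since an open disk need not
  contain long extensions.\<close>

locale geodesic_plane =
  fixes d :: "complex \<Rightarrow> complex \<Rightarrow> real" and g :: "complex \<Rightarrow> complex \<Rightarrow> real \<Rightarrow> complex"
  assumes d_self: "d x x = 0"
    and d_pos: "x \<noteq> y \<Longrightarrow> 0 < d x y"
    and d_sym: "d x y = d y x"
    and d_tri: "d x z \<le> d x y + d y z"
    and d_cont: "continuous_on UNIV (d x)"
    and g_arc: "x \<noteq> y \<Longrightarrow> arc (g x y)"
    and g_start: "pathstart (g x y) = x"
    and g_finish: "pathfinish (g x y) = y"
    and g_sym: "path_image (g x y) = path_image (g y x)"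
    and g_between: "z \<in> path_image (g x y) \<Longrightarrow> d x z + d z y = d x y"
    and nonbranching: "\<lbrakk>y \<in> path_image (g x p); y \<in> path_image (g x q); y \<noteq> x\<rbrakk> \<Longrightarrow>
      p \<in> path_image (g x q) \<or> q \<in> path_image (g x p)"
    and extend: "\<lbrakk>x \<noteq> y; open N; y \<in> N\<rbrakk> \<Longrightarrow> \<exists>y'\<in>N. y' \<noteq> y \<and> d x y' = d x y + d y y'"
begin

section \<open>The sum of the distances to three points of a geodesic plane\<close>

lemma d_nonneg: "0 \<le> d x y"
  using d_self d_pos by (metis less_eq_real_def)

abbreviation seg :: "complex \<Rightarrow> complex \<Rightarrow> complex set" where
  "seg x y \<equiv> path_image (g x y)"

abbreviation tri :: "complex \<Rightarrow> complex \<Rightarrow> complex \<Rightarrow> complex set" where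
  "tri x y z \<equiv> seg x y \<union> seg y z \<union> seg z x"

lemma compact_seg: "x \<noteq> y \<Longrightarrow> compact (seg x y)"
  using g_arc arc_imp_path compact_path_image by blast

text \<open>The geodesic from \<open>x\<close> to \<open>p\<close> is extended until it reaches the boundary of the triangle.\<close>

lemma d_sum_le_of_inside:
  assumes "x \<noteq> y" "y \<noteq> t" "t \<noteq> x" and p: "p \<in> tri t x y \<union> inside (tri t x y)"
  shows "d x p + d p y \<le> d x t + d t y"
proof (cases "p = x")
  case True
  then show ?thesis by (simp add: d_self d_tri)
next
  case False
  let ?S = "tri t x y"
  have compS: "compact ?S"
    using assms by (auto intro!: compact_Un compact_seg)
  \<comment> \<open>The points of the closed triangle that are reached from \<open>x\<close> through
    \<open>p\<close> without detour. A point of \<open>E\<close> farthest from \<open>x\<close>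
    replaces the end of the extended geodesic, so that the extension need not be built as a
    curve.\<close>
  define E where "E = {q \<in> ?S \<union> inside ?S. d x q = d x p + d p q}"
  have "E = (?S \<union> inside ?S) \<inter> {q. d x q = d x p + d p q}"
    unfolding E_def by blast
  moreover have "closed {q. d x q = d x p + d p q}"
    by (intro closed_Collect_eq continuous_intros d_cont)
  ultimately have "compact E"
    using compact_Un_inside[OF compS] by (simp add: compact_Int_closed)
  moreover have "p \<in> E" using p by (simp add: E_def d_self)
  ultimately obtain q where q: "q \<in> E" and qmax: "\<And>r. r \<in> E \<Longrightarrow> d x r \<le> d x q"
    using continuous_attains_sup[of E "d x"] d_cont continuous_on_subset by (metis empty_iff subset_UNIV)
  have qeq: "d x q = d x p + d p q" using q by (simp add: E_def)
  have "q \<notin> inside ?S"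
  proof
    assume qin: "q \<in> inside ?S"
    have "x \<noteq> q" using qeq False d_pos[of x p] d_nonneg[of p q] d_self by force
    then obtain r where r: "r \<in> inside ?S" "r \<noteq> q" "d x r = d x q + d q r"
      using extend[of x q "inside ?S"] qin open_inside compS compact_imp_closed by blast
    \<comment> \<open>A point beyond q is also beyond p: d x r = d x p + d p q + d q r >= d x p + d
      p r >= d x r.\<close>
    have "d x r = d x p + d p r"
      using r(3) qeq d_tri[of p r q] d_tri[of x r p] by linarith
    then have "r \<in> E" using r(1) by (simp add: E_def)
    then show False using qmax r(3) d_pos[of q r] r(2) by fastforce
  qed
  \<comment> \<open>In every case d x p + d p y <= d x q + d q y, and since q lies on a geodesic
    side the right-hand side is at most d x t + d t y.\<close>
  then consider "q \<in> seg t x" | "q \<in> seg x y" | "q \<in> seg y t"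
    using q unfolding E_def by blast
  then show ?thesis
  proof cases
    case 1
    then have "d t q + d q x = d t x" by (rule g_between)
    then show ?thesis
      using qeq d_tri[of p y q] d_tri[of q y t] d_sym[of t x] d_sym[of t q] d_sym[of q x] by linarith
  next
    case 2
    then have "d x q + d q y = d x y" by (rule g_between)
    then show ?thesis using qeq d_tri[of p y q] d_tri[of x y t] by linarith
  next
    case 3
    then have "d y q + d q t = d y t" by (rule g_between)
    then show ?thesis
      using qeq d_tri[of p y q] d_tri[of x q t] d_sym[of y t] d_sym[of y q] d_sym[of q t] by linarith
  qed
qed

text \<open>If y is on the side a b, then y itself is better, as d y a + d y b = d a b <= d a t + d
  t b. If y is on a side from c to e, the geodesics from c to e and to t share y, so one continues
  the other; as t is not on the side, e lies between c and t. Then e is better: d e c = d t c - d t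
  e, and the gain d t e pays for the change of the distance to the third vertex.\<close>

lemma reduce_of_crossing:
  assumes t: "t \<notin> tri a b c" and y: "y \<in> seg t c" "y \<noteq> c" "y \<in> tri a b c"
  shows "\<exists>q\<in>tri a b c. d q a + d q b + d q c \<le> d t a + d t b + d t c"
proof -
  have vert: "a \<in> tri a b c" "b \<in> tri a b c"
    using g_start pathstart_in_path_image by (metis UnI1, metis UnI1 UnI2)
  have case_b: "\<exists>q\<in>tri a b c. d q a + d q b + d q c \<le> d t a + d t b + d t c"
    if "e \<in> {a, b}" "y \<in> seg e c" for e
  proof -
    have "y \<in> seg c e" "y \<in> seg c t" using that(2) y(1) g_sym by blast+
    then have "e \<in> seg c t \<or> t \<in> seg c e" using nonbranching y(2) by blast
    moreover have "seg c e \<subseteq> tri a b c" using that(1) g_sym[of b c] by auto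
    ultimately have "e \<in> seg c t" using t by blast
    then have "d c e + d e t = d c t" by (rule g_between)
    then have "d e a + d e b + d e c \<le> d t a + d t b + d t c"
      using that(1)
    proof (elim insertE emptyE)
      assume e: "e = a"
      show ?thesis
        using \<open>d c e + d e t = d c t\<close>[unfolded e] d_self[of a] d_nonneg[of t a]
          d_tri[of a b t] d_sym[of c a] d_sym[of a t] d_sym[of c t]
        unfolding e by linarith
    next
      assume e: "e = b"
      show ?thesis
        using \<open>d c e + d e t = d c t\<close>[unfolded e] d_self[of b] d_nonneg[of t b]
          d_tri[of b a t] d_sym[of c b] d_sym[of b t] d_sym[of c t]
        unfolding e by linarith
    qed
    then show ?thesis using that(1) vert by blast
  qed
  consider "y \<in> seg a b" | "y \<in> seg b c" | "y \<in> seg c a" using y(3) by blast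
  then show ?thesis
  proof cases
    case 1
    then have "d a y + d y b = d a b" by (rule g_between)
    moreover have "d t y + d y c = d t c" using y(1) by (rule g_between)
    ultimately have "d y a + d y b + d y c \<le> d t a + d t b + d t c"
      using d_tri[of a b t] d_sym[of a y] d_sym[of a t] d_nonneg[of t y] by linarith
    then show ?thesis using y(3) by blast
  next
    case 2
    then show ?thesis using case_b[of b] by simp
  next
    case 3
    then show ?thesis using case_b[of a] g_sym[of c a] by simp
  qed
qed

text \<open>The part of the segment up to a point inside the triangle is connected, starts outside
  at \<open>t\<close>, and could meet the sides only at \<open>v\<close>, which it has not reached;
  it cannot pass from one component of the complement to another.\<close>

lemma seg_disjoint_inside:
  assumes t: "t \<notin> tri a b c \<union> inside (tri a b c)" and meet: "seg t v \<inter> tri a b c \<subseteq> {v}"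
    and comp: "closed (tri a b c)" and v: "v \<in> tri a b c"
  shows "seg t v \<inter> inside (tri a b c) = {}"
proof (rule ccontr)
  let ?J = "tri a b c"
  assume "seg t v \<inter> inside ?J \<noteq> {}"
  then obtain s where s: "s \<in> {0..1}" "g t v s \<in> inside ?J"
    unfolding path_image_def by blast
  have tv: "t \<noteq> v" using t v by blast
  then have arc: "arc (g t v)" by (rule g_arc)
  have "connected (g t v ` {0..s})"
  proof (intro connected_continuous_image connected_Icc)
    have "continuous_on {0..1} (g t v)" using arc by (simp add: arc_def path_def)
    then show "continuous_on {0..s} (g t v)" by (rule continuous_on_subset) (use s(1) in auto)
  qed
  note conn = this
  have "g t v 0 = t" "g t v 1 = v"
    using g_start[of t v] g_finish[of t v] unfolding pathstart_def pathfinish_def by auto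
  have "g t v ` {0..s} \<inter> ?J = {}"
  proof -
    have "g t v r \<notin> ?J" if r: "r \<in> {0..s}" for r
    proof
      assume rJ: "g t v r \<in> ?J"
      have "g t v r \<in> seg t v"
        unfolding path_image_def by (rule imageI) (use r s(1) in simp)
      then have "g t v r \<in> seg t v \<inter> ?J" using rJ by (rule IntI)
      then have "g t v r \<in> {v}" using meet by (rule rev_subsetD)
      then have "g t v r = g t v 1" unfolding \<open>g t v 1 = v\<close> by (rule singletonD)
      moreover have "r \<in> {0..1}" "(1::real) \<in> {0..1}" using r s(1) by auto
      ultimately have "r = 1" using arc unfolding arc_def by (meson inj_onD)
      then have "s = 1" using r s(1) by simp
      then show False using s(2) rJ \<open>r = 1\<close> inside_no_overlap[of ?J] by blast
    qed
    then show ?thesis by blast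
  qed
  then have "g t v ` {0..s} \<subseteq> - ?J" by blast
  moreover have "g t v 0 \<in> g t v ` {0..s}" "g t v s \<in> g t v ` {0..s}" using s(1) by simp_all
  ultimately have "connected_component (- ?J) (g t v s) t"
    unfolding connected_component_def \<open>g t v 0 = t\<close> using conn by blast
  then show False using inside_same_component s(2) t by blast
qed

theorem sum_of_distances_minimal_in_triangle:
  assumes ne: "a \<noteq> b" "b \<noteq> c" "c \<noteq> a"
    and meet: "seg a b \<inter> seg b c = {b}" "seg b c \<inter> seg c a = {c}" "seg c a \<inter> seg a b = {a}"
  shows "\<exists>q\<in>tri a b c \<union> inside (tri a b c). \<forall>t. d q a + d q b + d q c \<le> d t a + d t b + d t c"
proof -
  let ?J = "tri a b c" and ?f = "\<lambda>q. d q a + d q b + d q c"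
  have compJ: "compact ?J" using ne by (auto intro!: compact_Un compact_seg)
  have contf: "continuous_on (?J \<union> inside ?J) ?f"
  proof -
    have "continuous_on (?J \<union> inside ?J) (\<lambda>q. d q x)" for x
    proof -
      have "(\<lambda>q. d q x) = d x" by (rule ext) (rule d_sym)
      then show ?thesis by (metis continuous_on_subset d_cont subset_UNIV)
    qed
    then show ?thesis by (intro continuous_intros)
  qed
  have vert: "a \<in> ?J" "b \<in> ?J" "c \<in> ?J"
    using g_start pathstart_in_path_image by (metis UnI1, metis UnI1 UnI2, metis UnI2)
  then obtain q where q: "q \<in> ?J \<union> inside ?J" "\<And>t. t \<in> ?J \<union> inside ?J \<Longrightarrow> ?f q \<le> ?f t"
    using continuous_attains_inf[OF compact_Un_inside[OF compJ] _ contf] by blast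
  have simple: "simple_path (g a b +++ g b c +++ g c a)"
  proof (intro simple_path_join_loop arc_join g_arc ne)
    show "seg b c \<inter> seg c a \<subseteq> {pathstart (g c a)}"
      using meet by (simp add: g_start)
    have "seg a b \<inter> (seg b c \<union> seg c a) \<subseteq> {a, b}" using meet by blast
    then show "seg a b \<inter> path_image (g b c +++ g c a) \<subseteq> {pathstart (g a b), pathstart (g b c +++ g c a)}"
      by (simp add: g_start g_finish path_image_join)
  qed (simp_all add: g_start g_finish)
  have loop: "pathfinish (g a b +++ g b c +++ g c a) = pathstart (g a b +++ g b c +++ g c a)"
    by (simp add: g_start g_finish)
  have "\<exists>r\<in>?J \<union> inside ?J. ?f r \<le> ?f t" if t: "t \<notin> ?J \<union> inside ?J" for t
  proof -
    have perm: "tri b c a = ?J" "tri c a b = ?J" by blast+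
    have tJ: "t \<notin> ?J" using t by blast
    then have tne: "t \<noteq> a" "t \<noteq> b" "t \<noteq> c" using vert by blast+
    have tJ': "t \<notin> tri b c a" "t \<notin> tri c a b" unfolding perm using tJ by auto
    \<comment> \<open>Either one of the geodesics from \<open>t\<close> meets the triangle before
      its vertex, which is \<open>reduce_of_crossing\<close> up to a cyclic relabelling, or all
      three arrive from outside.\<close>
    consider y where "y \<in> seg t c" "y \<noteq> c" "y \<in> ?J" | y where "y \<in> seg t a" "y \<noteq> a" "y \<in> ?J"
      | y where "y \<in> seg t b" "y \<noteq> b" "y \<in> ?J"
      | "seg t a \<inter> ?J \<subseteq> {a}" "seg t b \<inter> ?J \<subseteq> {b}" "seg t c \<inter> ?J \<subseteq> {c}"
      by blast
    then show ?thesis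
    proof cases
      case 1
      from reduce_of_crossing[OF tJ this] show ?thesis by blast
    next
      case 2
      then have "\<exists>r\<in>?J. d r b + d r c + d r a \<le> d t b + d t c + d t a"
        using reduce_of_crossing[OF tJ'(1), of y] unfolding perm by simp
      then show ?thesis by (auto simp: add_ac)
    next
      case 3
      then have "\<exists>r\<in>?J. d r c + d r a + d r b \<le> d t c + d t a + d t b"
        using reduce_of_crossing[OF tJ'(2), of y] unfolding perm by simp
      then show ?thesis by (auto simp: add_ac)
    next
      case 4
      have disj: "seg t a \<inter> inside ?J = {}" "seg t b \<inter> inside ?J = {}" "seg t c \<inter> inside ?J = {}"
        using seg_disjoint_inside[OF t 4(1) compact_imp_closed[OF compJ] vert(1)]
          seg_disjoint_inside[OF t 4(2) compact_imp_closed[OF compJ] vert(2)]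
          seg_disjoint_inside[OF t 4(3) compact_imp_closed[OF compJ] vert(3)] by auto
      \<comment> \<open>The winding number argument speaks of the open inside only. The vertices are
        reached as limits: the triangle is the frontier of its inside, and a closed subtriangle
        contains its limits.\<close>
      have vcl: "v \<in> closure (inside ?J)" if "v \<in> ?J" for v
      proof -
        have "frontier (inside ?J) = ?J"
          using Jordan_inside_outside[OF simple loop]
          by (simp add: path_image_join g_start g_finish Un_assoc)
        then show ?thesis using that by (auto simp: frontier_def)
      qed
      have key: "v \<in> tri t x y \<union> inside (tri t x y)"
        if "inside ?J \<subseteq> inside (seg t x \<union> seg x y \<union> seg t y)" "v \<in> ?J" "x \<noteq> y" "t \<noteq> x" "t \<noteq> y" for v x y
      proof -
        have "closed (tri t x y \<union> inside (tri t x y))"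
          using that(3-) by (intro compact_imp_closed compact_Un_inside compact_Un compact_seg) auto
        moreover have "inside ?J \<subseteq> inside (tri t x y)" using that(1) g_sym[of t y] by simp
        ultimately have "closure (inside ?J) \<subseteq> tri t x y \<union> inside (tri t x y)"
          by (intro closure_minimal le_supI2)
        then show ?thesis using vcl[OF that(2)] by (rule subsetD)
      qed
      have p: "path (g x y)" if "x \<noteq> y" for x y
        using that by (intro arc_imp_path g_arc)
      have "inside ?J \<subseteq> inside (seg t a \<union> seg a b \<union> seg t b) \<or>
          inside ?J \<subseteq> inside (seg t b \<union> seg b c \<union> seg t c) \<or>
          inside ?J \<subseteq> inside (seg t c \<union> seg c a \<union> seg t a)"
        by (rule inside_subset_inside_subtriangle[OF simple p[OF ne(1)] p[OF ne(2)] p[OF ne(3)]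
            p[OF tne(1)] p[OF tne(2)] p[OF tne(3)] _ _ _ _ _ _ _ _ refl disj])
          (simp_all add: g_start g_finish)
      then show ?thesis
      proof (elim disjE)
        assume "inside ?J \<subseteq> inside (seg t a \<union> seg a b \<union> seg t b)"
        from key[OF this vert(3) ne(1) tne(1,2)] have "d a c + d c b \<le> d a t + d t b"
          by (rule d_sum_le_of_inside[OF ne(1) tne(2)[symmetric] tne(1)])
        then have "?f c \<le> ?f t" using d_self[of c] d_nonneg[of t c] d_sym[of a c] d_sym[of a t] by linarith
        then show ?thesis using vert by blast
      next
        assume "inside ?J \<subseteq> inside (seg t b \<union> seg b c \<union> seg t c)"
        from key[OF this vert(1) ne(2) tne(2,3)] have "d b a + d a c \<le> d b t + d t c"
          by (rule d_sum_le_of_inside[OF ne(2) tne(3)[symmetric] tne(2)])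
        then have "?f a \<le> ?f t" using d_self[of a] d_nonneg[of t a] d_sym[of a b] d_sym[of b t] by linarith
        then show ?thesis using vert by blast
      next
        assume "inside ?J \<subseteq> inside (seg t c \<union> seg c a \<union> seg t a)"
        from key[OF this vert(2) ne(3) tne(3,1)] have "d c b + d b a \<le> d c t + d t a"
          by (rule d_sum_le_of_inside[OF ne(3) tne(1)[symmetric] tne(3)])
        then have "?f b \<le> ?f t" using d_self[of b] d_nonneg[of t b] d_sym[of c b] d_sym[of c t] by linarith
        then show ?thesis using vert by blast
      qed
    qed
  qed
  then have "?f q \<le> ?f t" for t using q(2) by (meson order_trans)
  then show ?thesis using q(1) by blast
qed

end

section \<open>Christoffel symbols\<close>

text \<open>The constant is left existential so that the closure rules below can be chained along
  the formula of the Christoffel symbols without tracking constants.\<close>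

definition lip :: "'a::euclidean_space set \<Rightarrow> ('a \<Rightarrow> 'b::real_normed_vector) \<Rightarrow> bool" where
  "lip S f \<longleftrightarrow> (\<exists>L. L-lipschitz_on S f)"

lemma lip_bounded:
  assumes "compact S" "lip S f"
  obtains B where "0 \<le> B" "\<And>x. x \<in> S \<Longrightarrow> norm (f x) \<le> B"
proof -
  have "bounded (f ` S)"
    using assms lipschitz_on_continuous_on compact_continuous_image compact_imp_bounded
    unfolding lip_def by blast
  then show ?thesis using that unfolding bounded_pos by (metis imageI less_imp_le)
qed

lemma lipI: "(\<And>x y. x \<in> S \<Longrightarrow> y \<in> S \<Longrightarrow> norm (f x - f y) \<le> L * norm (x - y)) \<Longrightarrow> lip S f"
  unfolding lip_def
  by (rule exI[of _ "\<bar>L\<bar>"], rule lipschitz_onI)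
    (auto simp: dist_norm intro: order_trans[OF _ mult_right_mono[OF abs_ge_self]])

lemma lip_const: "lip S (\<lambda>x. a)"
  unfolding lip_def using lipschitz_on_constant by blast

lemma lip_add: "lip S f \<Longrightarrow> lip S g \<Longrightarrow> lip S (\<lambda>x. f x + g x)"
  unfolding lip_def using lipschitz_on_add by blast

lemma lip_minus: "lip S f \<Longrightarrow> lip S (\<lambda>x. - f x)"
  unfolding lip_def using lipschitz_on_minus by blast

lemma lip_diff: "lip S f \<Longrightarrow> lip S g \<Longrightarrow> lip S (\<lambda>x. f x - g x)"
  unfolding lip_def using lipschitz_on_diff by blast

lemma lip_sum: "(\<And>i. i \<in> I \<Longrightarrow> lip S (f i)) \<Longrightarrow> lip S (\<lambda>x. \<Sum>i\<in>I. f i x)"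
  by (induction I rule: infinite_finite_induct) (auto intro: lip_const lip_add)

lemma lip_nth: "lip S f \<Longrightarrow> lip S (\<lambda>x. f x $ i)" for f :: "_ \<Rightarrow> ('b::real_normed_vector)^'n"
proof -
  assume "lip S f"
  then obtain L where L: "L-lipschitz_on S f" unfolding lip_def by blast
  show ?thesis
  proof (rule lipI[of _ _ L])
    fix x y assume "x \<in> S" "y \<in> S"
    have "norm (f x $ i - f y $ i) \<le> norm (f x - f y)" by (metis Finite_Cartesian_Product.norm_nth_le vector_minus_component)
    also have "\<dots> \<le> L * norm (x - y)" using L \<open>x \<in> S\<close> \<open>y \<in> S\<close> by (auto simp: lipschitz_on_def dist_norm)
    finally show "norm (f x $ i - f y $ i) \<le> L * norm (x - y)" .
  qed
qed

lemma lip_mult: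
  fixes f g :: "'a::euclidean_space \<Rightarrow> real"
  assumes S: "compact S" and f: "lip S f" and g: "lip S g"
  shows "lip S (\<lambda>x. f x * g x)"
proof -
  obtain L1 L2 where L: "L1-lipschitz_on S f" "L2-lipschitz_on S g" using f g unfolding lip_def by blast
  obtain B1 where B1: "0 \<le> B1" "\<And>x. x \<in> S \<Longrightarrow> norm (f x) \<le> B1" using lip_bounded[OF S f] by blast
  obtain B2 where B2: "0 \<le> B2" "\<And>x. x \<in> S \<Longrightarrow> norm (g x) \<le> B2" using lip_bounded[OF S g] by blast
  show ?thesis
  proof (rule lipI[of _ _ "L1 * B2 + B1 * L2"])
    fix x y assume xy: "x \<in> S" "y \<in> S"
    have d: "\<bar>f x - f y\<bar> \<le> L1 * norm (x - y)" "\<bar>g x - g y\<bar> \<le> L2 * norm (x - y)" "0 \<le> L1" "0 \<le> L2"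
      using L xy by (auto simp: lipschitz_on_def dist_norm)
    have "f x * g x - f y * g y = (f x - f y) * g x + f y * (g x - g y)" by (simp add: algebra_simps)
    then have "\<bar>f x * g x - f y * g y\<bar> \<le> \<bar>f x - f y\<bar> * \<bar>g x\<bar> + \<bar>f y\<bar> * \<bar>g x - g y\<bar>"
      by (metis abs_mult abs_triangle_ineq)
    also have "\<dots> \<le> (L1 * norm (x - y)) * B2 + B1 * (L2 * norm (x - y))"
      using d B1 B2 xy by (intro add_mono mult_mono) auto
    finally show "norm (f x * g x - f y * g y) \<le> (L1 * B2 + B1 * L2) * norm (x - y)"
      by (simp add: algebra_simps)
  qed
qed

lemma lip_inverse:
  fixes f :: "'a::euclidean_space \<Rightarrow> real"
  assumes S: "compact S" and f: "lip S f" and nz: "\<And>x. x \<in> S \<Longrightarrow> f x \<noteq> 0"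
  shows "lip S (\<lambda>x. inverse (f x))"
proof -
  obtain L where L: "L-lipschitz_on S f" using f unfolding lip_def by blast
  have "continuous_on S (\<lambda>x. inverse (f x))"
    using L nz lipschitz_on_continuous_on by (intro continuous_intros) auto
  then have "bounded ((\<lambda>x. inverse (f x)) ` S)"
    using S compact_continuous_image compact_imp_bounded by blast
  then obtain B where B: "0 < B" "\<And>x. x \<in> S \<Longrightarrow> \<bar>inverse (f x)\<bar> \<le> B"
    unfolding bounded_pos by auto
  show ?thesis
  proof (rule lipI[of _ _ "B * L * B"])
    fix x y assume xy: "x \<in> S" "y \<in> S"
    have d: "\<bar>f y - f x\<bar> \<le> L * norm (x - y)" "0 \<le> L"
      using L xy by (auto simp: lipschitz_on_def dist_norm norm_minus_commute)
    have "inverse (f x) - inverse (f y) = inverse (f x) * (f y - f x) * inverse (f y)"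
      using nz xy by (simp add: field_simps)
    then have "norm (inverse (f x) - inverse (f y)) = \<bar>inverse (f x)\<bar> * \<bar>f y - f x\<bar> * \<bar>inverse (f y)\<bar>"
      by (simp add: abs_mult)
    also have "\<dots> \<le> B * (L * norm (x - y)) * B"
      using d B xy by (intro mult_mono) auto
    finally show "norm (inverse (f x) - inverse (f y)) \<le> B * L * B * norm (x - y)"
      by (simp add: algebra_simps)
  qed
qed

text \<open>\<open>Ck_on\<close> controls the derivative in each fixed direction only, so its
  operator norm is bounded through the finitely many basis directions, each bounded by compactness.
  The mean value inequality on the convex set then applies.\<close>

lemma lip_of_Ck:
  fixes f :: "'a::euclidean_space \<Rightarrow> 'b::real_normed_vector"
  assumes f: "Ck_on (Suc k) T f" and S: "compact S" "convex S" "S \<subseteq> T"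
  shows "lip S f"
proof -
  let ?D = "\<lambda>x. frechet_derivative f (at x)"
  have der: "(f has_derivative ?D x) (at x)" if "x \<in> S" for x
    using f S(3) that frechet_derivative_works by auto
  have Ck: "Ck_on k T (\<lambda>x. ?D x v)" for v using f by auto
  have cont: "continuous_on T (\<lambda>x. ?D x v)" for v
  proof (cases k)
    case 0
    then show ?thesis using Ck[of v] by simp
  next
    case (Suc l)
    then have "\<forall>x\<in>T. (\<lambda>x. ?D x v) differentiable (at x)" using Ck[of v] by simp
    then show ?thesis
      by (intro continuous_at_imp_continuous_on ballI differentiable_imp_continuous_within) auto
  qed
  have "\<exists>B. \<forall>x\<in>S. norm (?D x v) \<le> B" for v
  proof -
    have "bounded ((\<lambda>x. ?D x v) ` S)"
      using continuous_on_subset[OF cont S(3)] S(1) compact_continuous_image compact_imp_bounded by blast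
    then show ?thesis unfolding bounded_iff by blast
  qed
  then obtain B where B: "\<And>v x. x \<in> S \<Longrightarrow> norm (?D x v) \<le> B v" by metis
  let ?L = "\<Sum>b\<in>Basis. \<bar>B b\<bar>"
  have "onorm (?D x) \<le> ?L" if x: "x \<in> S" for x
  proof (rule onorm_le)
    fix h
    have lin: "linear (?D x)" using der[OF x] has_derivative_linear by blast
    have "?D x h = ?D x (\<Sum>b\<in>Basis. (h \<bullet> b) *\<^sub>R b)" by (simp add: euclidean_representation)
    also have "\<dots> = (\<Sum>b\<in>Basis. (h \<bullet> b) *\<^sub>R ?D x b)"
      by (simp add: linear_sum[OF lin] linear_scale[OF lin])
    finally have "?D x h = (\<Sum>b\<in>Basis. (h \<bullet> b) *\<^sub>R ?D x b)" .
    then have "norm (?D x h) \<le> (\<Sum>b\<in>Basis. norm ((h \<bullet> b) *\<^sub>R ?D x b))" by (metis norm_sum)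
    also have "\<dots> \<le> (\<Sum>b\<in>Basis. norm h * \<bar>B b\<bar>)"
    proof (rule sum_mono)
      fix b :: 'a assume b: "b \<in> Basis"
      have "norm (?D x b) \<le> \<bar>B b\<bar>" using B[OF x, of b] by linarith
      then show "norm ((h \<bullet> b) *\<^sub>R ?D x b) \<le> norm h * \<bar>B b\<bar>"
        using Basis_le_norm[OF b, of h] by (auto intro: mult_mono)
    qed
    finally show "norm (?D x h) \<le> ?L * norm h" by (simp add: sum_distrib_left mult.commute)
  qed
  then have "norm (f x - f y) \<le> ?L * norm (x - y)" if "x \<in> S" "y \<in> S" for x y
    using that der by (intro differentiable_bound[OF S(2)]) (auto intro: has_derivative_at_withinI)
  then show ?thesis by (rule lipI)
qed

lemma frechet_derivative_nth:
  fixes f :: "'a::real_normed_vector \<Rightarrow> ('b::real_normed_vector)^'n"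
  assumes "f differentiable (at x)"
  shows "frechet_derivative (\<lambda>y. f y $ i) (at x) v = frechet_derivative f (at x) v $ i"
proof -
  have "(f has_derivative frechet_derivative f (at x)) (at x)"
    using assms frechet_derivative_works by blast
  then have "((\<lambda>y. f y $ i) has_derivative (\<lambda>v. frechet_derivative f (at x) v $ i)) (at x)"
    by (rule bounded_linear.has_derivative[OF bounded_linear_vec_nth])
  then show ?thesis using frechet_derivative_at by metis
qed

lemma matrix_inv_2:
  fixes A :: "real^2^2"
  assumes "det A \<noteq> 0"
  shows "matrix_inv A $ 1 $ 1 = A $ 2 $ 2 * inverse (det A)"
    "matrix_inv A $ 2 $ 2 = A $ 1 $ 1 * inverse (det A)"
    "matrix_inv A $ 1 $ 2 = - A $ 1 $ 2 * inverse (det A)"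
    "matrix_inv A $ 2 $ 1 = - A $ 2 $ 1 * inverse (det A)"
proof -
  define e where "e = inverse (det A)"
  have e: "A $ 1 $ 1 * A $ 2 $ 2 * e - A $ 1 $ 2 * A $ 2 $ 1 * e = 1"
    using assms unfolding e_def det_2 left_diff_distrib[symmetric] by (rule right_inverse)
  \<comment> \<open>The adjugate divided by the determinant. As \<open>matrix_inv\<close> is a
    chosen two-sided inverse, it is identified with \<open>B\<close> by uniqueness of
    inverses.\<close>
  define B :: "real^2^2" where "B = (\<chi> i j. e *
     (if i = 1 \<and> j = 1 then A $ 2 $ 2 else if i = 2 \<and> j = 2 then A $ 1 $ 1 else - A $ i $ j))"
  have "A ** B = mat 1" "B ** A = mat 1"
    using e by (simp_all add: vec_eq_iff forall_2 matrix_matrix_mult_def sum_2 B_def mat_def algebra_simps)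
  note B = this
  have "A ** matrix_inv A = mat 1 \<and> matrix_inv A ** A = mat 1"
    unfolding matrix_inv_def by (rule someI[of _ B]) (simp add: B)
  then have "matrix_inv A = B"
    using B by (metis matrix_mul_assoc matrix_mul_lid matrix_mul_rid)
  then show "matrix_inv A $ 1 $ 1 = A $ 2 $ 2 * inverse (det A)"
    "matrix_inv A $ 2 $ 2 = A $ 1 $ 1 * inverse (det A)"
    "matrix_inv A $ 1 $ 2 = - A $ 1 $ 2 * inverse (det A)"
    "matrix_inv A $ 2 $ 1 = - A $ 2 $ 1 * inverse (det A)"
    by (simp_all add: B_def e_def)
qed

lemma lip_christoffel:
  fixes G :: "real^2 \<Rightarrow> real^2^2"
  assumes G: "smooth_on T G" and S: "compact S" "convex S" "S \<subseteq> T" and det: "\<And>x. x \<in> S \<Longrightarrow> det (G x) \<noteq> 0"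
  shows "lip S (christoffel G k i j)"
proof -
  have "Ck_on (Suc 0) T G" using G unfolding smooth_on_def by blast
  then have lG: "lip S (\<lambda>x. G x $ a $ b)" for a b
    using S by (intro lip_nth lip_of_Ck)
  have "lip S (\<lambda>x. inverse (det (G x)))"
    unfolding det_2 by (intro lip_inverse lip_diff lip_mult lG S(1)) (use det in \<open>simp add: det_2\<close>)
  note linv = this
  have lI: "lip S (\<lambda>x. matrix_inv (G x) $ a $ b)" for a b
  proof -
    have cong: "lip S f" if "lip S g" "\<And>x. x \<in> S \<Longrightarrow> f x = g x" for f g :: "real^2 \<Rightarrow> real"
      using that unfolding lip_def lipschitz_on_def by auto
    have "a = 1 \<or> a = 2" "b = 1 \<or> b = 2" using exhaust_2 by blast+
    then show ?thesis
      by (elim disjE)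
        (auto intro!: cong[OF _ matrix_inv_2(1)[OF det]] cong[OF _ matrix_inv_2(2)[OF det]]
          cong[OF _ matrix_inv_2(3)[OF det]] cong[OF _ matrix_inv_2(4)[OF det]]
          lip_mult[OF S(1)] lip_minus lG linv)
  qed
  \<comment> \<open>Smoothness is a property of the matrix-valued \<open>G\<close>, whereas
    \<open>pderiv_coord\<close> differentiates a single coefficient; they agree because taking a
    coefficient is linear. A Lipschitz first derivative is obtained from a second one.\<close>
  have lP: "lip S (pderiv_coord m (\<lambda>y. G y $ a $ b))" for m a b
  proof -
    have C2: "Ck_on (Suc (Suc 0)) T G" using G unfolding smooth_on_def by blast
    then have "lip S (\<lambda>x. frechet_derivative G (at x) (axis m 1))"
      using S by (intro lip_of_Ck[where k = 0]) auto
    then have l: "lip S (\<lambda>x. frechet_derivative G (at x) (axis m 1) $ a $ b)" by (intro lip_nth)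
    have "pderiv_coord m (\<lambda>y. G y $ a $ b) x = frechet_derivative G (at x) (axis m 1) $ a $ b" if "x \<in> S" for x
    proof -
      have d: "G differentiable (at x)" using C2 S(3) that by auto
      then have "(\<lambda>y. G y $ a) differentiable (at x)"
        using bounded_linear.has_derivative[OF bounded_linear_vec_nth] unfolding differentiable_def by blast
      then show ?thesis
        unfolding pderiv_coord_def by (simp add: frechet_derivative_nth d)
    qed
    then show ?thesis using l unfolding lip_def lipschitz_on_def by auto
  qed
  have "christoffel G k i j = (\<lambda>x. (\<Sum>l\<in>UNIV. matrix_inv (G x) $ k $ l *
        (pderiv_coord i (\<lambda>y. G y $ j $ l) x + pderiv_coord j (\<lambda>y. G y $ i $ l) x
          - pderiv_coord l (\<lambda>y. G y $ i $ j) x)) * (1/2))"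
    by (rule ext) (simp add: christoffel_def)
  note eq = this
  show ?thesis
    unfolding eq by (intro lip_mult[OF S(1)] lip_sum lip_diff lip_add lI lP lip_const)
qed

section \<open>The geodesic equation as an equation of quadratic type\<close>

definition geodesic_rhs :: "(real^2 \<Rightarrow> real^2^2) \<Rightarrow> real^2 \<Rightarrow> real^2 \<Rightarrow> real^2" where
  "geodesic_rhs G x v = (\<chi> k. - (\<Sum>i\<in>UNIV. \<Sum>j\<in>UNIV. christoffel G k i j x * v $ i * v $ j))"

lemma geodesic_rhs_zero: "geodesic_rhs G x 0 = 0"
  by (simp add: geodesic_rhs_def vec_eq_iff)

lemma geodesic_rhs_scale: "geodesic_rhs G x (a *\<^sub>R v) = (a * a) *\<^sub>R geodesic_rhs G x v"
  by (simp add: geodesic_rhs_def vec_eq_iff sum_distrib_left algebra_simps)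

text \<open>Each product of a Christoffel symbol and two velocity components is changed one factor
  at a time: a change of the point costs the Lipschitz constant of the symbol times m^2, a change of
  either velocity costs the bound of the symbol times m.\<close>

lemma quadratic_ode_geodesic_rhs:
  fixes G :: "real^2 \<Rightarrow> real^2^2"
  assumes G: "smooth_on T G" and S: "compact S" "convex S" "S \<subseteq> T" and det: "\<And>x. x \<in> S \<Longrightarrow> det (G x) \<noteq> 0"
  shows "\<exists>K. quadratic_ode (geodesic_rhs G) S K"
proof -
  note lc = lip_christoffel[OF assms]
  have "\<exists>L. \<forall>k i j. 0 \<le> L k i j \<and> (\<forall>x\<in>S. \<forall>y\<in>S. \<bar>christoffel G k i j x - christoffel G k i j y\<bar> \<le> L k i j * norm (x - y))"
    using lc unfolding lip_def lipschitz_on_def dist_norm real_norm_def by metis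
  then obtain L where L: "\<And>k i j. 0 \<le> L k i j"
    "\<And>k i j x y. x \<in> S \<Longrightarrow> y \<in> S \<Longrightarrow> \<bar>christoffel G k i j x - christoffel G k i j y\<bar> \<le> L k i j * norm (x - y)"
    by blast
  have "\<exists>B. \<forall>k i j. 0 \<le> B k i j \<and> (\<forall>x\<in>S. \<bar>christoffel G k i j x\<bar> \<le> B k i j)"
  proof -
    have "\<exists>B\<ge>0. \<forall>x\<in>S. \<bar>christoffel G k i j x\<bar> \<le> B" for k i j
      using lip_bounded[OF S(1) lc[of k i j]] by (metis real_norm_def)
    then show ?thesis by metis
  qed
  then obtain B where B: "\<And>k i j. 0 \<le> B k i j" "\<And>k i j x. x \<in> S \<Longrightarrow> \<bar>christoffel G k i j x\<bar> \<le> B k i j"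
    by blast
  \<comment> \<open>Components and index pairs are estimated separately and added up; the 2 counts
    the two velocity factors.\<close>
  define K where "K = (\<Sum>k\<in>UNIV. \<Sum>i\<in>UNIV. \<Sum>j\<in>UNIV. L k i j + 2 * B k i j)"
  have "norm (geodesic_rhs G x v - geodesic_rhs G y w) \<le> K * (m\<^sup>2 * norm (x - y) + m * norm (v - w))"
    if xy: "x \<in> S" "y \<in> S" and vw: "norm v \<le> m" "norm w \<le> m" for x y v w m
  proof -
    let ?e = "m\<^sup>2 * norm (x - y) + m * norm (v - w)"
    have m: "0 \<le> m" using vw(1) norm_ge_zero order_trans by blast
    have t: "\<bar>christoffel G k i j x * v $ i * v $ j - christoffel G k i j y * w $ i * w $ j\<bar>
        \<le> (L k i j + 2 * B k i j) * ?e" for k i j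
    proof -
      have c: "\<bar>v $ i\<bar> \<le> m" "\<bar>v $ j\<bar> \<le> m" "\<bar>w $ i\<bar> \<le> m" "\<bar>w $ j\<bar> \<le> m"
        using vw component_le_norm_cart order_trans by blast+
      have cd: "\<bar>v $ i - w $ i\<bar> \<le> norm (v - w)" "\<bar>v $ j - w $ j\<bar> \<le> norm (v - w)"
        using component_le_norm_cart[of "v - w"] by (metis vector_minus_component)+
      have "christoffel G k i j x * v $ i * v $ j - christoffel G k i j y * w $ i * w $ j =
          (christoffel G k i j x - christoffel G k i j y) * (v $ i * v $ j)
          + christoffel G k i j y * ((v $ i - w $ i) * v $ j + w $ i * (v $ j - w $ j))"
        by (simp add: algebra_simps)
      also have "\<bar>\<dots>\<bar> \<le> \<bar>christoffel G k i j x - christoffel G k i j y\<bar> * (\<bar>v $ i\<bar> * \<bar>v $ j\<bar>)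
          + \<bar>christoffel G k i j y\<bar> * (\<bar>v $ i - w $ i\<bar> * \<bar>v $ j\<bar> + \<bar>w $ i\<bar> * \<bar>v $ j - w $ j\<bar>)"
        unfolding abs_mult[symmetric]
        by (rule order_trans[OF abs_triangle_ineq add_left_mono])
          (simp add: abs_mult, intro mult_left_mono order_trans[OF abs_triangle_ineq], auto simp: abs_mult)
      also have "\<dots> \<le> (L k i j * norm (x - y)) * (m * m) + B k i j * (norm (v - w) * m + m * norm (v - w))"
        using L(1)[of k i j] L(2)[OF xy, of k i j] B(1)[of k i j] B(2)[OF xy(2), of k i j] c cd m
        by (intro add_mono mult_mono add_nonneg_nonneg mult_nonneg_nonneg) auto
      also have "\<dots> = L k i j * (m\<^sup>2 * norm (x - y)) + 2 * B k i j * (m * norm (v - w))"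
        by (simp add: power2_eq_square algebra_simps)
      also have "\<dots> \<le> L k i j * ?e + 2 * B k i j * ?e"
        using L(1)[of k i j] B(1)[of k i j] m by (intro add_mono mult_left_mono) auto
      finally show ?thesis by (simp add: algebra_simps)
    qed
    have "norm (geodesic_rhs G x v - geodesic_rhs G y w) \<le>
        (\<Sum>k\<in>UNIV. \<bar>(geodesic_rhs G x v - geodesic_rhs G y w) $ k\<bar>)"
      by (rule norm_le_l1_cart)
    also have "\<dots> \<le> (\<Sum>k\<in>UNIV. \<Sum>i\<in>UNIV. \<Sum>j\<in>UNIV. (L k i j + 2 * B k i j) * ?e)"
    proof (rule sum_mono)
      fix k :: 2
      have "(geodesic_rhs G x v - geodesic_rhs G y w) $ k = - (\<Sum>i\<in>UNIV. \<Sum>j\<in>UNIV.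
          christoffel G k i j x * v $ i * v $ j - christoffel G k i j y * w $ i * w $ j)"
        by (simp add: geodesic_rhs_def sum_subtractf)
      also have "\<bar>\<dots>\<bar> \<le> (\<Sum>i\<in>UNIV. \<bar>\<Sum>j\<in>UNIV.
          christoffel G k i j x * v $ i * v $ j - christoffel G k i j y * w $ i * w $ j\<bar>)"
        unfolding abs_minus_cancel by (rule sum_abs)
      also have "\<dots> \<le> (\<Sum>i\<in>UNIV. \<Sum>j\<in>UNIV. (L k i j + 2 * B k i j) * ?e)"
        by (intro sum_mono order_trans[OF sum_abs] t)
      finally show "\<bar>(geodesic_rhs G x v - geodesic_rhs G y w) $ k\<bar> \<le> (\<Sum>i\<in>UNIV. \<Sum>j\<in>UNIV. (L k i j + 2 * B k i j) * ?e)" .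
    qed
    also have "\<dots> = K * ?e" unfolding K_def by (simp add: sum_distrib_right)
    finally show ?thesis .
  qed
  moreover have "0 \<le> K" unfolding K_def using L(1) B(1) by (intro sum_nonneg add_nonneg_nonneg) auto
  ultimately show ?thesis
    by (intro exI[of _ K] quadratic_ode.intro) (auto simp: geodesic_rhs_zero)
qed

section \<open>Curves and charts\<close>

text \<open>The length of a vector in an arbitrary chart; \<open>tangent_norm\<close> is the case of
  the chart chosen at the point. Estimates along a curve need one fixed chart, whereas the chosen
  one may change from point to point.\<close>

definition gnorm :: "'a surface \<Rightarrow> 'a chart \<Rightarrow> real^2 \<Rightarrow> real^2 \<Rightarrow> real" where
  "gnorm M c x w = sqrt (w \<bullet> (gcoeff M c x *v w))"

definition speed :: "'a surface \<Rightarrow> (real \<Rightarrow> 'a) \<Rightarrow> real \<Rightarrow> real" where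
  "speed M \<sigma> t = tangent_norm M (\<sigma> t) (velocity M \<sigma> t)"

lemma curve_length_eq: "curve_length M \<sigma> = integral {0..1} (speed M \<sigma>)"
  unfolding curve_length_def speed_def ..

lemma inner_matrix_congruence:
  fixes A :: "real^2^2"
  shows "w \<bullet> ((transpose J ** A ** J) *v w) = (J *v w) \<bullet> (A *v (J *v w))"
proof -
  have "w \<bullet> ((transpose J ** A ** J) *v w) = ((A *v (J *v w)) v* J) \<bullet> w"
    by (simp add: matrix_vector_mul_assoc[symmetric] matrix_mul_assoc[symmetric]
        transpose_matrix_vector inner_commute[of w])
  also have "\<dots> = (A *v (J *v w)) \<bullet> (J *v w)" by (rule dot_lmul_matrix)
  finally show ?thesis by (simp add: inner_commute)
qed

text \<open>Curves are differentiated within closed parameter intervals that are mapped into one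
  chart. Around \<open>t\<close> such an interval exists by continuity, and near \<open>t\<close>
  the derivative within it is the derivative within the unit interval, also when \<open>t\<close> is
  an end point.\<close>

lemma local_interval:
  fixes \<sigma> :: "real \<Rightarrow> 'a::topological_space"
  assumes "continuous_on {0..1} \<sigma>" "t \<in> {0..1}" "open N" "\<sigma> t \<in> N"
  obtains \<delta> a b where "0 < \<delta>" "0 \<le> a" "b \<le> 1" "a < b" "a \<le> t" "t \<le> b"
    "\<sigma> ` {a..b} \<subseteq> N" "0 < t \<Longrightarrow> a < t" "t < 1 \<Longrightarrow> t < b"
    "\<And>r. r \<in> {0..1} \<Longrightarrow> \<bar>r - t\<bar> < \<delta> \<Longrightarrow> r \<in> {a..b} \<and> at r within {a..b} = at r within {0..1}"
proof -
  have "\<forall>\<^sub>F r in at t within {0..1}. \<sigma> r \<in> N"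
    using assms by (auto simp: continuous_on_def intro: topological_tendstoD)
  then obtain e where e: "0 < e" "\<And>r. r \<in> {0..1} \<Longrightarrow> r \<noteq> t \<Longrightarrow> dist r t < e \<Longrightarrow> \<sigma> r \<in> N"
    unfolding eventually_at by blast
  define \<delta> where "\<delta> = e / 2"
  define a where "a = max 0 (t - \<delta>)"
  define b where "b = min 1 (t + \<delta>)"
  have "0 < \<delta>" using e by (simp add: \<delta>_def)
  moreover have "\<sigma> ` {a..b} \<subseteq> N"
  proof
    fix y assume "y \<in> \<sigma> ` {a..b}"
    then obtain r where r: "y = \<sigma> r" "r \<in> {a..b}" by blast
    then have "r \<in> {0..1}" "dist r t < e" using e(1) by (auto simp: a_def b_def \<delta>_def dist_real_def)
    then show "y \<in> N" using e(2)[of r] assms(4) r(1) by (cases "r = t") auto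
  qed
  moreover have "r \<in> {a..b} \<and> at r within {a..b} = at r within {0..1}"
    if "r \<in> {0..1}" "\<bar>r - t\<bar> < \<delta>" for r
  proof
    show "r \<in> {a..b}" using that by (auto simp: a_def b_def)
    show "at r within {a..b} = at r within {0..1}"
      by (rule at_within_nhd[of r "{t - \<delta><..<t + \<delta>}"]) (use that in \<open>auto simp: a_def b_def\<close>)
  qed
  ultimately show ?thesis
    using assms(2) by (intro that[of \<delta> a b]) (auto simp: a_def b_def)
qed

section \<open>Change of charts and the speed of curves\<close>

context riemannian_surface
begin

lemma chart_at: "chart_at M p \<in> charts M" "p \<in> fst (chart_at M p)"
proof -
  have "\<exists>c. c \<in> charts M \<and> p \<in> fst c" using charts_cover by blast
  then show "chart_at M p \<in> charts M" "p \<in> fst (chart_at M p)"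
    unfolding chart_at_def by (rule someI2_ex, blast)+
qed

lemma chart_inverse:
  assumes "c \<in> charts M"
  shows "p \<in> fst c \<Longrightarrow> inv_into (fst c) (snd c) (snd c p) = p"
    and "x \<in> coord_image c \<Longrightarrow> snd c (inv_into (fst c) (snd c) x) = x"
    and "x \<in> coord_image c \<Longrightarrow> inv_into (fst c) (snd c) x \<in> fst c"
    and "p \<in> fst c \<Longrightarrow> snd c p \<in> coord_image c"
  using chart_homeomorphism[OF assms] unfolding homeomorphism_def by auto

lemma chart_continuous:
  assumes "c \<in> charts M"
  shows "continuous_on (fst c) (snd c)" "continuous_on (coord_image c) (inv_into (fst c) (snd c))"
  using chart_homeomorphism[OF assms] unfolding homeomorphism_def by auto

lemma open_coord_preimage:
  assumes c: "c \<in> charts M" and "open V"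
  shows "open {p \<in> fst c. snd c p \<in> V}"
proof -
  have "open (fst c \<inter> snd c -` V)"
    using continuous_open_preimage[OF chart_continuous(1)[OF c]] chart_open[OF c] assms(2) by blast
  moreover have "{p \<in> fst c. snd c p \<in> V} = fst c \<inter> snd c -` V" by auto
  ultimately show ?thesis by (simp only:)
qed

lemma open_coord_subset:
  assumes c: "c \<in> charts M" and "open N"
  shows "open (snd c ` (fst c \<inter> N))"
proof -
  have "snd c ` (fst c \<inter> N) = coord_image c \<inter> inv_into (fst c) (snd c) -` N"
  proof (intro equalityI subsetI)
    fix x assume "x \<in> snd c ` (fst c \<inter> N)"
    then show "x \<in> coord_image c \<inter> inv_into (fst c) (snd c) -` N"
      using chart_inverse[OF c] by auto
  next
    fix x assume "x \<in> coord_image c \<inter> inv_into (fst c) (snd c) -` N"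
    then show "x \<in> snd c ` (fst c \<inter> N)"
      using chart_inverse(2,3)[OF c, of x] by (intro image_eqI[of _ _ "inv_into (fst c) (snd c) x"]) auto
  qed
  then show ?thesis
    using continuous_open_preimage[OF chart_continuous(2)[OF c]] chart_open[OF c] assms(2) by simp
qed

lemma transition_derivative:
  assumes "c \<in> charts M" "c' \<in> charts M" "p \<in> fst c \<inter> fst c'"
  shows "(transition c c' has_derivative frechet_derivative (transition c c') (at (snd c p))) (at (snd c p))"
proof -
  have "Ck_on (Suc 0) (snd c ` (fst c \<inter> fst c')) (transition c c')"
    using transition_smooth[OF assms(1,2)] unfolding smooth_on_def by blast
  then have "transition c c' differentiable (at (snd c p))"
    using assms(3) by auto
  then show ?thesis by (rule frechet_derivative_works[THEN iffD1])
qed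

lemma transition_derivative_continuous:
  assumes "c \<in> charts M" "c' \<in> charts M"
  shows "continuous_on (snd c ` (fst c \<inter> fst c')) (\<lambda>x. frechet_derivative (transition c c') (at x) v)"
proof -
  have "Ck_on (Suc 0) (snd c ` (fst c \<inter> fst c')) (transition c c')"
    using transition_smooth[OF assms(1,2)] unfolding smooth_on_def by blast
  then show ?thesis by auto
qed

text \<open>Chain rule. \<open>snd c'\<close> factors through the transition map on
  \<open>fst c\<close> only, where the curve stays for parameters near \<open>t\<close> by
  continuity.\<close>

lemma vector_derivative_change_chart:
  assumes c: "c \<in> charts M" "c' \<in> charts M" and t: "\<sigma> t \<in> fst c \<inter> fst c'" and tT: "t \<in> T"
    and cont: "continuous (at t within T) \<sigma>"
    and der: "(snd c \<circ> \<sigma> has_vector_derivative w) (at t within T)"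
  shows "(snd c' \<circ> \<sigma> has_vector_derivative frechet_derivative (transition c c') (at (snd c (\<sigma> t))) w) (at t within T)"
proof -
  let ?D = "frechet_derivative (transition c c') (at (snd c (\<sigma> t)))"
  have D: "(transition c c' has_derivative ?D) (at (snd c (\<sigma> t)))"
    using transition_derivative[OF c t] .
  have "(transition c c' \<circ> (snd c \<circ> \<sigma>) has_derivative ?D \<circ> (\<lambda>h. h *\<^sub>R w)) (at t within T)"
    by (rule diff_chain_within) (use der D has_derivative_at_withinI in \<open>auto simp: has_vector_derivative_def\<close>)
  moreover have "?D \<circ> (\<lambda>h. h *\<^sub>R w) = (\<lambda>h. h *\<^sub>R ?D w)"
    using linear_scale[OF has_derivative_linear[OF D]] by auto
  ultimately have "(transition c c' \<circ> (snd c \<circ> \<sigma>) has_derivative (\<lambda>h. h *\<^sub>R ?D w)) (at t within T)" by simp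
  moreover have "\<forall>\<^sub>F s in at t within T. (transition c c' \<circ> (snd c \<circ> \<sigma>)) s = (snd c' \<circ> \<sigma>) s"
  proof -
    have "\<forall>\<^sub>F s in at t within T. \<sigma> s \<in> fst c"
      using cont t chart_open[OF c(1)] unfolding continuous_within by (intro topological_tendstoD) auto
    then show ?thesis
      by eventually_elim (simp add: transition_def chart_inverse(1)[OF c(1)])
  qed
  moreover have "(transition c c' \<circ> (snd c \<circ> \<sigma>)) t = (snd c' \<circ> \<sigma>) t"
    using t by (simp add: transition_def chart_inverse(1)[OF c(1)])
  ultimately show ?thesis
    unfolding has_vector_derivative_def using tT by (rule has_derivative_transform_eventually)
qed

lemma gnorm_nonneg: "0 \<le> gnorm M c x w" if "c \<in> charts M" "x \<in> coord_image c"
  using gcoeff_pos[OF that, of w] unfolding gnorm_def by (cases "w = 0") auto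

lemma gnorm_pos: "0 < gnorm M c x w" if "c \<in> charts M" "x \<in> coord_image c" "w \<noteq> 0"
  using gcoeff_pos[OF that] unfolding gnorm_def by simp

lemma velocity_eq:
  assumes "t \<in> {0..1}"
    and "(snd (chart_at M (\<sigma> t)) \<circ> \<sigma> has_vector_derivative w) (at t within {0..1})"
  shows "velocity M \<sigma> t = w"
  unfolding velocity_def using vector_derivative_within_cbox[of 0 1 t] assms by simp

text \<open>A change of chart multiplies the velocity by the Jacobian and replaces the metric by a
  congruent matrix; the two effects cancel in the length.\<close>

lemma speed_eq:
  assumes c: "c \<in> charts M" and t: "t \<in> {0..1}" "\<sigma> t \<in> fst c" and cont: "continuous_on {0..1} \<sigma>"
    and der: "(snd c \<circ> \<sigma> has_vector_derivative w) (at t within {0..1})"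
  shows "speed M \<sigma> t = gnorm M c (snd c (\<sigma> t)) w"
proof -
  let ?c = "chart_at M (\<sigma> t)"
  let ?D = "frechet_derivative (transition c ?c) (at (snd c (\<sigma> t)))"
  note c' = chart_at[of "\<sigma> t"]
  have "continuous (at t within {0..1}) \<sigma>"
    using cont t by (auto simp: continuous_on_eq_continuous_within)
  then have vel: "velocity M \<sigma> t = ?D w"
    using c c' t der by (intro velocity_eq vector_derivative_change_chart) auto
  have lin: "linear ?D" using transition_derivative[of c ?c "\<sigma> t"] c c' t has_derivative_linear by blast
  have mat: "matrix ?D *v w = ?D w" using matrix_vector_mul(2)[OF lin] by metis
  have "gcoeff M c (snd c (\<sigma> t)) = transpose (matrix ?D) ** gcoeff M ?c (snd ?c (\<sigma> t)) ** matrix ?D"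
    by (rule gcoeff_transform) (use c c' t in auto)
  then show ?thesis
    unfolding speed_def tangent_norm_def tangent_inner_def gnorm_def vel
    by (simp add: inner_matrix_congruence mat)
qed

lemma gcoeff_continuous: "c \<in> charts M \<Longrightarrow> continuous_on (coord_image c) (gcoeff M c)"
  using gcoeff_smooth[of c] unfolding smooth_on_def by (metis Ck_on.simps(1))

lemma gnorm_continuous:
  assumes "c \<in> charts M" "continuous_on T x" "continuous_on T w" "x ` T \<subseteq> coord_image c"
  shows "continuous_on T (\<lambda>r. gnorm M c (x r) (w r))"
proof -
  have "continuous_on T (\<lambda>r. gcoeff M c (x r))"
    by (rule continuous_on_compose2[OF gcoeff_continuous[OF assms(1)] assms(2,4)])
  then show ?thesis
    unfolding gnorm_def matrix_vector_mult_def using assms(3)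
    by (intro continuous_intros)
qed

lemma C1_curve_onD:
  assumes "C1_curve_on M a b \<sigma>" "c \<in> charts M" "a \<le> s" "s < t" "t \<le> b" "\<sigma> ` {s..t} \<subseteq> fst c"
  obtains v where "continuous_on {s..t} v"
    "\<And>r. r \<in> {s..t} \<Longrightarrow> (snd c \<circ> \<sigma> has_vector_derivative v r) (at r within {s..t})"
  using assms unfolding C1_curve_on_def by blast

lemma C1_curve_on_derivative:
  assumes C1: "C1_curve_on M 0 1 \<sigma>" and c: "c \<in> charts M" and t: "t \<in> {0..1}" "\<sigma> t \<in> fst c"
  obtains w where "(snd c \<circ> \<sigma> has_vector_derivative w) (at t within {0..1})"
proof -
  have cont: "continuous_on {0..1} \<sigma>" using C1 by (simp add: C1_curve_on_def)
  obtain \<delta> a b where d: "0 < \<delta>" "0 \<le> a" "b \<le> 1" "a < b" "a \<le> t" "t \<le> b" "\<sigma> ` {a..b} \<subseteq> fst c"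
    and at: "\<And>r. r \<in> {0..1} \<Longrightarrow> \<bar>r - t\<bar> < \<delta> \<Longrightarrow> r \<in> {a..b} \<and> at r within {a..b} = at r within {0..1}"
    using local_interval[OF cont t(1) _ t(2)] chart_open[OF c] by metis
  obtain v where v: "continuous_on {a..b} v"
    "\<And>r. r \<in> {a..b} \<Longrightarrow> (snd c \<circ> \<sigma> has_vector_derivative v r) (at r within {a..b})"
    using C1_curve_onD[OF C1 c d(2,4,3,7)] by blast
  show ?thesis using that v(2)[of t] at[OF t(1)] d(1) by auto
qed

text \<open>The velocity may jump together with the chart chosen at each point, but the speed does
  not: near \<open>t\<close> it can be computed in the one chart chosen at
  \<open>\<sigma> t\<close>.\<close>

lemma speed_continuous:
  assumes C1: "C1_curve_on M 0 1 \<sigma>"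
  shows "continuous_on {0..1} (speed M \<sigma>)"
  unfolding continuous_on_eq_continuous_within
proof
  fix t :: real assume t: "t \<in> {0..1}"
  have cont: "continuous_on {0..1} \<sigma>" using C1 by (simp add: C1_curve_on_def)
  let ?c = "chart_at M (\<sigma> t)"
  note c = chart_at[of "\<sigma> t"]
  obtain \<delta> a b where d: "0 < \<delta>" "0 \<le> a" "b \<le> 1" "a < b" "a \<le> t" "t \<le> b" "\<sigma> ` {a..b} \<subseteq> fst ?c"
    and at: "\<And>r. r \<in> {0..1} \<Longrightarrow> \<bar>r - t\<bar> < \<delta> \<Longrightarrow> r \<in> {a..b} \<and> at r within {a..b} = at r within {0..1}"
    using local_interval[OF cont t _ c(2)] chart_open[OF c(1)] by metis
  obtain v where v: "continuous_on {a..b} v"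
    "\<And>r. r \<in> {a..b} \<Longrightarrow> (snd ?c \<circ> \<sigma> has_vector_derivative v r) (at r within {a..b})"
    using C1_curve_onD[OF C1 c(1) d(2,4,3,7)] by blast
  have eq: "speed M \<sigma> r = gnorm M ?c ((snd ?c \<circ> \<sigma>) r) (v r)" if r: "r \<in> {0..1}" "\<bar>r - t\<bar> < \<delta>" for r
  proof -
    have "r \<in> {a..b}" "at r within {a..b} = at r within {0..1}" using at[OF r] by auto
    moreover from this have "\<sigma> r \<in> fst ?c" using d(7) by blast
    ultimately show ?thesis using speed_eq[OF c(1) r(1) _ cont, of "v r"] v(2)[of r] by simp
  qed
  have contg: "continuous_on {a..b} (\<lambda>r. gnorm M ?c ((snd ?c \<circ> \<sigma>) r) (v r))"
  proof (rule gnorm_continuous[OF c(1) _ v(1)])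
    show "continuous_on {a..b} (snd ?c \<circ> \<sigma>)"
      using v(2) unfolding continuous_on_eq_continuous_within by (blast intro: has_vector_derivative_continuous)
    show "(snd ?c \<circ> \<sigma>) ` {a..b} \<subseteq> coord_image ?c" using d(7) unfolding coord_image_def by auto
  qed
  have "continuous (at t within {0..1}) (\<lambda>r. gnorm M ?c ((snd ?c \<circ> \<sigma>) r) (v r))"
  proof -
    have "t \<in> {a..b}" "at t within {a..b} = at t within {0..1}" using at[OF t] d(1) by auto
    then show ?thesis
      using contg unfolding continuous_on_eq_continuous_within by metis
  qed
  moreover have "\<forall>\<^sub>F r in at t within {0..1}. gnorm M ?c ((snd ?c \<circ> \<sigma>) r) (v r) = speed M \<sigma> r"
    unfolding eventually_at using d(1) eq by (intro exI[of _ \<delta>]) (auto simp: dist_real_def)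
  ultimately show "continuous (at t within {0..1}) (speed M \<sigma>)"
    using eq[OF t] d(1) unfolding continuous_within by (simp add: tendsto_cong)
qed

lemma speed_nonneg: "0 \<le> speed M \<sigma> t"
  unfolding speed_def tangent_norm_def tangent_inner_def
  using gnorm_nonneg[OF chart_at(1) chart_inverse(4)[OF chart_at]] by (simp add: gnorm_def)

lemma C1_curve_joins:
  assumes "C1_curve_on M 0 1 \<sigma>" "pathstart \<sigma> = P" "pathfinish \<sigma> = Q"
  shows "joins M P Q \<sigma>"
  using assms unfolding joins_def piecewise_C1_curve_def path_def
  by (auto simp: C1_curve_on_def intro!: exI[of _ "Suc 0"] exI[of _ "real"])

end

section \<open>Geodesics\<close>

definition chart_geodesic :: "'a surface \<Rightarrow> 'a chart \<Rightarrow> (real \<Rightarrow> real^2) \<Rightarrow> (real \<Rightarrow> real^2) \<Rightarrow> real \<Rightarrow> real \<Rightarrow> bool" where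
  "chart_geodesic M c x v s t \<longleftrightarrow> (\<forall>r\<in>{s..t}. (x has_vector_derivative v r) (at r within {s..t}) \<and>
     (v has_vector_derivative geodesic_rhs (gcoeff M c) (x r) (v r)) (at r within {s..t}))"

text \<open>\<open>u\<close> may exceed \<open>v\<close>: \<open>subcurve 1 0\<close> is the
  reversed curve. For \<open>u = v\<close> the curve is constant.\<close>

definition subcurve :: "real \<Rightarrow> real \<Rightarrow> (real \<Rightarrow> 'a) \<Rightarrow> real \<Rightarrow> 'a" where
  "subcurve u v \<gamma> r = \<gamma> ((v - u) * r + u)"

text \<open>\<open>geodesic\<close> on an arbitrary parameter interval, so that pieces can be
  rescaled and glued before the whole is put on the unit interval.\<close>

definition geodesic_on :: "'a::topological_space surface \<Rightarrow> real \<Rightarrow> real \<Rightarrow> (real \<Rightarrow> 'a) \<Rightarrow> bool" where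
  "geodesic_on M a b \<gamma> \<longleftrightarrow> continuous_on {a..b} \<gamma> \<and>
     (\<forall>c\<in>charts M. \<forall>s t. a \<le> s \<and> s < t \<and> t \<le> b \<and> \<gamma> ` {s..t} \<subseteq> fst c \<longrightarrow>
        (\<exists>v. chart_geodesic M c (snd c \<circ> \<gamma>) v s t))"

lemma geodesic_iff: "geodesic M \<gamma> \<longleftrightarrow> geodesic_on M 0 1 \<gamma>"
  unfolding geodesic_def geodesic_on_def chart_geodesic_def geodesic_rhs_def path_def comp_def ..

lemma geodesic_onD:
  assumes "geodesic_on M a b \<gamma>" "c \<in> charts M" "a \<le> s" "s < t" "t \<le> b" "\<gamma> ` {s..t} \<subseteq> fst c"
  obtains v where "chart_geodesic M c (snd c \<circ> \<gamma>) v s t"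
  using assms unfolding geodesic_on_def by blast

lemma chart_geodesic_subset:
  assumes "chart_geodesic M c x v s t" "s \<le> s'" "t' \<le> t"
  shows "chart_geodesic M c x v s' t'"
  unfolding chart_geodesic_def
proof (intro ballI conjI)
  fix r assume r: "r \<in> {s'..t'}"
  then have r': "r \<in> {s..t}" and sub: "{s'..t'} \<subseteq> {s..t}" using assms(2,3) by auto
  show "(x has_vector_derivative v r) (at r within {s'..t'})"
    using assms(1) r' has_vector_derivative_within_subset[OF _ sub] unfolding chart_geodesic_def by blast
  show "(v has_vector_derivative geodesic_rhs (gcoeff M c) (x r) (v r)) (at r within {s'..t'})"
    using assms(1) r' has_vector_derivative_within_subset[OF _ sub] unfolding chart_geodesic_def by blast
qed

lemma has_vector_derivative_affine:
  fixes f :: "real \<Rightarrow> 'a::real_normed_vector"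
  assumes "(f has_vector_derivative f') (at (m * r + k) within T)" "\<And>q. q \<in> S \<Longrightarrow> m * q + k \<in> T"
  shows "((\<lambda>q. f (m * q + k)) has_vector_derivative m *\<^sub>R f') (at r within S)"
proof -
  have "((\<lambda>q. m * q + k) has_vector_derivative m) (at r within S)"
    by (auto intro!: derivative_eq_intros)
  moreover have "(f has_vector_derivative f') (at (m * r + k) within (\<lambda>q. m * q + k) ` S)"
    using assms by (auto intro: has_vector_derivative_within_subset)
  ultimately show ?thesis
    using vector_diff_chain_within[of "\<lambda>q. m * q + k" m r S f f'] by (simp add: comp_def)
qed

text \<open>Both sides of the geodesic equation scale by \<open>m * m\<close>, the right-hand side
  because it is quadratic in the velocity.\<close>

lemma chart_geodesic_affine:
  assumes g: "chart_geodesic M c x v p q" and sub: "\<And>r. r \<in> {s..t} \<Longrightarrow> m * r + k \<in> {p..q}"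
  shows "chart_geodesic M c (\<lambda>r. x (m * r + k)) (\<lambda>r. m *\<^sub>R v (m * r + k)) s t"
  unfolding chart_geodesic_def
proof (intro ballI conjI)
  fix r assume r: "r \<in> {s..t}"
  have d: "(x has_vector_derivative v (m * r + k)) (at (m * r + k) within {p..q})"
    "(v has_vector_derivative geodesic_rhs (gcoeff M c) (x (m * r + k)) (v (m * r + k))) (at (m * r + k) within {p..q})"
    using g sub[OF r] unfolding chart_geodesic_def by blast+
  show "((\<lambda>r. x (m * r + k)) has_vector_derivative m *\<^sub>R v (m * r + k)) (at r within {s..t})"
    using d(1) sub by (rule has_vector_derivative_affine)
  have "((\<lambda>r. v (m * r + k)) has_vector_derivative m *\<^sub>R geodesic_rhs (gcoeff M c) (x (m * r + k)) (v (m * r + k))) (at r within {s..t})"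
    using d(2) sub by (rule has_vector_derivative_affine)
  from bounded_linear.has_vector_derivative[OF bounded_linear_scaleR_right this, of m]
  show "((\<lambda>r. m *\<^sub>R v (m * r + k)) has_vector_derivative
      geodesic_rhs (gcoeff M c) (x (m * r + k)) (m *\<^sub>R v (m * r + k))) (at r within {s..t})"
    by (simp add: geodesic_rhs_scale)
qed

lemma geodesic_on_affine:
  assumes g: "geodesic_on M p q \<gamma>" and m: "m \<noteq> 0" and sub: "\<And>r. r \<in> {s..t} \<Longrightarrow> m * r + k \<in> {p..q}"
  shows "geodesic_on M s t (\<lambda>r. \<gamma> (m * r + k))"
  unfolding geodesic_on_def
proof (intro conjI ballI allI impI)
  have "continuous_on {p..q} \<gamma>" using g by (simp add: geodesic_on_def)
  then show "continuous_on {s..t} (\<lambda>r. \<gamma> (m * r + k))"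
    by (rule continuous_on_compose2) (use sub in \<open>auto intro!: continuous_intros\<close>)
next
  fix c s' t' assume c: "c \<in> charts M"
    and st: "s \<le> s' \<and> s' < t' \<and> t' \<le> t \<and> (\<lambda>r. \<gamma> (m * r + k)) ` {s'..t'} \<subseteq> fst c"
  \<comment> \<open>For negative \<open>m\<close> the orientation is reversed and the end points
    change places.\<close>
  define p' where "p' = min (m * s' + k) (m * t' + k)"
  define q' where "q' = max (m * s' + k) (m * t' + k)"
  have pq: "p \<le> p'" "q' \<le> q" using sub[of s'] sub[of t'] st by (auto simp: p'_def q'_def)
  have "m * s' + k \<noteq> m * t' + k" using st m by auto
  then have lt: "p' < q'" unfolding p'_def q'_def by linarith
  have mem: "m * r + k \<in> {p'..q'}" if "r \<in> {s'..t'}" for r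
  proof (cases "0 \<le> m")
    case True
    then have "m * s' \<le> m * r" "m * r \<le> m * t'" using that by (auto intro: mult_left_mono)
    then show ?thesis by (auto simp: p'_def q'_def)
  next
    case False
    then have "m * r \<le> m * s'" "m * t' \<le> m * r" using that by (auto intro: mult_left_mono_neg)
    then show ?thesis by (auto simp: p'_def q'_def)
  qed
  have "\<gamma> ` {p'..q'} \<subseteq> fst c"
  proof
    fix y assume "y \<in> \<gamma> ` {p'..q'}"
    then obtain u where u: "u \<in> {p'..q'}" "y = \<gamma> u" by blast
    define r where "r = (u - k) / m"
    have ur: "u = m * r + k" using m by (simp add: r_def)
    have "r \<in> {s'..t'}"
    proof (cases "0 < m")
      case True
      then have "m * s' \<le> m * t'" using st by simp
      then have "m * s' \<le> m * r" "m * r \<le> m * t'" using u(1) unfolding ur p'_def q'_def by auto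
      then show ?thesis using True by simp
    next
      case False
      then have neg: "m < 0" using m by simp
      then have "m * t' \<le> m * s'" using st by simp
      then have "m * r \<le> m * s'" "m * t' \<le> m * r" using u(1) unfolding ur p'_def q'_def by auto
      then show ?thesis using neg by simp
    qed
    then show "y \<in> fst c" using st u(2) ur by blast
  qed
  then obtain v where "chart_geodesic M c (snd c \<circ> \<gamma>) v p' q'"
    using geodesic_onD[OF g c pq(1) lt pq(2)] by blast
  from chart_geodesic_affine[OF this mem]
  show "\<exists>v. chart_geodesic M c (snd c \<circ> (\<lambda>r. \<gamma> (m * r + k))) v s' t'"
    by (auto simp: comp_def)
qed

lemma geodesic_on_const: "geodesic_on M a b (\<lambda>r. P)"
  unfolding geodesic_on_def chart_geodesic_def
  by (intro conjI ballI allI impI continuous_on_const exI[of _ "\<lambda>r. 0"])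
    (auto simp: geodesic_rhs_zero comp_def)

lemma geodesic_on_cong:
  assumes "geodesic_on M a b \<gamma>" "\<And>r. r \<in> {a..b} \<Longrightarrow> \<sigma> r = \<gamma> r"
  shows "geodesic_on M a b \<sigma>"
  unfolding geodesic_on_def
proof (intro conjI ballI allI impI)
  show "continuous_on {a..b} \<sigma>"
    using assms continuous_on_cong[of "{a..b}" "{a..b}" \<sigma> \<gamma>] by (auto simp: geodesic_on_def)
next
  fix c s t assume c: "c \<in> charts M" and st: "a \<le> s \<and> s < t \<and> t \<le> b \<and> \<sigma> ` {s..t} \<subseteq> fst c"
  have eq: "\<sigma> r = \<gamma> r" if "r \<in> {s..t}" for r using assms(2) st that by auto
  then have "\<gamma> ` {s..t} \<subseteq> fst c" using st by (metis image_cong)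
  then obtain v where v: "chart_geodesic M c (snd c \<circ> \<gamma>) v s t"
    using geodesic_onD[OF assms(1) c] st by blast
  have "chart_geodesic M c (snd c \<circ> \<sigma>) v s t"
    unfolding chart_geodesic_def
  proof (intro ballI conjI)
    fix r assume r: "r \<in> {s..t}"
    have "((snd c \<circ> \<gamma>) has_vector_derivative v r) (at r within {s..t})"
      using v r unfolding chart_geodesic_def by blast
    then show "((snd c \<circ> \<sigma>) has_vector_derivative v r) (at r within {s..t})"
      by (rule has_vector_derivative_transform[OF r, rotated]) (simp add: eq)
    show "(v has_vector_derivative geodesic_rhs (gcoeff M c) ((snd c \<circ> \<sigma>) r) (v r)) (at r within {s..t})"
      using v r eq[OF r] unfolding chart_geodesic_def by auto
  qed
  then show "\<exists>v. chart_geodesic M c (snd c \<circ> \<sigma>) v s t" by blast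
qed

lemma affine_mem_01: "u \<in> {0..1} \<Longrightarrow> v \<in> {0..1} \<Longrightarrow> r \<in> {0..1} \<Longrightarrow> (v - u) * r + u \<in> {0..1::real}"
proof -
  assume u: "u \<in> {0..1}" and v: "v \<in> {0..1}" and r: "r \<in> {0..1::real}"
  have e: "(v - u) * r + u = (1 - r) * u + r * v" by (simp add: algebra_simps)
  show ?thesis unfolding e using convexD_alt[OF convex_real_interval(5)[of 0 1] u v, of r] r by simp
qed

lemma geodesic_subcurve:
  assumes g: "geodesic M \<gamma>" and u: "u \<in> {0..1}" and v: "v \<in> {0..1}"
  shows "geodesic M (subcurve u v \<gamma>)"
proof (cases "u = v")
  case True
  then have "subcurve u v \<gamma> = (\<lambda>r. \<gamma> u)" by (auto simp: subcurve_def fun_eq_iff)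
  then show ?thesis by (simp add: geodesic_iff geodesic_on_const)
next
  case False
  have "geodesic_on M 0 1 (\<lambda>r. \<gamma> ((v - u) * r + u))"
  proof (rule geodesic_on_affine[OF g[unfolded geodesic_iff]])
    show "(v - u) * r + u \<in> {0..1}" if "r \<in> {0..1}" for r
      using u v that by (rule affine_mem_01)
  qed (use False in simp)
  then show ?thesis unfolding geodesic_iff by (rule geodesic_on_cong) (simp add: subcurve_def)
qed

section \<open>Uniqueness and gluing of geodesics\<close>

context riemannian_surface
begin

lemma det_gcoeff: "c \<in> charts M \<Longrightarrow> x \<in> coord_image c \<Longrightarrow> det (gcoeff M c x) \<noteq> 0"
proof
  assume c: "c \<in> charts M" "x \<in> coord_image c" and "det (gcoeff M c x) = 0"
  then have "\<not> invertible (gcoeff M c x)" using invertible_det_nz by blast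
  then have "\<not> (\<exists>B. B ** gcoeff M c x = mat 1)" using invertible_left_inverse by blast
  then obtain v where "gcoeff M c x *v v = 0" "v \<noteq> 0" using matrix_left_invertible_ker by blast
  then show False using gcoeff_pos[OF c \<open>v \<noteq> 0\<close>] by simp
qed

text \<open>Closed coordinate balls are compact and convex, as the Lipschitz estimate for the
  Christoffel symbols requires; on them the estimates for solutions become available.\<close>

lemma chart_ball:
  assumes c: "c \<in> charts M" and N: "open N" "p \<in> N" "p \<in> fst c"
  obtains \<rho> where "0 < \<rho>" "cball (snd c p) \<rho> \<subseteq> snd c ` (fst c \<inter> N)" "cball (snd c p) \<rho> \<subseteq> coord_image c"
    "\<exists>K. quadratic_ode (geodesic_rhs (gcoeff M c)) (cball (snd c p) \<rho>) K"
proof -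
  obtain \<rho> where \<rho>: "0 < \<rho>" "cball (snd c p) \<rho> \<subseteq> snd c ` (fst c \<inter> N)"
    using open_coord_subset[OF c N(1)] N open_contains_cball[of "snd c ` (fst c \<inter> N)"] by blast
  then have sub: "cball (snd c p) \<rho> \<subseteq> coord_image c" unfolding coord_image_def by blast
  have "\<exists>K. quadratic_ode (geodesic_rhs (gcoeff M c)) (cball (snd c p) \<rho>) K"
    by (rule quadratic_ode_geodesic_rhs[OF gcoeff_smooth[OF c] compact_cball convex_cball sub])
      (use det_gcoeff[OF c] sub in blast)
  then show ?thesis using that \<rho> sub by blast
qed

lemma geodesic_C1:
  assumes "geodesic M \<gamma>"
  shows "C1_curve_on M 0 1 \<gamma>"
  unfolding C1_curve_on_def
proof (intro conjI ballI allI impI)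
  show "continuous_on {0..1} \<gamma>" using assms by (simp add: geodesic_iff geodesic_on_def)
  fix c s t assume c: "c \<in> charts M" and st: "0 \<le> s \<and> s < t \<and> t \<le> 1 \<and> \<gamma> ` {s..t} \<subseteq> fst c"
  then obtain v where v: "chart_geodesic M c (snd c \<circ> \<gamma>) v s t"
    using geodesic_onD[OF assms[unfolded geodesic_iff] c] by blast
  have "continuous_on {s..t} v"
    using v unfolding chart_geodesic_def continuous_on_eq_continuous_within
    by (blast intro: has_vector_derivative_continuous)
  then show "\<exists>v. continuous_on {s..t} v \<and>
      (\<forall>r\<in>{s..t}. (snd c \<circ> \<gamma> has_vector_derivative v r) (at r within {s..t}))"
    using v unfolding chart_geodesic_def by blast
qed

lemma has_vector_derivative_unique_Icc:
  fixes f :: "real \<Rightarrow> 'b::real_normed_vector"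
  assumes "a < b" "r \<in> {a..b}" "(f has_vector_derivative v) (at r within {a..b})"
    "(g has_vector_derivative w) (at r within {a..b})" "\<And>s. s \<in> {a..b} \<Longrightarrow> f s = g s"
  shows "v = w"
proof -
  have "(g has_vector_derivative v) (at r within {a..b})"
    using assms(3) by (rule has_vector_derivative_transform[OF assms(2), rotated]) (simp add: assms(5))
  then show ?thesis
    using assms(1,2,4) vector_derivative_within_cbox[of a b r g] by auto
qed

text \<open>Continuity argument: let tau be the supremum of the times up to which the curves agree.
  They agree at tau together with their velocities, and uniqueness for the equation in one chart
  pushes the agreement beyond tau unless tau = 1.\<close>

lemma geodesic_unique:
  assumes g: "geodesic M \<gamma>" "geodesic M \<delta>" and init: "\<gamma> 0 = \<delta> 0" "velocity M \<gamma> 0 = velocity M \<delta> 0"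
    and t: "t \<in> {0..1}"
  shows "\<gamma> t = \<delta> t"
proof -
  note gon = g[unfolded geodesic_iff]
  have cont: "continuous_on {0..1} \<gamma>" "continuous_on {0..1} \<delta>" using gon by (auto simp: geodesic_on_def)
  define A where "A = {t \<in> {0..1}. \<forall>s\<in>{0..t}. \<gamma> s = \<delta> s}"
  define \<tau> where "\<tau> = Sup A"
  have A0: "0 \<in> A" using init by (auto simp: A_def)
  have bdd: "bdd_above A" by (auto simp: A_def bdd_above_def)
  have \<tau>: "0 \<le> \<tau>" "\<tau> \<le> 1"
  proof -
    show "0 \<le> \<tau>" unfolding \<tau>_def by (rule cSup_upper[OF A0 bdd])
    have "A \<noteq> {}" using A0 by blast
    then show "\<tau> \<le> 1" unfolding \<tau>_def by (rule cSup_least) (simp add: A_def)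
  qed
  have below: "\<gamma> s = \<delta> s" if s: "0 \<le> s" "s < \<tau>" for s
  proof -
    have "A \<noteq> {}" using A0 by blast
    then obtain a where "a \<in> A" "s < a" using less_cSupE[of s A] s(2) unfolding \<tau>_def by metis
    then show ?thesis using s(1) unfolding A_def by simp
  qed
  have at\<tau>: "\<gamma> \<tau> = \<delta> \<tau>"
  proof (cases "\<tau> = 0")
    case True
    then show ?thesis using init by simp
  next
    case False
    \<comment> \<open>Clamping the parameter extends both curves continuously to the whole line, so
      that the set of agreement is closed.\<close>
    let ?cl = "\<lambda>s::real. max 0 (min 1 s)"
    have "continuous_on UNIV (\<lambda>s. \<gamma> (?cl s))" "continuous_on UNIV (\<lambda>s. \<delta> (?cl s))"
      by (rule continuous_on_compose2[OF cont(1)] continuous_on_compose2[OF cont(2)];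
          force intro!: continuous_intros)+
    then have "closed {s. \<gamma> (?cl s) = \<delta> (?cl s)}" by (rule closed_Collect_eq)
    moreover have "{0..<\<tau>} \<subseteq> {s. \<gamma> (?cl s) = \<delta> (?cl s)}" using below \<tau> by auto
    ultimately have "closure {0..<\<tau>} \<subseteq> {s. \<gamma> (?cl s) = \<delta> (?cl s)}" by (simp add: closure_minimal)
    moreover have "\<tau> \<in> closure {0..<\<tau>}" using False \<tau> by (simp add: closure_atLeastLessThan)
    ultimately show ?thesis using \<tau> by auto
  qed
  have "\<tau> = 1"
  proof (rule ccontr)
    assume "\<tau> \<noteq> 1"
    then have lt: "\<tau> < 1" and \<tau>01: "\<tau> \<in> {0..1}" using \<tau> by auto
    let ?c = "chart_at M (\<gamma> \<tau>)"
    note c = chart_at[of "\<gamma> \<tau>"]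
    obtain \<rho> where \<rho>: "0 < \<rho>" "cball (snd ?c (\<gamma> \<tau>)) \<rho> \<subseteq> coord_image ?c"
      and ode: "\<exists>K. quadratic_ode (geodesic_rhs (gcoeff M ?c)) (cball (snd ?c (\<gamma> \<tau>)) \<rho>) K"
      using chart_ball[OF c(1) open_UNIV UNIV_I c(2)] by metis
    then obtain K where K: "quadratic_ode (geodesic_rhs (gcoeff M ?c)) (cball (snd ?c (\<gamma> \<tau>)) \<rho>) K" by blast
    interpret quadratic_ode "geodesic_rhs (gcoeff M ?c)" "cball (snd ?c (\<gamma> \<tau>)) \<rho>" K by (rule K)
    define N where "N = {p \<in> fst ?c. snd ?c p \<in> ball (snd ?c (\<gamma> \<tau>)) \<rho>}"
    have N: "open N" "\<gamma> \<tau> \<in> N" "\<delta> \<tau> \<in> N" "N \<subseteq> fst ?c"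
      unfolding N_def using open_coord_preimage[OF c(1) open_ball] c(2) \<rho>(1) at\<tau> by auto
    obtain d1 a1 b1 where I1: "0 < d1" "0 \<le> a1" "b1 \<le> 1" "a1 < b1" "a1 \<le> \<tau>" "\<tau> \<le> b1" "\<gamma> ` {a1..b1} \<subseteq> N"
      "0 < \<tau> \<Longrightarrow> a1 < \<tau>" "\<tau> < 1 \<Longrightarrow> \<tau> < b1"
      "\<And>r. r \<in> {0..1} \<Longrightarrow> \<bar>r - \<tau>\<bar> < d1 \<Longrightarrow> r \<in> {a1..b1} \<and> at r within {a1..b1} = at r within {0..1}"
      by (rule local_interval[OF cont(1) \<tau>01 N(1) N(2)]) blast
    obtain d2 a2 b2 where I2: "0 < d2" "0 \<le> a2" "b2 \<le> 1" "a2 < b2" "a2 \<le> \<tau>" "\<tau> \<le> b2" "\<delta> ` {a2..b2} \<subseteq> N"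
      "0 < \<tau> \<Longrightarrow> a2 < \<tau>" "\<tau> < 1 \<Longrightarrow> \<tau> < b2"
      "\<And>r. r \<in> {0..1} \<Longrightarrow> \<bar>r - \<tau>\<bar> < d2 \<Longrightarrow> r \<in> {a2..b2} \<and> at r within {a2..b2} = at r within {0..1}"
      by (rule local_interval[OF cont(2) \<tau>01 N(1) N(3)]) blast
    obtain v1 where v1: "chart_geodesic M ?c (snd ?c \<circ> \<gamma>) v1 a1 b1"
      using geodesic_onD[OF gon(1) c(1) I1(2,4,3)] I1(7) N(4) by blast
    obtain v2 where v2: "chart_geodesic M ?c (snd ?c \<circ> \<delta>) v2 a2 b2"
      using geodesic_onD[OF gon(2) c(1) I2(2,4,3)] I2(7) N(4) by blast
    \<comment> \<open>At 0 the velocities agree by hypothesis; at a later time because the curves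
      agree on an interval to the left of it, which determines the one-sided derivative.\<close>
    have veq: "v1 \<tau> = v2 \<tau>"
    proof (cases "\<tau> = 0")
      case True
      have "at \<tau> within {a1..b1} = at \<tau> within {0..1}" using I1(10)[OF \<tau>01] I1(1) by simp
      moreover have "(snd ?c \<circ> \<gamma> has_vector_derivative v1 \<tau>) (at \<tau> within {a1..b1})"
        using v1 I1(5,6) unfolding chart_geodesic_def by auto
      ultimately have 1: "velocity M \<gamma> 0 = v1 \<tau>" using True by (intro velocity_eq) simp_all
      have "at \<tau> within {a2..b2} = at \<tau> within {0..1}" using I2(10)[OF \<tau>01] I2(1) by simp
      moreover have "(snd ?c \<circ> \<delta> has_vector_derivative v2 \<tau>) (at \<tau> within {a2..b2})"
        using v2 I2(5,6) unfolding chart_geodesic_def by auto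
      ultimately have 2: "velocity M \<delta> 0 = v2 \<tau>" using True at\<tau> by (intro velocity_eq) simp_all
      show ?thesis using 1 2 init(2) by simp
    next
      case False
      then have pos: "0 < \<tau>" using \<tau> by simp
      let ?a = "max a1 a2"
      have a: "?a < \<tau>" using I1(8) I2(8) pos by simp
      have 1: "(snd ?c \<circ> \<gamma> has_vector_derivative v1 \<tau>) (at \<tau> within {?a..\<tau>})"
        using chart_geodesic_subset[OF v1, of ?a \<tau>] I1(6) a unfolding chart_geodesic_def by auto
      have 2: "(snd ?c \<circ> \<delta> has_vector_derivative v2 \<tau>) (at \<tau> within {?a..\<tau>})"
        using chart_geodesic_subset[OF v2, of ?a \<tau>] I2(6) a unfolding chart_geodesic_def by auto
      have eq: "(snd ?c \<circ> \<gamma>) s = (snd ?c \<circ> \<delta>) s" if "s \<in> {?a..\<tau>}" for s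
        using below[of s] at\<tau> that I1(2) by (cases "s = \<tau>") auto
      show ?thesis using has_vector_derivative_unique_Icc[OF a _ 1 2 eq] a by simp
    qed
    define b where "b = min b1 b2"
    have b: "\<tau> < b" "b \<le> b1" "b \<le> b2" "b \<le> 1" using I1(9,3) I2(9) lt by (auto simp: b_def)
    have sol1: "sol \<tau> b (snd ?c \<circ> \<gamma>) v1"
    proof -
      have "(snd ?c \<circ> \<gamma>) r \<in> cball (snd ?c (\<gamma> \<tau>)) \<rho>" if "r \<in> {\<tau>..b}" for r
      proof -
        have "\<gamma> r \<in> N" using that I1(5,7) b(2) by auto
        then show ?thesis unfolding N_def by auto
      qed
      then show ?thesis
        using chart_geodesic_subset[OF v1 I1(5) b(2)] unfolding sol_def chart_geodesic_def by blast
    qed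
    have sol2: "sol \<tau> b (snd ?c \<circ> \<delta>) v2"
    proof -
      have "(snd ?c \<circ> \<delta>) r \<in> cball (snd ?c (\<gamma> \<tau>)) \<rho>" if "r \<in> {\<tau>..b}" for r
      proof -
        have "\<delta> r \<in> N" using that I2(5,7) b(3) by auto
        then show ?thesis unfolding N_def by auto
      qed
      then show ?thesis
        using chart_geodesic_subset[OF v2 I2(5) b(3)] unfolding sol_def chart_geodesic_def by blast
    qed
    have "\<gamma> r = \<delta> r" if r: "r \<in> {\<tau>..b}" for r
    proof -
      have "(snd ?c \<circ> \<gamma>) r = (snd ?c \<circ> \<delta>) r"
        by (rule sol_unique[OF sol1 sol2 _ veq r]) (simp add: at\<tau>)
      moreover have "\<gamma> r \<in> fst ?c" "\<delta> r \<in> fst ?c"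
        using r I1(5,7) I2(5,7) b(2,3) N(4) by force+
      ultimately show ?thesis using chart_inverse(1)[OF c(1)] by (metis comp_apply)
    qed
    then have "b \<in> A" using below b \<tau> unfolding A_def by force
    then show False using cSup_upper[OF _ bdd] b(1) unfolding \<tau>_def by fastforce
  qed
  then show ?thesis using below at\<tau> t by (cases "t = 1") auto
qed

text \<open>An initial piece, however short, determines the initial velocity.\<close>

lemma geodesic_unique_germ:
  assumes g: "geodesic M \<gamma>" "geodesic M \<delta>" and e: "0 < e" "\<And>s. s \<in> {0..e} \<Longrightarrow> \<gamma> s = \<delta> s"
    and t: "t \<in> {0..1}"
  shows "\<gamma> t = \<delta> t"
proof (rule geodesic_unique[OF g _ _ t])
  show 0: "\<gamma> 0 = \<delta> 0" using e by simp
  let ?c = "chart_at M (\<gamma> 0)"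
  note c = chart_at[of "\<gamma> 0"]
  obtain w where w: "(snd ?c \<circ> \<gamma> has_vector_derivative w) (at 0 within {0..1})"
    using C1_curve_on_derivative[OF geodesic_C1[OF g(1)] c(1), of 0] c(2) by auto
  have "(snd ?c \<circ> \<delta> has_vector_derivative w) (at 0 within {0..1})"
    using w unfolding has_vector_derivative_def
  proof (rule has_derivative_transform_eventually)
    show "\<forall>\<^sub>F s in at 0 within {0..1}. (snd ?c \<circ> \<gamma>) s = (snd ?c \<circ> \<delta>) s"
      unfolding eventually_at using e by (intro exI[of _ e]) (auto simp: dist_real_def)
  qed (use 0 in auto)
  then show "velocity M \<gamma> 0 = velocity M \<delta> 0"
    using w velocity_eq[of 0 \<gamma> w] velocity_eq[of 0 \<delta> w] 0 by simp
qed

text \<open>Each part satisfies the geodesic equation in every chart already, so matching the velocities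
  in a single chart suffices, and the transformation law of the Christoffel symbols is avoided.\<close>

lemma geodesic_on_join:
  assumes g: "geodesic_on M a b \<sigma>" "geodesic_on M b d \<sigma>" and ord: "a < b" "b < d"
    and c0: "c0 \<in> charts M" "\<sigma> b \<in> fst c0"
    and der: "(snd c0 \<circ> \<sigma> has_vector_derivative w) (at b within {a..b})"
      "(snd c0 \<circ> \<sigma> has_vector_derivative w) (at b within {b..d})"
  shows "geodesic_on M a d \<sigma>"
  unfolding geodesic_on_def
proof (intro conjI ballI allI impI)
  have cont: "continuous_on {a..b} \<sigma>" "continuous_on {b..d} \<sigma>" using g by (auto simp: geodesic_on_def)
  then have "continuous_on ({a..b} \<union> {b..d}) \<sigma>" by (intro continuous_on_closed_Un) auto
  moreover have "{a..b} \<union> {b..d} = {a..d}" using ord by auto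
  ultimately show contd: "continuous_on {a..d} \<sigma>" by simp
  fix c s t assume c: "c \<in> charts M" and st: "a \<le> s \<and> s < t \<and> t \<le> d \<and> \<sigma> ` {s..t} \<subseteq> fst c"
  consider "t \<le> b" | "b \<le> s" | "s < b" "b < t" by linarith
  then show "\<exists>v. chart_geodesic M c (snd c \<circ> \<sigma>) v s t"
  proof cases
    case 1
    with st have o: "a \<le> s" "s < t" "t \<le> b" "\<sigma> ` {s..t} \<subseteq> fst c" by auto
    show ?thesis by (rule geodesic_onD[OF g(1) c o]) (rule exI)
  next
    case 2
    with st have o: "b \<le> s" "s < t" "t \<le> d" "\<sigma> ` {s..t} \<subseteq> fst c" by auto
    show ?thesis by (rule geodesic_onD[OF g(2) c o]) (rule exI)
  next
    case 3
    have "{s..b} \<subseteq> {s..t}" "{b..t} \<subseteq> {s..t}" using 3 by auto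
    then have im: "\<sigma> ` {s..b} \<subseteq> fst c" "\<sigma> ` {b..t} \<subseteq> fst c" using st by blast+
    obtain v1 where v1: "chart_geodesic M c (snd c \<circ> \<sigma>) v1 s b"
      using geodesic_onD[OF g(1) c _ 3(1) _ im(1)] st by blast
    obtain v2 where v2: "chart_geodesic M c (snd c \<circ> \<sigma>) v2 b t"
      using geodesic_onD[OF g(2) c _ 3(2) _ im(2)] st by blast
    \<comment> \<open>The common velocity \<open>w\<close> in \<open>c0\<close> becomes
      \<open>?D w\<close> in \<open>c\<close>, so the one-sided velocities in \<open>c\<close> agree
      at \<open>b\<close> as well.\<close>
    let ?D = "frechet_derivative (transition c0 c) (at (snd c0 (\<sigma> b)))"
    have \<sigma>b: "\<sigma> b \<in> fst c0 \<inter> fst c" using c0 im(1) 3 by auto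
    have "(snd c \<circ> \<sigma> has_vector_derivative ?D w) (at b within {a..b})"
      using cont(1) ord by (intro vector_derivative_change_chart[OF c0(1) c \<sigma>b _ _ der(1)])
        (auto simp: continuous_on_eq_continuous_within)
    then have "(snd c \<circ> \<sigma> has_vector_derivative ?D w) (at b within {s..b})"
      by (rule has_vector_derivative_within_subset) (use st in auto)
    moreover have "(snd c \<circ> \<sigma> has_vector_derivative v1 b) (at b within {s..b})"
      using v1 3 unfolding chart_geodesic_def by auto
    ultimately have w1: "v1 b = ?D w"
      using 3(1) vector_derivative_within_cbox[of s b b "snd c \<circ> \<sigma>"]
      by (metis atLeastAtMost_iff box_real(2) less_imp_le order_refl)
    have "(snd c \<circ> \<sigma> has_vector_derivative ?D w) (at b within {b..d})"
      using cont(2) ord by (intro vector_derivative_change_chart[OF c0(1) c \<sigma>b _ _ der(2)])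
        (auto simp: continuous_on_eq_continuous_within)
    then have "(snd c \<circ> \<sigma> has_vector_derivative ?D w) (at b within {b..t})"
      by (rule has_vector_derivative_within_subset) (use st in auto)
    moreover have "(snd c \<circ> \<sigma> has_vector_derivative v2 b) (at b within {b..t})"
      using v2 3 unfolding chart_geodesic_def by auto
    ultimately have w2: "v2 b = ?D w"
      using 3(2) vector_derivative_within_cbox[of b t b "snd c \<circ> \<sigma>"]
      by (metis atLeastAtMost_iff box_real(2) less_imp_le order_refl)
    define v where "v r = (if r \<in> {s..b} then v1 r else v2 r)" for r
    have v12: "v r = v2 r" if "r \<in> {b..t}" for r
      using that w1 w2 by (auto simp: v_def)
    have glue: "(f has_vector_derivative f') (at r within {s..t})"
      if l: "r \<in> {s..b} \<Longrightarrow> (f has_vector_derivative f') (at r within {s..b})"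
        and u: "r \<in> {b..t} \<Longrightarrow> (f has_vector_derivative f') (at r within {b..t})"
        and r: "r \<in> {s..t}" for f :: "real \<Rightarrow> real^2" and f' r
    proof -
      have st_eq: "{s..t} = {s..b} \<union> {b..t}" using 3 by auto
      consider "r < b" | "r = b" | "b < r" by linarith
      then show ?thesis
      proof cases
        case 1
        have "at r within {s..t} = at r within {s..b}"
          by (rule at_within_nhd[of r "{..<b}"]) (use 1 3 in auto)
        then show ?thesis using l 1 r by auto
      next
        case 2
        then have "(f has_vector_derivative f') (at r within {s..b} \<union> {b..t})"
          using l u 3 unfolding has_vector_derivative_def has_derivative_within by (auto intro: Lim_Un)
        then show ?thesis by (simp add: st_eq)
      next
        case c3: 3
        have "at r within {s..t} = at r within {b..t}"
          by (rule at_within_nhd[of r "{b<..}"]) (use c3 3 in auto)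
        then show ?thesis using u c3 r by auto
      qed
    qed
    have "chart_geodesic M c (snd c \<circ> \<sigma>) v s t"
      unfolding chart_geodesic_def
    proof (intro ballI conjI glue)
      fix r assume "r \<in> {s..b}"
      then show "(snd c \<circ> \<sigma> has_vector_derivative v r) (at r within {s..b})"
        using v1 unfolding chart_geodesic_def v_def by auto
    next
      fix r assume "r \<in> {b..t}"
      then show "(snd c \<circ> \<sigma> has_vector_derivative v r) (at r within {b..t})"
        using v2 v12 unfolding chart_geodesic_def by auto
    next
      fix r assume r: "r \<in> {s..b}"
      then have "(v1 has_vector_derivative geodesic_rhs (gcoeff M c) ((snd c \<circ> \<sigma>) r) (v r)) (at r within {s..b})"
        using v1 unfolding chart_geodesic_def v_def by auto
      then show "(v has_vector_derivative geodesic_rhs (gcoeff M c) ((snd c \<circ> \<sigma>) r) (v r)) (at r within {s..b})"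
        by (rule has_vector_derivative_transform[OF r, rotated]) (simp add: v_def)
    next
      fix r assume r: "r \<in> {b..t}"
      then have "(v2 has_vector_derivative geodesic_rhs (gcoeff M c) ((snd c \<circ> \<sigma>) r) (v r)) (at r within {b..t})"
        using v2 v12 unfolding chart_geodesic_def by auto
      then show "(v has_vector_derivative geodesic_rhs (gcoeff M c) ((snd c \<circ> \<sigma>) r) (v r)) (at r within {b..t})"
        by (rule has_vector_derivative_transform[OF r, rotated]) (simp add: v12)
    qed auto
    then show ?thesis by blast
  qed
qed

end

section \<open>The distance in a geodesic disk\<close>

context riemannian_surface
begin

section \<open>Arc length under reparametrization and concatenation\<close>

lemma gnorm_scale: "gnorm M c x (a *\<^sub>R w) = \<bar>a\<bar> * gnorm M c x w"
  unfolding gnorm_def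
  by (simp add: matrix_vector_mult_scaleR real_sqrt_mult mult.assoc[symmetric])

text \<open>The velocity is a derivative within the unit interval. This matters because geodesics of
  the disk are unique on that interval only.\<close>

lemma speed_cong:
  assumes eq: "\<And>t. t \<in> {0..1} \<Longrightarrow> \<sigma> t = \<tau> t" and t: "t \<in> {0..1}"
  shows "speed M \<sigma> t = speed M \<tau> t"
proof -
  have "((f \<circ> \<sigma>) has_vector_derivative w) (at t within {0..1}) \<longleftrightarrow>
      ((f \<circ> \<tau>) has_vector_derivative w) (at t within {0..1})" for f :: "'a \<Rightarrow> real^2" and w
    using has_vector_derivative_transform[OF t, of "f \<circ> \<sigma>" "f \<circ> \<tau>" w]
      has_vector_derivative_transform[OF t, of "f \<circ> \<tau>" "f \<circ> \<sigma>" w] eq by auto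
  then show ?thesis
    unfolding speed_def velocity_def vector_derivative_def eq[OF t] by simp
qed

lemma curve_length_cong:
  assumes "\<And>t. t \<in> {0..1} \<Longrightarrow> \<sigma> t = \<tau> t"
  shows "curve_length M \<sigma> = curve_length M \<tau>"
  unfolding curve_length_eq by (rule Henstock_Kurzweil_Integration.integral_cong) (rule speed_cong[OF assms])

text \<open>The condition on the filters says that \<open>{a..b}\<close> fills the unit interval
  near \<open>r\<close>. It fails at the inner joint of two curves, where each piece determines a
  one-sided derivative only.\<close>

lemma speed_affine:
  assumes C1: "C1_curve_on M 0 1 \<gamma>" and r: "r \<in> {0..1}" and cont: "continuous_on {0..1} \<sigma>"
    and ab: "a < b" "r \<in> {a..b}" and at: "at r within {0..1} = at r within {a..b}"
    and mem: "\<And>q. q \<in> {a..b} \<Longrightarrow> m * q + k \<in> {0..1}" and eq: "\<And>q. q \<in> {a..b} \<Longrightarrow> \<sigma> q = \<gamma> (m * q + k)"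
  shows "speed M \<sigma> r = \<bar>m\<bar> * speed M \<gamma> (m * r + k)"
proof -
  let ?c = "chart_at M (\<sigma> r)"
  note c = chart_at[of "\<sigma> r"]
  have e: "\<gamma> (m * r + k) = \<sigma> r" "m * r + k \<in> {0..1}" using eq mem ab by auto
  have contg: "continuous_on {0..1} \<gamma>" using C1 by (simp add: C1_curve_on_def)
  obtain w where w: "(snd ?c \<circ> \<gamma> has_vector_derivative w) (at (m * r + k) within {0..1})"
    using C1_curve_on_derivative[OF C1 c(1) e(2)] c(2) e(1) by metis
  have "((\<lambda>q. (snd ?c \<circ> \<gamma>) (m * q + k)) has_vector_derivative m *\<^sub>R w) (at r within {a..b})"
    using w mem by (rule has_vector_derivative_affine)
  then have "(snd ?c \<circ> \<sigma> has_vector_derivative m *\<^sub>R w) (at r within {a..b})"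
    by (rule has_vector_derivative_transform[OF ab(2), rotated]) (simp add: eq)
  then have "speed M \<sigma> r = gnorm M ?c (snd ?c (\<sigma> r)) (m *\<^sub>R w)"
    using speed_eq[OF c(1) r c(2) cont] at by simp
  also have "\<dots> = \<bar>m\<bar> * gnorm M ?c (snd ?c (\<sigma> r)) w" by (rule gnorm_scale)
  also have "gnorm M ?c (snd ?c (\<sigma> r)) w = speed M \<gamma> (m * r + k)"
    using speed_eq[OF c(1) e(2) _ contg w] c(2) e(1) by simp
  finally show ?thesis .
qed

lemma speed_subcurve:
  assumes C1: "C1_curve_on M 0 1 \<gamma>" and u: "u \<in> {0..1}" and v: "v \<in> {0..1}" and r: "r \<in> {0..1}"
  shows "speed M (subcurve u v \<gamma>) r = \<bar>v - u\<bar> * speed M \<gamma> ((v - u) * r + u)"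
proof (rule speed_affine[OF C1 r _ zero_less_one r])
  have "continuous_on {0..1} \<gamma>" using C1 by (simp add: C1_curve_on_def)
  then have "continuous_on {0..1} (\<lambda>r. \<gamma> ((v - u) * r + u))"
    by (rule continuous_on_compose2)
      (use affine_mem_01[OF u v] in \<open>auto intro!: continuous_intros simp del: atLeastAtMost_iff\<close>)
  then show "continuous_on {0..1} (subcurve u v \<gamma>)" by (simp add: subcurve_def[abs_def])
qed (auto simp: subcurve_def affine_mem_01 u v simp del: atLeastAtMost_iff)

lemma speed_integrable: "C1_curve_on M 0 1 \<gamma> \<Longrightarrow> speed M \<gamma> integrable_on {0..1}"
  by (intro integrable_continuous_real speed_continuous)

lemma speed_integrable': "C1_curve_on M 0 1 \<gamma> \<Longrightarrow> 0 \<le> a \<Longrightarrow> b \<le> 1 \<Longrightarrow> speed M \<gamma> integrable_on {a..b}"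
  by (rule integrable_on_subinterval[OF speed_integrable]) auto

lemma curve_length_subcurve:
  assumes C1: "C1_curve_on M 0 1 \<gamma>" and u: "u \<in> {0..1}" and v: "v \<in> {0..1}" and uv: "u \<le> v"
  shows "curve_length M (subcurve u v \<gamma>) = integral {u..v} (speed M \<gamma>)"
proof (cases "u = v")
  case True
  have "curve_length M (subcurve u v \<gamma>) = integral {0..1} (\<lambda>r::real. 0)"
    unfolding curve_length_eq by (rule Henstock_Kurzweil_Integration.integral_cong) (use speed_subcurve[OF C1 u v] True in auto)
  then show ?thesis using True by simp
next
  case False
  let ?I = "integral {u..v} (speed M \<gamma>)"
  have "(speed M \<gamma> has_integral ?I) (cbox u v)"
    using speed_integrable'[OF C1, of u v] u v by (simp add: integrable_integral)
  from has_integral_affinity'[OF this, of "v - u" u]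
  have "((\<lambda>r. speed M \<gamma> ((v - u) * r + u)) has_integral ?I / (v - u)) {0..1}"
    using False uv by (simp add: divide_inverse mult.commute)
  from has_integral_mult_right[OF this, of "v - u"]
  have "((\<lambda>r. (v - u) * speed M \<gamma> ((v - u) * r + u)) has_integral ?I) {0..1}"
    using False by simp
  moreover have "curve_length M (subcurve u v \<gamma>) = integral {0..1} (\<lambda>r. (v - u) * speed M \<gamma> ((v - u) * r + u))"
    unfolding curve_length_eq by (rule Henstock_Kurzweil_Integration.integral_cong) (simp add: speed_subcurve[OF C1 u v] uv del: atLeastAtMost_iff)
  ultimately show ?thesis using integral_unique by metis
qed

lemma curve_length_reverse:
  assumes C1: "C1_curve_on M 0 1 \<gamma>"
  shows "curve_length M (subcurve 1 0 \<gamma>) = curve_length M \<gamma>"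
proof -
  have "(speed M \<gamma> has_integral curve_length M \<gamma>) (cbox 0 1)"
    using speed_integrable[OF C1] by (simp add: integrable_integral curve_length_eq)
  from has_integral_affinity[OF this, of "-1" 1]
  have "((\<lambda>r. speed M \<gamma> (- r + 1)) has_integral curve_length M \<gamma>) ((\<lambda>x. 1 - x) ` {0..1})" by simp
  moreover have "(\<lambda>x. 1 - x) ` {0..1} = {0..1::real}" by (simp add: image_diff_atLeastAtMost)
  ultimately have "((\<lambda>r. speed M \<gamma> (- r + 1)) has_integral curve_length M \<gamma>) {0..1}" by simp
  moreover have "curve_length M (subcurve 1 0 \<gamma>) = integral {0..1} (\<lambda>r. speed M \<gamma> (- r + 1))"
    unfolding curve_length_eq using speed_subcurve[OF C1, of 1 0] by (intro Henstock_Kurzweil_Integration.integral_cong) simp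
  ultimately show ?thesis using integral_unique by metis
qed

lemma C1_curve_on_affine:
  assumes C1: "C1_curve_on M p q \<gamma>" and m: "0 < m" and ab: "p = m * a + k" "q = m * b + k"
    and eq: "\<And>r. r \<in> {a..b} \<Longrightarrow> \<sigma> r = \<gamma> (m * r + k)"
  shows "C1_curve_on M a b \<sigma>"
  unfolding C1_curve_on_def
proof (intro conjI ballI allI impI)
  have mem: "m * r + k \<in> {m * s + k..m * t + k}" if "r \<in> {s..t}" for r s t
    using that m by auto
  have "continuous_on {p..q} \<gamma>" using C1 by (simp add: C1_curve_on_def)
  then have "continuous_on {a..b} (\<lambda>r. \<gamma> (m * r + k))"
    by (rule continuous_on_compose2) (use mem ab in \<open>auto intro!: continuous_intros simp del: atLeastAtMost_iff\<close>)
  then show "continuous_on {a..b} \<sigma>" by (rule continuous_on_cong[OF refl, THEN iffD1, rotated]) (rule eq[symmetric])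
  fix c s t assume c: "c \<in> charts M" and st: "a \<le> s \<and> s < t \<and> t \<le> b \<and> \<sigma> ` {s..t} \<subseteq> fst c"
  have eq': "\<sigma> r = \<gamma> (m * r + k)" if "r \<in> {s..t}" for r using eq st that by auto
  have 1: "p \<le> m * s + k" "m * s + k < m * t + k" "m * t + k \<le> q" using st m ab by auto
  have 2: "\<gamma> ` {m * s + k..m * t + k} \<subseteq> fst c"
  proof
    fix y assume "y \<in> \<gamma> ` {m * s + k..m * t + k}"
    then obtain u where u: "u \<in> {m * s + k..m * t + k}" "y = \<gamma> u" by blast
    have "m * s \<le> u - k" "u - k \<le> m * t" using u(1) by auto
    then have "(u - k) / m \<in> {s..t}" using m by (simp add: field_simps)
    moreover have "u = m * ((u - k) / m) + k" using m by simp
    ultimately have "y = \<sigma> ((u - k) / m)" "(u - k) / m \<in> {s..t}" using eq' u(2) by metis+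
    then show "y \<in> fst c" using st by blast
  qed
  obtain v where v: "continuous_on {m * s + k..m * t + k} v"
    "\<And>r. r \<in> {m * s + k..m * t + k} \<Longrightarrow> (snd c \<circ> \<gamma> has_vector_derivative v r) (at r within {m * s + k..m * t + k})"
    using C1_curve_onD[OF C1 c 1 2] by blast
  show "\<exists>v. continuous_on {s..t} v \<and>
      (\<forall>r\<in>{s..t}. (snd c \<circ> \<sigma> has_vector_derivative v r) (at r within {s..t}))"
  proof (intro exI[of _ "\<lambda>r. m *\<^sub>R v (m * r + k)"] conjI ballI)
    have "continuous_on {s..t} (\<lambda>r. v (m * r + k))"
      by (rule continuous_on_compose2[OF v(1)]) (use mem in \<open>auto intro!: continuous_intros simp del: atLeastAtMost_iff\<close>)
    then show "continuous_on {s..t} (\<lambda>r. m *\<^sub>R v (m * r + k))" by (intro continuous_intros)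
    fix r assume r: "r \<in> {s..t}"
    have "((\<lambda>q. (snd c \<circ> \<gamma>) (m * q + k)) has_vector_derivative m *\<^sub>R v (m * r + k)) (at r within {s..t})"
      using v(2)[OF mem[OF r]] mem by (rule has_vector_derivative_affine)
    then show "(snd c \<circ> \<sigma> has_vector_derivative m *\<^sub>R v (m * r + k)) (at r within {s..t})"
      by (rule has_vector_derivative_transform[OF r, rotated]) (simp add: eq')
  qed
qed

text \<open>The joined curve may have a corner at 1/2, where its velocity is unspecified. A single
  point does not affect the integral, and by substitution each half contributes the length of its
  piece.\<close>

lemma curve_length_join:
  assumes C1: "C1_curve_on M 0 1 \<alpha>" "C1_curve_on M 0 1 \<beta>" and j: "pathfinish \<alpha> = pathstart \<beta>"
  shows "joins M (pathstart \<alpha>) (pathfinish \<beta>) (\<alpha> +++ \<beta>)"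
    and "curve_length M (\<alpha> +++ \<beta>) = curve_length M \<alpha> + curve_length M \<beta>"
proof -
  let ?\<sigma> = "\<alpha> +++ \<beta>"
  have p: "path ?\<sigma>" using C1 j by (intro path_join_imp) (auto simp: C1_curve_on_def path_def)
  then have cont: "continuous_on {0..1} ?\<sigma>" by (simp add: path_def)
  have e1: "?\<sigma> r = \<alpha> (2 * r + 0)" if "r \<in> {0..1/2}" for r
    using that by (auto simp: joinpaths_def)
  have e2: "?\<sigma> r = \<beta> (2 * r + (- 1))" if "r \<in> {1/2..1}" for r
  proof (cases "r = 1/2")
    case True
    then show ?thesis using j unfolding joinpaths_def pathfinish_def pathstart_def True by simp
  next
    case False
    then show ?thesis using that by (simp add: joinpaths_def)
  qed
  have D1: "C1_curve_on M 0 (1/2) ?\<sigma>" by (rule C1_curve_on_affine[OF C1(1) _ _ _ e1]) auto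
  have D2: "C1_curve_on M (1/2) 1 ?\<sigma>" by (rule C1_curve_on_affine[OF C1(2) _ _ _ e2]) auto
  show "joins M (pathstart \<alpha>) (pathfinish \<beta>) ?\<sigma>"
    unfolding joins_def piecewise_C1_curve_def
  proof (intro conjI exI[of _ "2::nat"] exI[of _ "\<lambda>i. real i / 2"] allI impI)
    fix i :: nat assume "i < 2"
    then have "i = 0 \<or> i = 1" by auto
    then show "C1_curve_on M (real i / 2) (real (Suc i) / 2) ?\<sigma>" using D1 D2 by auto
  qed (use p in auto)
  have s1: "speed M ?\<sigma> r = 2 * speed M \<alpha> (2 * r)" if "r \<in> {0..1/2} - {1/2}" for r
  proof -
    have "at r within {0..1} = at r within {0..1/2}"
      by (rule at_within_nhd[of r "{..<1/2}"]) (use that in auto)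
    then have "speed M ?\<sigma> r = \<bar>2\<bar> * speed M \<alpha> (2 * r + 0)"
      using that by (intro speed_affine[OF C1(1) _ cont, where a = 0 and b = "1/2"]) (auto simp: e1)
    then show ?thesis by simp
  qed
  have s2: "speed M ?\<sigma> r = 2 * speed M \<beta> (2 * r - 1)" if "r \<in> {1/2..1} - {1/2}" for r
  proof -
    have "at r within {0..1} = at r within {1/2..1}"
      by (rule at_within_nhd[of r "{1/2<..}"]) (use that in auto)
    then have "speed M ?\<sigma> r = \<bar>2\<bar> * speed M \<beta> (2 * r + (- 1))"
      using that by (intro speed_affine[OF C1(2) _ cont, where a = "1/2" and b = 1]) (auto simp: e2)
    then show ?thesis by simp
  qed
  have hi: "((\<lambda>r. 2 * f (2 * r + k)) has_integral I) {(- k) / 2..(1 - k) / 2}" if "(f has_integral I) {0..1}"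
    for f :: "real \<Rightarrow> real" and I k
  proof -
    have "((\<lambda>r. f (2 * r + k)) has_integral I / 2) {(- k) / 2..(1 - k) / 2}"
      using has_integral_affinity'[of f I 0 1 2 k] that by simp
    from has_integral_mult_right[OF this, of 2] show ?thesis by simp
  qed
  have "(speed M \<alpha> has_integral curve_length M \<alpha>) {0..1}" "(speed M \<beta> has_integral curve_length M \<beta>) {0..1}"
    using speed_integrable C1 by (simp_all add: integrable_integral curve_length_eq)
  from hi[OF this(1), of 0] hi[OF this(2), of "-1"]
  have h: "((\<lambda>r. 2 * speed M \<alpha> (2 * r)) has_integral curve_length M \<alpha>) {0..1/2}"
    "((\<lambda>r. 2 * speed M \<beta> (2 * r - 1)) has_integral curve_length M \<beta>) {1/2..1}" by simp_all
  have "(speed M ?\<sigma> has_integral curve_length M \<alpha>) {0..1/2}"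
    by (rule has_integral_spike_finite[OF _ _ h(1), of "{1/2}"]) (simp_all add: s1 del: atLeastAtMost_iff)
  moreover have "(speed M ?\<sigma> has_integral curve_length M \<beta>) {1/2..1}"
    by (rule has_integral_spike_finite[OF _ _ h(2), of "{1/2}"]) (simp_all add: s2 del: atLeastAtMost_iff)
  ultimately have "(speed M ?\<sigma> has_integral curve_length M \<alpha> + curve_length M \<beta>) {0..1}"
    by (rule has_integral_combine[rotated 2]) auto
  then show "curve_length M ?\<sigma> = curve_length M \<alpha> + curve_length M \<beta>"
    unfolding curve_length_eq by (rule integral_unique)
qed

lemma velocity_const: "velocity M (\<lambda>r. P) 0 = 0"
  by (rule velocity_eq) (auto simp: comp_def)

lemma speed_zero_iff:
  assumes "C1_curve_on M 0 1 \<gamma>" "t \<in> {0..1}"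
  shows "speed M \<gamma> t = 0 \<longleftrightarrow> velocity M \<gamma> t = 0"
  unfolding speed_def tangent_norm_def tangent_inner_def
  using gcoeff_pos[OF chart_at(1) chart_inverse(4)[OF chart_at], of "velocity M \<gamma> t" "\<gamma> t"] by fastforce

end

section \<open>The metric given by the geodesics of the disk\<close>

locale geodesic_disk_surface = riemannian_surface M
  for M :: "'a::{t2_space, second_countable_topology} surface" +
  fixes U :: "'a set"
  assumes disk: "geodesic_disk M U"
begin

abbreviation geo :: "'a \<Rightarrow> 'a \<Rightarrow> real \<Rightarrow> 'a" where "geo \<equiv> geod M U"

text \<open>The length of the chosen geodesic takes the place of an infimum over curves; minimality
  enters through \<open>gd_le\<close>.\<close>

definition gd :: "'a \<Rightarrow> 'a \<Rightarrow> real" where "gd P Q = curve_length M (geo P Q)"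

lemma geo_within: "P \<in> U \<Longrightarrow> Q \<in> U \<Longrightarrow> geodesic_within M U P Q (geo P Q)"
  using disk unfolding geodesic_disk_def geod_def by (metis someI_ex)

lemma geo:
  assumes "P \<in> U" "Q \<in> U"
  shows "geodesic M (geo P Q)" "geo P Q 0 = P" "geo P Q 1 = Q" "r \<in> {0..1} \<Longrightarrow> geo P Q r \<in> U"
    "C1_curve_on M 0 1 (geo P Q)" "path (geo P Q)" "path_image (geo P Q) \<subseteq> U"
  using geo_within[OF assms] geodesic_C1 unfolding geodesic_within_def path_image_def geodesic_def pathstart_def pathfinish_def
  by blast+

lemma geo_eq:
  assumes "P \<in> U" "Q \<in> U" "geodesic M \<gamma>" "\<gamma> 0 = P" "\<gamma> 1 = Q" "\<And>r. r \<in> {0..1} \<Longrightarrow> \<gamma> r \<in> U" "t \<in> {0..1}"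
  shows "\<gamma> t = geo P Q t"
proof -
  have "geodesic_within M U P Q \<gamma>"
    using assms unfolding geodesic_within_def pathstart_def pathfinish_def path_image_def by blast
  then show ?thesis using disk geo_within[OF assms(1,2)] assms(1,2,7) unfolding geodesic_disk_def by metis
qed

lemma gd_le:
  assumes P: "P \<in> U" and Q: "Q \<in> U" and j: "joins M P Q \<sigma>"
  shows "gd P Q \<le> curve_length M \<sigma>"
proof -
  obtain \<gamma> where \<gamma>: "geodesic_within M U P Q \<gamma>"
    "\<And>\<gamma>'. geodesic_within M U P Q \<gamma>' \<Longrightarrow> \<forall>t\<in>{0..1}. \<gamma>' t = \<gamma> t"
    "\<And>\<sigma>. joins M P Q \<sigma> \<Longrightarrow> curve_length M \<gamma> \<le> curve_length M \<sigma>"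
    using disk P Q unfolding geodesic_disk_def by metis
  have "curve_length M (geo P Q) = curve_length M \<gamma>"
    by (rule curve_length_cong) (use \<gamma>(2)[OF geo_within[OF P Q]] in blast)
  then show ?thesis unfolding gd_def using \<gamma>(3)[OF j] by simp
qed

lemma gd_le_C1:
  assumes "P \<in> U" "Q \<in> U" "C1_curve_on M 0 1 \<sigma>" "\<sigma> 0 = P" "\<sigma> 1 = Q"
  shows "gd P Q \<le> curve_length M \<sigma>"
  using assms by (intro gd_le C1_curve_joins) (auto simp: pathstart_def pathfinish_def)

lemma gd_nonneg: "P \<in> U \<Longrightarrow> Q \<in> U \<Longrightarrow> 0 \<le> gd P Q"
  unfolding gd_def curve_length_eq
  by (intro integral_nonneg speed_integrable geo(5) speed_nonneg)

lemma gd_triangle: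
  assumes U: "P \<in> U" "Q \<in> U" "Y \<in> U"
  shows "gd P Q \<le> gd P Y + gd Y Q"
proof -
  note g1 = geo[OF U(1,3)] and g2 = geo[OF U(3,2)]
  have j: "pathfinish (geo P Y) = pathstart (geo Y Q)" using g1 g2 by (simp add: pathstart_def pathfinish_def)
  have "joins M P Q (geo P Y +++ geo Y Q)"
    using curve_length_join(1)[OF g1(5) g2(5) j] g1 g2 by (simp add: pathstart_def pathfinish_def)
  then show ?thesis
    using gd_le[OF U(1,2)] curve_length_join(2)[OF g1(5) g2(5) j] unfolding gd_def by metis
qed

text \<open>A rescaled piece of a geodesic of the disk is again a geodesic in \<open>U\<close>,
  hence the one chosen between its end points. With \<open>u > v\<close> this covers
  reversal.\<close>

lemma geo_subcurve:
  assumes U: "P \<in> U" "Q \<in> U" and u: "u \<in> {0..1}" and v: "v \<in> {0..1}" and r: "r \<in> {0..1}"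
  shows "geo (geo P Q u) (geo P Q v) r = subcurve u v (geo P Q) r"
proof (rule geo_eq[symmetric])
  note g = geo[OF U]
  show "geo P Q u \<in> U" "geo P Q v \<in> U" using g(4) u v by auto
  show "geodesic M (subcurve u v (geo P Q))" by (rule geodesic_subcurve[OF g(1) u v])
  show "subcurve u v (geo P Q) r \<in> U" if "r \<in> {0..1}" for r
    unfolding subcurve_def by (rule g(4)) (rule affine_mem_01[OF u v that])
qed (use r in \<open>auto simp: subcurve_def\<close>)

lemma gd_geo:
  assumes U: "P \<in> U" "Q \<in> U" and u: "u \<in> {0..1}" and v: "v \<in> {0..1}" and uv: "u \<le> v"
  shows "gd (geo P Q u) (geo P Q v) = integral {u..v} (speed M (geo P Q))"
proof -
  have "gd (geo P Q u) (geo P Q v) = curve_length M (subcurve u v (geo P Q))"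
    unfolding gd_def by (rule curve_length_cong) (rule geo_subcurve[OF U u v])
  then show ?thesis using curve_length_subcurve[OF geo(5)[OF U] u v uv] by simp
qed

lemma gd_self: "P \<in> U \<Longrightarrow> gd P P = 0"
  using gd_geo[of P P 0 0] geo(2)[of P P] by simp

lemma gd_between:
  assumes U: "P \<in> U" "Q \<in> U" and t: "t \<in> {0..1}"
  shows "gd P (geo P Q t) + gd (geo P Q t) Q = gd P Q"
proof -
  note g = geo[OF U]
  have "gd P (geo P Q t) = integral {0..t} (speed M (geo P Q))"
    "gd (geo P Q t) Q = integral {t..1} (speed M (geo P Q))"
    using gd_geo[OF U, of 0 t] gd_geo[OF U, of t 1] t g by auto
  moreover have "integral {0..t} (speed M (geo P Q)) + integral {t..1} (speed M (geo P Q)) = gd P Q"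
    unfolding gd_def curve_length_eq
    by (rule Henstock_Kurzweil_Integration.integral_combine) (use t speed_integrable[OF g(5)] in auto)
  ultimately show ?thesis by simp
qed

lemma geo_reverse:
  assumes U: "P \<in> U" "Q \<in> U" and r: "r \<in> {0..1}"
  shows "geo Q P r = geo P Q (1 - r)"
  using geo_subcurve[OF U, of 1 0 r] r geo(2,3)[OF U] by (simp add: subcurve_def)

lemma gd_sym:
  assumes U: "P \<in> U" "Q \<in> U"
  shows "gd P Q = gd Q P"
proof -
  have "gd Q P = curve_length M (subcurve 1 0 (geo P Q))"
    unfolding gd_def by (rule curve_length_cong) (simp add: geo_reverse[OF U] subcurve_def)
  then show ?thesis using curve_length_reverse[OF geo(5)[OF U]] by (simp add: gd_def)
qed

text \<open>By uniqueness a geodesic with zero initial velocity is constant.\<close>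

lemma velocity_geo_nonzero:
  assumes U: "P \<in> U" "Q \<in> U" and ne: "P \<noteq> Q"
  shows "velocity M (geo P Q) 0 \<noteq> 0"
proof
  assume 0: "velocity M (geo P Q) 0 = 0"
  have "geo P Q 1 = (\<lambda>r. P) 1"
    by (rule geodesic_unique[OF geo(1)[OF U]])
      (use geo(2)[OF U] 0 velocity_const geodesic_on_const in \<open>auto simp: geodesic_iff\<close>)
  then show False using geo(3)[OF U] ne by simp
qed

lemma gd_pos:
  assumes U: "P \<in> U" "Q \<in> U" and ne: "P \<noteq> Q"
  shows "0 < gd P Q"
proof (rule ccontr)
  assume "\<not> 0 < gd P Q"
  then have z: "integral (cbox 0 1) (speed M (geo P Q)) = 0"
    using gd_nonneg[OF U] by (simp add: gd_def curve_length_eq)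
  have "speed M (geo P Q) 0 = 0"
    using integral_cbox_eq_0_iff[of 0 1 "speed M (geo P Q)"] speed_continuous[OF geo(5)[OF U]] z speed_nonneg by auto
  then show False using speed_zero_iff[OF geo(5)[OF U], of 0] velocity_geo_nonzero[OF assms] by simp
qed

text \<open>By uniqueness in \<open>U\<close> the two geodesics have the same piece from
  \<open>X\<close> to \<open>Y\<close>. Up to the ratio of the parameters at \<open>Y\<close> they
  share a germ, so one runs along the other to its end.\<close>

lemma geo_nonbranching:
  assumes U: "X \<in> U" "P \<in> U" "Q \<in> U" and Y: "Y \<in> path_image (geo X P)" "Y \<in> path_image (geo X Q)" "Y \<noteq> X"
  shows "P \<in> path_image (geo X Q) \<or> Q \<in> path_image (geo X P)"
proof -
  have main: "P \<in> path_image (geo X Q)"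
    if U: "P \<in> U" "Q \<in> U" and s: "s \<in> {0..1}" "s' \<in> {0..1}" "s' \<le> s" "0 < s"
      and eq: "geo X P s = geo X Q s'" for P Q s s'
  proof -
    \<comment> \<open>Parameter \<open>s\<close> on the first curve corresponds to \<open>s'\<close>
      on the second. As \<open>s' \<le> s\<close>, the end \<open>P\<close> of the first corresponds
      to a parameter of the second within the unit interval.\<close>
    define l where "l = s' / s"
    have l: "0 \<le> l" "l \<le> 1" using s by (auto simp: l_def)
    have "geo X P r = subcurve 0 l (geo X Q) r" if r: "r \<in> {0..1}" for r
    proof (rule geodesic_unique_germ[OF geo(1)[OF assms(1) U(1)] geodesic_subcurve[OF geo(1)[OF assms(1) U(2)]] s(4) _ r])
      fix q assume q: "q \<in> {0..s}"
      have qs: "q / s \<in> {0..1}" using q s(4) by auto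
      have "geo X P q = subcurve 0 s (geo X P) (q / s)" using s(4) by (simp add: subcurve_def)
      also have "\<dots> = geo X (geo X P s) (q / s)"
        using geo_subcurve[OF assms(1) U(1), of 0 s "q / s"] s(1) qs geo(2)[OF assms(1) U(1)] by simp
      also have "\<dots> = geo X (geo X Q s') (q / s)" by (simp add: eq)
      also have "\<dots> = subcurve 0 s' (geo X Q) (q / s)"
        using geo_subcurve[OF assms(1) U(2), of 0 s' "q / s"] s(2) qs geo(2)[OF assms(1) U(2)] by simp
      also have "\<dots> = subcurve 0 l (geo X Q) q" by (simp add: subcurve_def l_def)
      finally show "geo X P q = subcurve 0 l (geo X Q) q" .
    qed (use l in auto)
    from this[of 1] have "P = geo X Q l" using geo(3)[OF assms(1) U(1)] by (simp add: subcurve_def)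
    then show ?thesis using l unfolding path_image_def by auto
  qed
  obtain s where s: "s \<in> {0..1}" "Y = geo X P s" using Y(1) unfolding path_image_def by blast
  obtain s' where s': "s' \<in> {0..1}" "Y = geo X Q s'" using Y(2) unfolding path_image_def by blast
  have pos: "0 < s" "0 < s'"
    using Y(3) s s' geo(2)[OF U(1,2)] geo(2)[OF U(1,3)] by (metis atLeastAtMost_iff less_eq_real_def)+
  show ?thesis
  proof (cases "s' \<le> s")
    case True
    then show ?thesis using main[OF U(2,3) s(1) s'(1) True pos(1)] s(2) s'(2) by simp
  next
    case False
    then show ?thesis using main[OF U(3,2) s'(1) s(1) _ pos(2)] s(2) s'(2) by simp
  qed
qed

lemma geo_const: "P \<in> U \<Longrightarrow> r \<in> {0..1} \<Longrightarrow> geo P P r = P"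
  using geo_eq[of P P "\<lambda>r. P" r] geodesic_on_const[of M 0 1 P] unfolding geodesic_iff by metis

text \<open>A piece that returns to its start is the geodesic from a point to itself, hence
  constant. By uniqueness of germs, forwards and backwards, the whole geodesic is then constant,
  although its ends differ.\<close>

lemma geo_inj:
  assumes U: "P \<in> U" "Q \<in> U" and ne: "P \<noteq> Q" and s: "s \<in> {0..1}" "t \<in> {0..1}" "geo P Q s = geo P Q t"
  shows "s = t"
proof -
  have no: False if st: "s \<in> {0..1}" "t \<in> {0..1}" "geo P Q s = geo P Q t" "s < t" for s t
  proof -
    have const: "subcurve s t (geo P Q) r = geo P Q s" if "r \<in> {0..1}" for r
      using geo_subcurve[OF U st(1,2) that] geo_const[OF geo(4)[OF U st(1)] that] st(3) by simp
    have fwd: "subcurve s 1 (geo P Q) 1 = geo P Q s"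
    proof (rule geodesic_unique_germ[of "subcurve s 1 (geo P Q)" "\<lambda>r. geo P Q s" "t - s" 1])
      show "geodesic M (subcurve s 1 (geo P Q))" using st(1) by (intro geodesic_subcurve geo(1) U) auto
      fix q assume q: "q \<in> {0..t - s}"
      have "q * (1 - s) \<le> (t - s) * 1" using q st by (intro mult_mono) auto
      then have "q * (1 - s) / (t - s) \<in> {0..1}" using q st by auto
      from const[OF this] show "subcurve s 1 (geo P Q) q = geo P Q s"
        using st(4) by (simp add: subcurve_def mult.commute)
    qed (use st geodesic_on_const in \<open>auto simp: geodesic_iff\<close>)
    have bwd: "subcurve t 0 (geo P Q) 1 = geo P Q s"
    proof (rule geodesic_unique_germ[of "subcurve t 0 (geo P Q)" "\<lambda>r. geo P Q s" "t - s" 1])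
      show "geodesic M (subcurve t 0 (geo P Q))" using st(2) by (intro geodesic_subcurve geo(1) U) auto
      fix q assume q: "q \<in> {0..t - s}"
      have "t * q \<le> 1 * (t - s)" using q st by (intro mult_mono) auto
      then have "1 - t * q / (t - s) \<in> {0..1}" using q st by auto
      note const[OF this]
      moreover have "(t - s) * (1 - t * q / (t - s)) + s = (0 - t) * q + t"
        using st(4) by (simp add: right_diff_distrib)
      ultimately show "subcurve t 0 (geo P Q) q = geo P Q s" by (simp only: subcurve_def)
    qed (use st geodesic_on_const in \<open>auto simp: geodesic_iff\<close>)
    show False using fwd bwd geo(2,3)[OF U] ne by (simp add: subcurve_def)
  qed
  show ?thesis using no[OF s] no[OF s(2,1) s(3)[symmetric]] by (meson linorder_neqE)
qed

lemma arc_geo: "P \<in> U \<Longrightarrow> Q \<in> U \<Longrightarrow> P \<noteq> Q \<Longrightarrow> arc (geo P Q)"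
  unfolding arc_def inj_on_def using geo(6) geo_inj by blast

lemma path_image_geo_sym:
  assumes "P \<in> U" "Q \<in> U"
  shows "path_image (geo P Q) = path_image (geo Q P)"
proof -
  have "path_image (geo P Q) \<subseteq> path_image (geo Q P)" if "P \<in> U" "Q \<in> U" for P Q
  proof
    fix Y assume "Y \<in> path_image (geo P Q)"
    then obtain r where "r \<in> {0..1}" "Y = geo P Q r" unfolding path_image_def by blast
    then have "Y = geo Q P (1 - r)" "1 - r \<in> {0..1}" using geo_reverse[OF that(2,1)] by auto
    then show "Y \<in> path_image (geo Q P)" unfolding path_image_def by blast
  qed
  then show ?thesis using assms by blast
qed

end

section \<open>First variation\<close>

context riemannian_surface
begin

text \<open>By homogeneity unit vectors suffice, and over \<open>S\<close> they form a compact set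
  on which the positive continuous function \<open>gnorm\<close> attains its bounds.\<close>

lemma gnorm_comparable:
  assumes c: "c \<in> charts M" and S: "compact S" "S \<subseteq> coord_image c"
  obtains a b where "0 < a" "0 < b" "\<And>p w. p \<in> S \<Longrightarrow> a * norm w \<le> gnorm M c p w"
    "\<And>p w. p \<in> S \<Longrightarrow> gnorm M c p w \<le> b * norm w"
proof (cases "S = {}")
  case True
  then show ?thesis using that[of 1 1] by simp
next
  case False
  let ?T = "S \<times> sphere (0::real^2) 1"
  let ?g = "\<lambda>q. gnorm M c (fst q) (snd q)"
  have T: "compact ?T" using S(1) by (intro compact_Times) auto
  have "axis 1 1 \<in> sphere (0::real^2) 1" by simp
  then have ne: "?T \<noteq> {}" using False by blast
  have cont: "continuous_on ?T ?g"
    by (rule gnorm_continuous[OF c]) (use S(2) in \<open>auto intro!: continuous_intros\<close>)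
  obtain q1 where q1: "q1 \<in> ?T" "\<And>q. q \<in> ?T \<Longrightarrow> ?g q1 \<le> ?g q"
    using continuous_attains_inf[OF T ne cont] by blast
  obtain q2 where q2: "q2 \<in> ?T" "\<And>q. q \<in> ?T \<Longrightarrow> ?g q \<le> ?g q2"
    using continuous_attains_sup[OF T ne cont] by blast
  have pos: "0 < ?g q" if "q \<in> ?T" for q
    using that S(2) by (intro gnorm_pos[OF c]) auto
  have *: "?g q1 * norm w \<le> gnorm M c p w \<and> gnorm M c p w \<le> ?g q2 * norm w" if p: "p \<in> S" for p w
  proof (cases "w = 0")
    case True
    then show ?thesis by (simp add: gnorm_def)
  next
    case False
    define e where "e = (1 / norm w) *\<^sub>R w"
    have e: "(p, e) \<in> ?T" "w = norm w *\<^sub>R e" using p False by (auto simp: e_def)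
    have "gnorm M c p w = norm w * gnorm M c p e" by (subst e(2)) (simp add: gnorm_scale)
    moreover have "norm w * ?g q1 \<le> norm w * gnorm M c p e" "norm w * gnorm M c p e \<le> norm w * ?g q2"
      using q1(2)[OF e(1)] q2(2)[OF e(1)] by (simp_all add: mult_left_mono)
    ultimately show ?thesis by (simp add: mult.commute)
  qed
  show ?thesis using that[OF pos[OF q1(1)] pos[OF q2(1)]] * by blast
qed

definition segment_curve :: "'a chart \<Rightarrow> real^2 \<Rightarrow> real^2 \<Rightarrow> real \<Rightarrow> 'a" where
  "segment_curve c x y r = inv_into (fst c) (snd c) (x + r *\<^sub>R (y - x))"

lemma segment_curve:
  assumes c: "c \<in> charts M" and sub: "closed_segment x y \<subseteq> coord_image c"
  shows "C1_curve_on M 0 1 (segment_curve c x y)"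
    and "r \<in> {0..1} \<Longrightarrow> speed M (segment_curve c x y) r = gnorm M c (x + r *\<^sub>R (y - x)) (y - x)"
proof -
  let ?\<sigma> = "segment_curve c x y"
  let ?l = "\<lambda>r. x + r *\<^sub>R (y - x)"
  have l: "?l r \<in> coord_image c" if "r \<in> {0..1}" for r
  proof -
    have "?l r \<in> closed_segment x y"
      unfolding closed_segment_def using that by (auto intro!: exI[of _ r] simp: algebra_simps)
    then show ?thesis using sub by blast
  qed
  have cont: "continuous_on {0..1} ?\<sigma>"
    unfolding segment_curve_def[abs_def]
    by (rule continuous_on_compose2[OF chart_continuous(2)[OF c]])
      (use l in \<open>auto intro!: continuous_intros\<close>)
  have inc: "snd c (?\<sigma> r) = ?l r" "?\<sigma> r \<in> fst c" if "r \<in> {0..1}" for r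
    using chart_inverse(2,3)[OF c l[OF that]] by (simp_all add: segment_curve_def)
  have der: "(snd c \<circ> ?\<sigma> has_vector_derivative y - x) (at r within {s..t})"
    if "r \<in> {s..t}" "0 \<le> s" "t \<le> 1" for r s t
  proof (rule has_vector_derivative_transform[OF that(1)])
    show "(snd c \<circ> ?\<sigma>) q = ?l q" if "q \<in> {s..t}" for q
      using inc(1)[of q] that \<open>0 \<le> s\<close> \<open>t \<le> 1\<close> by simp
    show "(?l has_vector_derivative y - x) (at r within {s..t})"
      by (auto intro!: derivative_eq_intros)
  qed
  show "C1_curve_on M 0 1 ?\<sigma>"
    unfolding C1_curve_on_def
  proof (intro conjI ballI allI impI cont)
    \<comment> \<open>A C1 curve must be differentiable in every chart; in another chart the
      velocity is the derivative of the transition map applied to \<open>y - x\<close>.\<close>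
    fix c' s t assume c': "c' \<in> charts M" and st: "0 \<le> s \<and> s < t \<and> t \<le> 1 \<and> ?\<sigma> ` {s..t} \<subseteq> fst c'"
    have r01: "r \<in> {0..1}" if "r \<in> {s..t}" for r using st that by auto
    have both: "?\<sigma> r \<in> fst c \<inter> fst c'" if "r \<in> {s..t}" for r using inc(2)[OF r01[OF that]] st that by blast
    let ?v = "\<lambda>r. frechet_derivative (transition c c') (at (?l r)) (y - x)"
    have "continuous_on {s..t} ?v"
    proof (rule continuous_on_compose2[OF transition_derivative_continuous[OF c c']])
      show "?l ` {s..t} \<subseteq> snd c ` (fst c \<inter> fst c')"
      proof
        fix z assume "z \<in> ?l ` {s..t}"
        then obtain r where r: "r \<in> {s..t}" "z = ?l r" by blast
        then have "z = snd c (?\<sigma> r)" using inc(1)[OF r01[OF r(1)]] by simp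
        then show "z \<in> snd c ` (fst c \<inter> fst c')" using both[OF r(1)] by blast
      qed
    qed (auto intro!: continuous_intros)
    moreover have "(snd c' \<circ> ?\<sigma> has_vector_derivative ?v r) (at r within {s..t})" if r: "r \<in> {s..t}" for r
    proof -
      have "continuous (at r within {s..t}) ?\<sigma>"
        using continuous_on_subset[OF cont, of "{s..t}"] st r by (auto simp: continuous_on_eq_continuous_within)
      from vector_derivative_change_chart[OF c c' both[OF r] r this der[OF r]]
      show ?thesis using inc(1)[OF r01[OF r]] st by simp
    qed
    ultimately show "\<exists>v. continuous_on {s..t} v \<and>
        (\<forall>r\<in>{s..t}. (snd c' \<circ> ?\<sigma> has_vector_derivative v r) (at r within {s..t}))" by blast
  qed
  show "speed M ?\<sigma> r = gnorm M c (?l r) (y - x)" if "r \<in> {0..1}"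
    using speed_eq[OF c that inc(2)[OF that] cont der[OF that]] inc(1)[OF that] by simp
qed

section \<open>The inner product of the tangent spaces\<close>

lemma tangent_inner_bilinear:
  "tangent_inner M X (u + u') v = tangent_inner M X u v + tangent_inner M X u' v"
  "tangent_inner M X u (v + v') = tangent_inner M X u v + tangent_inner M X u v'"
  "tangent_inner M X (a *\<^sub>R u) v = a * tangent_inner M X u v"
  "tangent_inner M X u (a *\<^sub>R v) = a * tangent_inner M X u v"
  by (simp_all add: tangent_inner_def inner_add_left inner_add_right matrix_vector_right_distrib
      matrix_vector_mult_scaleR)

lemma tangent_inner_sym: "tangent_inner M X u v = tangent_inner M X v u"
proof -
  let ?G = "gcoeff M (chart_at M X) (snd (chart_at M X) X)"
  have "transpose ?G = ?G" by (rule gcoeff_sym) (use chart_at chart_inverse(4) in blast)+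
  then have "?G *v u = u v* ?G" by (metis transpose_matrix_vector)
  then have "v \<bullet> (?G *v u) = (u v* ?G) \<bullet> v" by (simp add: inner_commute)
  then show ?thesis by (simp add: tangent_inner_def dot_lmul_matrix)
qed

lemma tangent_inner_pos: "u \<noteq> 0 \<Longrightarrow> 0 < tangent_inner M X u u"
  unfolding tangent_inner_def by (rule gcoeff_pos) (use chart_at chart_inverse(4) in blast)+

lemma tangent_norm_eq: "tangent_norm M X u = gnorm M (chart_at M X) (snd (chart_at M X) X) u"
  by (simp add: tangent_norm_def tangent_inner_def gnorm_def)

lemma tangent_norm_pos: "u \<noteq> 0 \<Longrightarrow> 0 < tangent_norm M X u"
  using tangent_inner_pos by (simp add: tangent_norm_def)

lemma tangent_norm_power2: "(tangent_norm M X u)\<^sup>2 = tangent_inner M X u u"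
  using tangent_inner_pos[of u X] by (cases "u = 0") (auto simp: tangent_norm_def tangent_inner_def)

lemma tangent_norm_scale: "tangent_norm M X (a *\<^sub>R u) = \<bar>a\<bar> * tangent_norm M X u"
  by (simp add: tangent_norm_eq gnorm_scale)

text \<open>With a = K |u| and |K u - v|^2 = a^2 + b this is sqrt (a^2 + b) <= a + b / (2 a). The
  last term of the bound tends to 0 as K grows.\<close>

lemma tangent_norm_diff_le:
  assumes "u \<noteq> 0" "0 < K"
  shows "tangent_norm M X (K *\<^sub>R u - v) - K * tangent_norm M X u \<le>
    - tangent_inner M X u v / tangent_norm M X u + (tangent_norm M X v)\<^sup>2 / (2 * K * tangent_norm M X u)"
proof -
  let ?n = "tangent_norm M X"
  define a where "a = K * ?n u"
  define b where "b = - 2 * K * tangent_inner M X u v + (?n v)\<^sup>2"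
  have a: "0 < a" using assms tangent_norm_pos by (simp add: a_def)
  have "(?n (K *\<^sub>R u - v))\<^sup>2 = tangent_inner M X (K *\<^sub>R u + (-1) *\<^sub>R v) (K *\<^sub>R u + (-1) *\<^sub>R v)"
    by (simp add: tangent_norm_power2)
  also have "\<dots> = a\<^sup>2 + b"
    unfolding tangent_inner_bilinear a_def b_def power_mult_distrib tangent_norm_power2
    by (simp add: tangent_inner_sym[of X v u] power2_eq_square algebra_simps)
  also have "\<dots> \<le> (a + b / (2 * a))\<^sup>2"
    using a by (simp add: power2_eq_square field_simps)
  finally have sq: "(?n (K *\<^sub>R u - v))\<^sup>2 \<le> (a + b / (2 * a))\<^sup>2" .
  have "0 \<le> a\<^sup>2 + b"
    using \<open>(?n (K *\<^sub>R u - v))\<^sup>2 = _\<close> \<open>_ = a\<^sup>2 + b\<close> by (metis zero_le_power2)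
  then have "0 \<le> 2 * a\<^sup>2 + b" using zero_le_power2[of a] by linarith
  then have "0 \<le> a + b / (2 * a)"
    using a by (simp add: power2_eq_square field_simps)
  then have "?n (K *\<^sub>R u - v) \<le> a + b / (2 * a)" using sq power2_le_imp_le by blast
  moreover have "b / (2 * a) = - tangent_inner M X u v / ?n u + (?n v)\<^sup>2 / (2 * K * ?n u)"
    using assms tangent_norm_pos[OF assms(1), of X] unfolding a_def b_def by (simp add: field_simps)
  ultimately show ?thesis unfolding a_def by linarith
qed

end

section \<open>The distance to first order\<close>

context geodesic_disk_surface
begin

lemma open_U: "open U" using disk by (simp add: geodesic_disk_def)

lemma gd_le_segment:
  assumes c: "c \<in> charts M" and sub: "closed_segment x y \<subseteq> snd c ` (fst c \<inter> U)"
    and B: "\<And>p. p \<in> closed_segment x y \<Longrightarrow> gnorm M c p (y - x) \<le> B"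
  shows "gd (inv_into (fst c) (snd c) x) (inv_into (fst c) (snd c) y) \<le> B"
proof -
  let ?i = "inv_into (fst c) (snd c)"
  have sub': "closed_segment x y \<subseteq> coord_image c" using sub unfolding coord_image_def by blast
  have U: "?i z \<in> U" if "z \<in> closed_segment x y" for z
  proof -
    obtain p where "p \<in> fst c" "p \<in> U" "z = snd c p" using sub \<open>z \<in> closed_segment x y\<close> by blast
    then show ?thesis using chart_inverse(1)[OF c] by simp
  qed
  note sc = segment_curve[OF c sub']
  have "gd (?i x) (?i y) \<le> curve_length M (segment_curve c x y)"
    by (rule gd_le_C1[OF U U sc(1)]) (auto simp: segment_curve_def)
  also have "\<dots> \<le> integral {0..1::real} (\<lambda>r. B)"
    unfolding curve_length_eq
  proof (rule integral_le)
    show "speed M (segment_curve c x y) integrable_on {0..1}" by (rule speed_integrable[OF sc(1)])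
    fix r :: real assume r: "r \<in> {0..1}"
    then have "x + r *\<^sub>R (y - x) \<in> closed_segment x y"
      unfolding closed_segment_def by (auto intro!: exI[of _ r] simp: algebra_simps)
    then show "speed M (segment_curve c x y) r \<le> B" using B sc(2)[OF r] by simp
  qed auto
  also have "\<dots> = B" by simp
  finally show ?thesis .
qed

lemma gd_locally_lipschitz:
  assumes P: "P \<in> U" and c: "c \<in> charts M" "P \<in> fst c"
  obtains \<rho> L where "0 < \<rho>" "0 < L" "cball (snd c P) \<rho> \<subseteq> snd c ` (fst c \<inter> U)"
    "\<And>x y. x \<in> cball (snd c P) \<rho> \<Longrightarrow> y \<in> cball (snd c P) \<rho> \<Longrightarrow>
      gd (inv_into (fst c) (snd c) x) (inv_into (fst c) (snd c) y) \<le> L * norm (y - x)"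
proof -
  obtain \<rho> where \<rho>: "0 < \<rho>" "cball (snd c P) \<rho> \<subseteq> snd c ` (fst c \<inter> U)" "cball (snd c P) \<rho> \<subseteq> coord_image c"
    by (rule chart_ball[OF c(1) open_U P c(2)])
  obtain a b where ab: "0 < b" "\<And>p w. p \<in> cball (snd c P) \<rho> \<Longrightarrow> gnorm M c p w \<le> b * norm w"
    by (rule gnorm_comparable[OF c(1) compact_cball \<rho>(3)]) blast
  show ?thesis
  proof (rule that[OF \<rho>(1) ab(1) \<rho>(2)])
    fix x y assume "x \<in> cball (snd c P) \<rho>" "y \<in> cball (snd c P) \<rho>"
    then have seg: "closed_segment x y \<subseteq> cball (snd c P) \<rho>" by (simp add: closed_segment_subset)
    then show "gd (inv_into (fst c) (snd c) x) (inv_into (fst c) (snd c) y) \<le> b * norm (y - x)"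
      using ab(2) \<rho>(2) by (intro gd_le_segment[OF c(1)]) blast+
  qed
qed

lemma gd_abs_diff_le:
  assumes "P \<in> U" "X \<in> U" "Y \<in> U"
  shows "\<bar>gd P X - gd P Y\<bar> \<le> gd X Y"
  using gd_triangle[of P X Y] gd_triangle[of P Y X] gd_sym[of X Y] assms by auto

lemma gd_continuous:
  assumes P: "P \<in> U"
  shows "continuous_on U (gd P)"
  unfolding continuous_on_def
proof
  fix Q assume Q: "Q \<in> U"
  let ?c = "chart_at M Q"
  note c = chart_at[of Q]
  let ?q = "snd ?c Q"
  obtain \<rho> L where \<rho>: "0 < \<rho>" "0 < L" "cball ?q \<rho> \<subseteq> snd ?c ` (fst ?c \<inter> U)"
    "\<And>x y. x \<in> cball ?q \<rho> \<Longrightarrow> y \<in> cball ?q \<rho> \<Longrightarrow>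
      gd (inv_into (fst ?c) (snd ?c) x) (inv_into (fst ?c) (snd ?c) y) \<le> L * norm (y - x)"
    using gd_locally_lipschitz[OF Q c] by blast
  have inc: "\<forall>\<^sub>F Y in at Q within U. Y \<in> fst ?c"
    using chart_open[OF c(1)] c(2) by (intro eventually_at_topological[THEN iffD2]) blast
  have tends: "(snd ?c \<longlongrightarrow> ?q) (at Q within U)"
    using chart_continuous(1)[OF c(1)] chart_open[OF c(1)] c(2)
    by (metis continuous_on_eq_continuous_at continuous_at_imp_continuous_at_within continuous_within)
  then have ball: "\<forall>\<^sub>F Y in at Q within U. snd ?c Y \<in> ball ?q \<rho>"
    using \<rho>(1) by (intro topological_tendstoD) auto
  have inU: "\<forall>\<^sub>F Y in at Q within U. Y \<in> U" by (simp add: eventually_at_filter)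
  have bound: "\<forall>\<^sub>F Y in at Q within U. norm (gd P Y - gd P Q) \<le> L * norm (snd ?c Y - ?q)"
    using inc ball inU
  proof eventually_elim
    case (elim Y)
    have "gd Q Y \<le> L * norm (snd ?c Y - ?q)"
      using \<rho>(4)[of ?q "snd ?c Y"] elim \<rho>(1) chart_inverse(1)[OF c(1)] c(2) by simp
    then show ?case using gd_abs_diff_le[OF P elim(3) Q] gd_sym[OF Q elim(3)] by simp
  qed
  have "((\<lambda>Y. L * norm (snd ?c Y - ?q)) \<longlongrightarrow> L * norm (?q - ?q)) (at Q within U)"
    by (intro tendsto_intros tends)
  then have "((\<lambda>Y. gd P Y - gd P Q) \<longlongrightarrow> 0) (at Q within U)"
    using Lim_null_comparison[OF bound] by simp
  then show "(gd P \<longlongrightarrow> gd P Q) (at Q within U)" using Lim_null by blast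
qed

text \<open>The metric is nearly constant near \<open>x\<close>, so straight coordinate segments give an upper
  bound for short distances that is sharp to first order.\<close>

lemma gd_first_order_bound:
  assumes X: "X \<in> U" and c: "c \<in> charts M" "X \<in> fst c"
    and y: "((\<lambda>t. (1 / t) *\<^sub>R (y t - snd c X)) \<longlongrightarrow> a) (at_right 0)"
    and z: "((\<lambda>t. (1 / t) *\<^sub>R (z t - snd c X)) \<longlongrightarrow> b) (at_right 0)" and e: "0 < e"
  shows "\<forall>\<^sub>F t in at_right 0. gd (inv_into (fst c) (snd c) (y t)) (inv_into (fst c) (snd c) (z t)) \<le>
    t * (gnorm M c (snd c X) (b - a) + e)"
proof -
  let ?x = "snd c X"
  obtain \<rho> where \<rho>: "0 < \<rho>" "cball ?x \<rho> \<subseteq> snd c ` (fst c \<inter> U)" "cball ?x \<rho> \<subseteq> coord_image c"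
    by (rule chart_ball[OF c(1) open_U X c(2)])
  let ?g = "\<lambda>q. gnorm M c (fst q) (snd q)"
  let ?T = "ball ?x \<rho> \<times> (UNIV :: (real^2) set)"
  have "continuous_on ?T ?g"
    by (rule gnorm_continuous[OF c(1)]) (use \<rho>(3) in \<open>auto intro!: continuous_intros\<close>)
  moreover have "open ?T" by (simp add: open_Times)
  moreover have "(?x, b - a) \<in> ?T" using \<rho>(1) by simp
  ultimately have "isCont ?g (?x, b - a)" using continuous_on_eq_continuous_at by blast
  \<comment> \<open>Continuity is used jointly in the point and the vector: the base point varies
    along the chord, and the chord divided by \<open>t\<close> only tends to
    \<open>b - a\<close>.\<close>
  then obtain \<delta> where \<delta>: "0 < \<delta>" "\<And>q. dist q (?x, b - a) < \<delta> \<Longrightarrow> dist (?g q) (?g (?x, b - a)) < e"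
    using e unfolding continuous_at_eps_delta by blast
  have lim: "((\<lambda>t. f t) \<longlongrightarrow> ?x) (at_right 0)" if "((\<lambda>t. (1 / t) *\<^sub>R (f t - ?x)) \<longlongrightarrow> w) (at_right 0)"
    for f :: "real \<Rightarrow> real^2" and w
  proof -
    have "((\<lambda>t. t *\<^sub>R ((1 / t) *\<^sub>R (f t - ?x)) + ?x) \<longlongrightarrow> 0 *\<^sub>R w + ?x) (at_right 0)"
      by (intro tendsto_intros that)
    moreover have "\<forall>\<^sub>F t in at_right (0::real). t *\<^sub>R ((1 / t) *\<^sub>R (f t - ?x)) + ?x = f t"
      using eventually_at_right_less[of 0] by eventually_elim simp
    ultimately show ?thesis by (simp add: tendsto_cong)
  qed
  define r where "r = min \<rho> (\<delta> / 2)"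
  have r: "0 < r" "r \<le> \<rho>" "r \<le> \<delta> / 2" using \<rho>(1) \<delta>(1) by (auto simp: r_def)
  have ey: "\<forall>\<^sub>F t in at_right 0. y t \<in> ball ?x r" using lim[OF y] r(1) by (intro topological_tendstoD) auto
  have ez: "\<forall>\<^sub>F t in at_right 0. z t \<in> ball ?x r" using lim[OF z] r(1) by (intro topological_tendstoD) auto
  have "((\<lambda>t. (1 / t) *\<^sub>R (z t - ?x) - (1 / t) *\<^sub>R (y t - ?x)) \<longlongrightarrow> b - a) (at_right 0)"
    by (intro tendsto_intros y z)
  then have ed: "\<forall>\<^sub>F t in at_right 0. (1 / t) *\<^sub>R (z t - ?x) - (1 / t) *\<^sub>R (y t - ?x) \<in> ball (b - a) (\<delta> / 2)"
    using \<delta>(1) by (intro topological_tendstoD) auto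
  show ?thesis
    using ey ez ed eventually_at_right_less[of 0]
  proof eventually_elim
    case (elim t)
    define w where "w = (1 / t) *\<^sub>R (z t - y t)"
    have w: "z t - y t = t *\<^sub>R w" using elim(4) by (simp add: w_def)
    have wd: "dist w (b - a) < \<delta> / 2"
      using elim(3) by (simp add: w_def dist_commute scaleR_diff_right[symmetric])
    have seg: "closed_segment (y t) (z t) \<subseteq> ball ?x r"
      using elim(1,2) by (simp add: closed_segment_subset)
    show ?case
    proof (rule gd_le_segment[OF c(1)])
      have "ball ?x r \<subseteq> cball ?x \<rho>" using r(2) by auto
      then show "closed_segment (y t) (z t) \<subseteq> snd c ` (fst c \<inter> U)" using seg \<rho>(2) by blast
      fix p assume "p \<in> closed_segment (y t) (z t)"
      then have p: "dist p ?x < r" using seg by (auto simp: dist_commute)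
      have "dist (p, w) (?x, b - a) \<le> dist p ?x + dist w (b - a)"
        by (simp add: dist_Pair_Pair sqrt_sum_squares_le_sum)
      also have "\<dots> < \<delta>" using p wd r(3) by linarith
      finally have "dist (gnorm M c p w) (gnorm M c ?x (b - a)) < e" using \<delta>(2)[of "(p, w)"] by simp
      then have "gnorm M c p w \<le> gnorm M c ?x (b - a) + e" by (simp add: dist_real_def)
      then show "gnorm M c p (z t - y t) \<le> t * (gnorm M c ?x (b - a) + e)"
        unfolding w gnorm_scale using elim(4) by (simp add: mult_left_mono)
    qed
  qed
qed

text \<open>For a first variation any curve from \<open>X\<close> with initial velocity
  \<open>v\<close> will do; a straight coordinate line is the simplest. It is meaningful for small
  \<open>t\<close> only, hence the statements along \<open>at_right 0\<close>.\<close>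

definition shift :: "'a \<Rightarrow> real^2 \<Rightarrow> real \<Rightarrow> 'a" where
  "shift X v t = inv_into (fst (chart_at M X)) (snd (chart_at M X)) (snd (chart_at M X) X + t *\<^sub>R v)"

lemma shift_in_U:
  assumes X: "X \<in> U"
  shows "\<forall>\<^sub>F t in at_right 0. shift X v t \<in> U"
proof -
  let ?c = "chart_at M X"
  note c = chart_at[of X]
  obtain \<rho> where \<rho>: "0 < \<rho>" "cball (snd ?c X) \<rho> \<subseteq> snd ?c ` (fst ?c \<inter> U)"
    by (rule chart_ball[OF c(1) open_U X c(2)])
  have "((\<lambda>t. snd ?c X + t *\<^sub>R v) \<longlongrightarrow> snd ?c X + 0 *\<^sub>R v) (at_right 0)" by (intro tendsto_intros)
  then have "\<forall>\<^sub>F t in at_right 0. snd ?c X + t *\<^sub>R v \<in> ball (snd ?c X) \<rho>"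
    using \<rho>(1) by (intro topological_tendstoD) auto
  then show ?thesis
  proof eventually_elim
    case (elim t)
    then have "snd ?c X + t *\<^sub>R v \<in> cball (snd ?c X) \<rho>" by auto
    then obtain p where p: "p \<in> fst ?c" "p \<in> U" "snd ?c X + t *\<^sub>R v = snd ?c p" using \<rho>(2) by blast
    then show ?case unfolding shift_def p(3) using chart_inverse(1)[OF c(1) p(1)] by simp
  qed
qed

lemma shift_quotient:
  fixes x v :: "real^2"
  shows "((\<lambda>t. (1 / t) *\<^sub>R ((x + t *\<^sub>R v) - x)) \<longlongrightarrow> v) (at_right (0::real))"
proof -
  have "\<forall>\<^sub>F t in at_right (0::real). (1 / t) *\<^sub>R ((x + t *\<^sub>R v) - x) = v"
    using eventually_at_right_less[of 0] by eventually_elim simp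
  then show ?thesis by (simp add: tendsto_eventually)
qed

lemma gd_shift_self:
  assumes X: "X \<in> U" and e: "0 < e"
  shows "\<forall>\<^sub>F t in at_right 0. gd (shift X v t) X \<le> t * (tangent_norm M X v + e)"
proof -
  let ?c = "chart_at M X"
  note c = chart_at[of X]
  have "((\<lambda>t. (1 / t) *\<^sub>R (snd ?c X - snd ?c X)) \<longlongrightarrow> 0) (at_right (0::real))" by simp
  from gd_first_order_bound[OF X c shift_quotient[of "snd ?c X" v] this e]
  show ?thesis
    using gnorm_scale[of ?c "snd ?c X" "-1" v] chart_inverse(1)[OF c]
    by (simp add: shift_def tangent_norm_eq)
qed

text \<open>A geodesic \<open>\<gamma>\<close> from \<open>X\<close> to \<open>P\<close> is compared with the shortcut from \<open>shift X v t\<close> to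
  \<open>\<gamma> (K * t)\<close>; for large \<open>K\<close> this becomes the first variation formula.\<close>

lemma gd_corner_cut:
  assumes X: "X \<in> U" and P: "P \<in> U" and ne: "P \<noteq> X" and K: "0 < K" and e: "0 < e"
  defines "u \<equiv> velocity M (geo X P) 0"
  shows "\<forall>\<^sub>F t in at_right 0. gd (shift X v t) P - gd X P \<le>
    t * (tangent_norm M X (K *\<^sub>R u - v) - K * tangent_norm M X u + (1 + K) * e)"
proof -
  let ?c = "chart_at M X" and ?\<gamma> = "geo X P"
  let ?x = "snd ?c X"
  note c = chart_at[of X] and g = geo[OF X P]
  obtain w where w: "(snd ?c \<circ> ?\<gamma> has_vector_derivative w) (at 0 within {0..1})"
    using C1_curve_on_derivative[OF g(5) c(1), of 0] c(2) g(2) by auto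
  have wu: "w = u" unfolding u_def using velocity_eq[of 0 ?\<gamma> w] w g(2) by simp
  \<comment> \<open>\<open>K * t\<close> is the parameter of the far end of the shortcut. It tends
    to 0 within the unit interval without being 0, so the difference quotient of the geodesic may be
    taken along it.\<close>
  have Kt: "filterlim (\<lambda>t. K * t) (at 0 within {0..1}) (at_right 0)"
  proof -
    have "((\<lambda>t. K * t) \<longlongrightarrow> K * 0) (at_right 0)" by (intro tendsto_intros)
    moreover have "\<forall>\<^sub>F t in at_right 0. K * t \<in> {0..1} \<and> K * t \<noteq> 0"
      unfolding eventually_at_right_field
      by (intro exI[of _ "1 / K"]) (use K in \<open>auto simp: field_simps\<close>)
    ultimately show ?thesis by (simp add: filterlim_at)
  qed
  have "((\<lambda>s. (1 / (s - 0)) *\<^sub>R ((snd ?c \<circ> ?\<gamma>) s - (snd ?c \<circ> ?\<gamma>) 0)) \<longlongrightarrow> u) (at 0 within {0..1})"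
  proof -
    have "((\<lambda>s. (1 / norm (s - 0)) *\<^sub>R ((snd ?c \<circ> ?\<gamma>) s - ((snd ?c \<circ> ?\<gamma>) 0 + (s - 0) *\<^sub>R u))) \<longlongrightarrow> 0) (at 0 within {0..1})"
      using w unfolding wu has_vector_derivative_def has_derivative_within by blast
    moreover have "\<forall>\<^sub>F s in at (0::real) within {0..1}.
        (1 / norm (s - 0)) *\<^sub>R ((snd ?c \<circ> ?\<gamma>) s - ((snd ?c \<circ> ?\<gamma>) 0 + (s - 0) *\<^sub>R u)) =
        (1 / (s - 0)) *\<^sub>R ((snd ?c \<circ> ?\<gamma>) s - (snd ?c \<circ> ?\<gamma>) 0) - u"
      unfolding eventually_at_filter
      by (intro always_eventually allI impI) (simp add: algebra_simps)
    ultimately have "((\<lambda>s. (1 / (s - 0)) *\<^sub>R ((snd ?c \<circ> ?\<gamma>) s - (snd ?c \<circ> ?\<gamma>) 0) - u) \<longlongrightarrow> 0) (at 0 within {0..1})"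
      by (simp only: tendsto_cong)
    then show ?thesis by (rule LIM_zero_cancel)
  qed
  from filterlim_compose[OF this Kt]
  have "((\<lambda>t. K *\<^sub>R (1 / (K * t)) *\<^sub>R (snd ?c (?\<gamma> (K * t)) - ?x)) \<longlongrightarrow> K *\<^sub>R u) (at_right 0)"
    using g(2) by (intro tendsto_intros) simp
  then have "((\<lambda>t. (1 / t) *\<^sub>R (snd ?c (?\<gamma> (K * t)) - ?x)) \<longlongrightarrow> K *\<^sub>R u) (at_right 0)"
    using K by simp
  from gd_first_order_bound[OF X c shift_quotient[of ?x v] this e]
  have E1: "\<forall>\<^sub>F t in at_right 0. gd (shift X v t) (inv_into (fst ?c) (snd ?c) (snd ?c (?\<gamma> (K * t))))
      \<le> t * (tangent_norm M X (K *\<^sub>R u - v) + e)"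
    by (simp add: shift_def tangent_norm_eq)
  have "continuous (at 0 within {0..1}) (speed M ?\<gamma>)"
    using speed_continuous[OF g(5)] by (auto simp: continuous_on_eq_continuous_within)
  then obtain d where d: "0 < d" "\<And>s. s \<in> {0..1} \<Longrightarrow> dist s 0 < d \<Longrightarrow> dist (speed M ?\<gamma> s) (speed M ?\<gamma> 0) < e"
    using e unfolding continuous_within_eps_delta by blast
  have sp0: "speed M ?\<gamma> 0 = tangent_norm M X u" unfolding speed_def g(2) u_def ..
  have contg: "continuous_on {0..1} ?\<gamma>" using g(5) by (simp add: C1_curve_on_def)
  obtain \<delta> a b where I: "0 < \<delta>" "?\<gamma> ` {a..b} \<subseteq> fst ?c"
    "\<And>r. r \<in> {0..1} \<Longrightarrow> \<bar>r - 0\<bar> < \<delta> \<Longrightarrow> r \<in> {a..b} \<and> at r within {a..b} = at r within {0..1}"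
  proof (rule local_interval[OF contg, of 0 "fst ?c"])
    show "open (fst ?c)" using chart_open[OF c(1)] by blast
    show "?\<gamma> 0 \<in> fst ?c" using g(2) c(2) by simp
  qed auto
  have E2: "\<forall>\<^sub>F t in at_right 0. K * t < min 1 (min d \<delta>)"
    unfolding eventually_at_right_field
    by (intro exI[of _ "min 1 (min d \<delta>) / K"]) (use K d(1) I(1) in \<open>auto simp: field_simps\<close>)
  show ?thesis
    using E1 E2 eventually_at_right_less[of 0] shift_in_U[OF X, of v]
  proof eventually_elim
    case (elim t)
    let ?s = "K * t"
    have s: "?s \<in> {0..1}" "?s < d" "?s < \<delta>" "0 < ?s" using elim(2,3) K by auto
    have "?\<gamma> ?s \<in> fst ?c" using I(2) I(3)[OF s(1)] s(3,4) by auto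
    then have inv: "inv_into (fst ?c) (snd ?c) (snd ?c (?\<gamma> ?s)) = ?\<gamma> ?s" by (rule chart_inverse(1)[OF c(1)])
    \<comment> \<open>By continuity of the speed, the piece cut off is at least \<open>?s\<close>
      times the initial speed less \<open>e\<close>.\<close>
    have "integral {0..?s} (\<lambda>r. tangent_norm M X u - e) \<le> integral {0..?s} (speed M ?\<gamma>)"
    proof (rule integral_le)
      show "speed M ?\<gamma> integrable_on {0..?s}" using speed_integrable'[OF g(5), of 0 ?s] s(1) by simp
      fix r assume "r \<in> {0..?s}"
      then have "r \<in> {0..1}" "dist r 0 < d" using s by auto
      from d(2)[OF this] show "tangent_norm M X u - e \<le> speed M ?\<gamma> r"
        unfolding sp0 dist_real_def by linarith
    qed auto
    then have low: "?s * (tangent_norm M X u - e) \<le> gd X (?\<gamma> ?s)"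
      using gd_geo[OF X P, of 0 ?s] s g(2) by simp
    have "gd (shift X v t) P \<le> gd (shift X v t) (?\<gamma> ?s) + gd (?\<gamma> ?s) P"
      by (rule gd_triangle[OF elim(4) P g(4)[OF s(1)]])
    moreover have "gd X (?\<gamma> ?s) + gd (?\<gamma> ?s) P = gd X P" by (rule gd_between[OF X P s(1)])
    moreover have "gd (shift X v t) (?\<gamma> ?s) \<le> t * (tangent_norm M X (K *\<^sub>R u - v) + e)"
      using elim(1) unfolding inv .
    \<comment> \<open>The shortcut contributes an error \<open>t * e\<close>, the piece cut off an
      error \<open>K * t * e\<close>.\<close>
    ultimately have "gd (shift X v t) P - gd X P \<le>
        t * (tangent_norm M X (K *\<^sub>R u - v) + e) - ?s * (tangent_norm M X u - e)"
      using low by linarith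
    then show ?case by (simp add: algebra_simps)
  qed
qed

lemma gd_first_variation:
  assumes X: "X \<in> U" and P: "P \<in> U" and ne: "P \<noteq> X" and e: "0 < e"
  defines "u \<equiv> velocity M (geo X P) 0"
  shows "\<forall>\<^sub>F t in at_right 0. gd (shift X v t) P - gd X P \<le>
    t * (- tangent_inner M X u v / tangent_norm M X u + e)"
proof -
  have u: "u \<noteq> 0" unfolding u_def using velocity_geo_nonzero[OF X P] ne by metis
  let ?n = "tangent_norm M X"
  \<comment> \<open>Large enough for the remainder in \<open>tangent_norm_diff_le\<close> to be at
    most \<open>e / 2\<close>; the added 1 keeps \<open>K\<close> positive for
    \<open>v = 0\<close>.\<close>
  define K where "K = (?n v)\<^sup>2 / (e * ?n u) + 1"
  have K: "0 < K" unfolding K_def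
    using e tangent_norm_pos[OF u, of X] by (intro add_nonneg_pos divide_nonneg_pos mult_pos_pos) auto
  have "(?n v)\<^sup>2 / (2 * K * ?n u) \<le> e / 2"
  proof -
    have "(?n v)\<^sup>2 \<le> e * ?n u * K"
      using e tangent_norm_pos[OF u, of X] by (simp add: K_def field_simps)
    then show ?thesis using K tangent_norm_pos[OF u, of X] by (simp add: field_simps)
  qed
  then have b: "?n (K *\<^sub>R u - v) - K * ?n u \<le> - tangent_inner M X u v / ?n u + e / 2"
    using tangent_norm_diff_le[OF u K, of X v] by linarith
  have e': "0 < e / (2 * (1 + K))" using e K by simp
  show ?thesis
    using gd_corner_cut[OF X P ne K e', of v, folded u_def] eventually_at_right_less[of 0]
  proof eventually_elim
    case (elim t)
    have "(1 + K) * (e / (2 * (1 + K))) = e / 2" using K by (simp add: field_simps)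
    then have "?n (K *\<^sub>R u - v) - K * ?n u + (1 + K) * (e / (2 * (1 + K))) \<le> - tangent_inner M X u v / ?n u + e"
      using b by linarith
    then have "t * (?n (K *\<^sub>R u - v) - K * ?n u + (1 + K) * (e / (2 * (1 + K)))) \<le> t * (- tangent_inner M X u v / ?n u + e)"
      using elim(2) by (intro mult_left_mono) auto
    then show ?case using elim(1) by linarith
  qed
qed

text \<open>In the first variation this vector acts as minus the gradient of the distance to
  \<open>P\<close>.\<close>

definition dir :: "'a \<Rightarrow> 'a \<Rightarrow> real^2" where
  "dir X P = (1 / tangent_norm M X (velocity M (geo X P) 0)) *\<^sub>R velocity M (geo X P) 0"

lemma dir_unit:
  assumes "X \<in> U" "P \<in> U" "P \<noteq> X"
  shows "tangent_inner M X (dir X P) (dir X P) = 1"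
proof -
  have u: "velocity M (geo X P) 0 \<noteq> 0" using velocity_geo_nonzero[OF assms(1,2)] assms(3) by metis
  show ?thesis
    using tangent_norm_pos[OF u, of X] unfolding dir_def tangent_inner_bilinear
    by (simp add: tangent_norm_power2[symmetric] power2_eq_square)
qed

lemma angle_eq: "angle M U P X Q = arccos (tangent_inner M X (dir X P) (dir X Q))"
  unfolding angle_def Let_def dir_def tangent_inner_bilinear by (simp add: mult.commute)

text \<open>The increase of the sum along \<open>shift X v t\<close> is nonnegative; dividing its
  upper bound by \<open>t\<close> leaves this inequality up to an arbitrary error. The coefficient
  \<open>k\<close> unites two uses: 0 when \<open>X\<close> is no vertex, 1 when \<open>X\<close> is
  a vertex, whose own distance grows at most like the length of \<open>v\<close>.\<close>

lemma first_order_condition: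
  assumes X: "X \<in> U" and I: "finite I" "\<And>i. i \<in> I \<Longrightarrow> P i \<in> U \<and> P i \<noteq> X" and k: "0 \<le> k"
    and min: "\<And>Y. Y \<in> U \<Longrightarrow> (\<Sum>i\<in>I. gd X (P i)) \<le> k * gd Y X + (\<Sum>i\<in>I. gd Y (P i))"
  shows "tangent_inner M X (\<Sum>i\<in>I. dir X (P i)) v \<le> k * tangent_norm M X v"
proof (rule field_le_epsilon)
  fix e :: real assume e: "0 < e"
  \<comment> \<open>The error \<open>d\<close> occurs \<open>k + card I\<close> times; the 1 keeps
    the denominator positive.\<close>
  define d where "d = e / (k + real (card I) + 1)"
  have d: "0 < d" "(k + real (card I)) * d \<le> e" using e k by (auto simp: d_def field_simps)
  have 1: "\<forall>\<^sub>F t in at_right 0. \<forall>i\<in>I. gd (shift X v t) (P i) - gd X (P i) \<le>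
      t * (- tangent_inner M X (dir X (P i)) v + d)"
  proof (rule eventually_ball_finite[OF I(1)], rule ballI)
    fix i assume i: "i \<in> I"
    show "\<forall>\<^sub>F t in at_right 0. gd (shift X v t) (P i) - gd X (P i) \<le>
        t * (- tangent_inner M X (dir X (P i)) v + d)"
      using gd_first_variation[OF X _ _ d(1), of "P i" v] I(2)[OF i]
      unfolding dir_def tangent_inner_bilinear by simp
  qed
  have "\<forall>\<^sub>F t in at_right (0::real). tangent_inner M X (\<Sum>i\<in>I. dir X (P i)) v \<le> k * tangent_norm M X v + e"
    using 1 gd_shift_self[OF X d(1), of v] shift_in_U[OF X, of v] eventually_at_right_less[of 0]
  proof eventually_elim
    case (elim t)
    have "0 \<le> k * gd (shift X v t) X + (\<Sum>i\<in>I. gd (shift X v t) (P i) - gd X (P i))"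
      using min[OF elim(3)] by (simp add: sum_subtractf)
    also have "\<dots> \<le> k * (t * (tangent_norm M X v + d)) + (\<Sum>i\<in>I. t * (- tangent_inner M X (dir X (P i)) v + d))"
      using elim(1,2) k by (intro add_mono mult_left_mono sum_mono) auto
    also have "(\<Sum>i\<in>I. t * (- tangent_inner M X (dir X (P i)) v + d)) =
        t * (real (card I) * d - (\<Sum>i\<in>I. tangent_inner M X (dir X (P i)) v))"
      unfolding sum_distrib_left[symmetric] by (simp add: sum.distrib sum_negf sum_subtractf)
    also have "k * (t * (tangent_norm M X v + d)) + \<dots> = t * (k * tangent_norm M X v - (\<Sum>i\<in>I. tangent_inner M X (dir X (P i)) v) + (k + real (card I)) * d)"
      by (simp add: algebra_simps)
    finally have "0 \<le> k * tangent_norm M X v - (\<Sum>i\<in>I. tangent_inner M X (dir X (P i)) v) + (k + real (card I)) * d"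
      using elim(4) by (simp add: zero_le_mult_iff)
    moreover have "(\<Sum>i\<in>I. tangent_inner M X (dir X (P i)) v) = tangent_inner M X (\<Sum>i\<in>I. dir X (P i)) v"
      by (simp add: tangent_inner_def inner_sum_left)
    ultimately show ?case using d(2) by linarith
  qed
  then show "tangent_inner M X (\<Sum>i\<in>I. dir X (P i)) v \<le> k * tangent_norm M X v + e"
    by (simp add: trivial_limit_at_right_real eventually_const)
qed

section \<open>Extension of geodesics\<close>

lemma chart_velocity:
  assumes C1: "C1_curve_on M 0 1 \<gamma>" and c: "c \<in> charts M" and s: "0 \<le> s" "s \<le> 1"
    and im: "\<gamma> ` {0..s} \<subseteq> fst c"
  obtains v where "\<And>r. r \<in> {0..s} \<Longrightarrow> (snd c \<circ> \<gamma> has_vector_derivative v r) (at r within {0..1})"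
    "\<And>r. r \<in> {0..s} \<Longrightarrow> speed M \<gamma> r = gnorm M c (snd c (\<gamma> r)) (v r)"
    "(v has_integral snd c (\<gamma> s) - snd c (\<gamma> 0)) {0..s}"
proof -
  have "\<exists>w. (snd c \<circ> \<gamma> has_vector_derivative w) (at r within {0..1})" if r: "r \<in> {0..s}" for r
  proof -
    have "r \<in> {0..1}" "\<gamma> r \<in> fst c" using r s im by auto
    then show ?thesis using C1_curve_on_derivative[OF C1 c] by metis
  qed
  then obtain v where v: "\<And>r. r \<in> {0..s} \<Longrightarrow> (snd c \<circ> \<gamma> has_vector_derivative v r) (at r within {0..1})"
    by metis
  have cont: "continuous_on {0..1} \<gamma>" using C1 by (simp add: C1_curve_on_def)
  have "speed M \<gamma> r = gnorm M c (snd c (\<gamma> r)) (v r)" if r: "r \<in> {0..s}" for r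
    by (rule speed_eq[OF c _ _ cont v[OF r]]) (use r s im in auto)
  note sp = this
  have "(v has_integral (snd c \<circ> \<gamma>) s - (snd c \<circ> \<gamma>) 0) {0..s}"
  proof (rule fundamental_theorem_of_calculus[OF s(1)])
    fix r assume "r \<in> {0..s}"
    from v[OF this] show "(snd c \<circ> \<gamma> has_vector_derivative v r) (at r within {0..s})"
      by (rule has_vector_derivative_within_subset) (use s in auto)
  qed
  then have "(v has_integral snd c (\<gamma> s) - snd c (\<gamma> 0)) {0..s}" by simp
  from that[OF v sp this] show ?thesis by blast
qed

text \<open>The coordinate displacement is the integral of the coordinate velocity, whose norm is at
  most the speed divided by \<open>a\<close>.\<close>

lemma chart_length_lower:
  assumes C1: "C1_curve_on M 0 1 \<gamma>" and c: "c \<in> charts M" and s: "0 \<le> s" "s \<le> 1"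
    and im: "\<gamma> ` {0..s} \<subseteq> {p \<in> fst c. snd c p \<in> S}"
    and a: "0 < a" "\<And>p w. p \<in> S \<Longrightarrow> a * norm w \<le> gnorm M c p w"
  shows "a * norm (snd c (\<gamma> s) - snd c (\<gamma> 0)) \<le> integral {0..s} (speed M \<gamma>)"
proof -
  have im': "\<gamma> ` {0..s} \<subseteq> fst c" using im by auto
  obtain v where v: "\<And>r. r \<in> {0..s} \<Longrightarrow> speed M \<gamma> r = gnorm M c (snd c (\<gamma> r)) (v r)"
    "(v has_integral snd c (\<gamma> s) - snd c (\<gamma> 0)) {0..s}"
    using chart_velocity[OF C1 c s im'] by metis
  have int: "speed M \<gamma> integrable_on {0..s}" using speed_integrable'[OF C1] s by simp
  have "norm (snd c (\<gamma> s) - snd c (\<gamma> 0)) \<le> integral {0..s} (\<lambda>r. (1 / a) * speed M \<gamma> r)"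
    unfolding integral_unique[OF v(2), symmetric]
  proof (rule integral_norm_bound_integral)
    show "v integrable_on {0..s}" using v(2) by blast
    show "(\<lambda>r. (1 / a) * speed M \<gamma> r) integrable_on {0..s}" using int by (rule integrable_on_mult_right)
    fix r assume r: "r \<in> {0..s}"
    then have "\<gamma> r \<in> {p \<in> fst c. snd c p \<in> S}" using im by blast
    then have "snd c (\<gamma> r) \<in> S" by simp
    then have "a * norm (v r) \<le> speed M \<gamma> r" using a(2) v(1)[OF r] by simp
    then show "norm (v r) \<le> (1 / a) * speed M \<gamma> r" using a(1) by (simp add: field_simps)
  qed
  also have "\<dots> = (1 / a) * integral {0..s} (speed M \<gamma>)" by simp
  finally show ?thesis using a(1) by (simp add: field_simps)
qed

text \<open>At its first exit from the open coordinate ball the curve would have covered a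
  coordinate distance of at least rho, hence a length of at least a rho.\<close>

lemma short_curve_in_ball:
  assumes C1: "C1_curve_on M 0 1 \<gamma>" and c: "c \<in> charts M" and \<gamma>0: "\<gamma> 0 \<in> fst c"
    and \<rho>: "0 < \<rho>" "cball (snd c (\<gamma> 0)) \<rho> \<subseteq> coord_image c"
    and a: "0 < a" "\<And>p w. p \<in> cball (snd c (\<gamma> 0)) \<rho> \<Longrightarrow> a * norm w \<le> gnorm M c p w"
    and short: "curve_length M \<gamma> < a * \<rho>" and t: "t \<in> {0..1}"
  shows "\<gamma> t \<in> fst c \<and> snd c (\<gamma> t) \<in> ball (snd c (\<gamma> 0)) \<rho>"
proof (rule ccontr)
  let ?y = "snd c (\<gamma> 0)"
  let ?N = "{p \<in> fst c. snd c p \<in> ball ?y \<rho>}"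
  let ?K = "{p \<in> fst c. snd c p \<in> cball ?y \<rho>}"
  assume out: "\<not> (\<gamma> t \<in> fst c \<and> snd c (\<gamma> t) \<in> ball ?y \<rho>)"
  have cont: "continuous_on {0..1} \<gamma>" using C1 by (simp add: C1_curve_on_def)
  have cv: "closed ({0..1} \<inter> \<gamma> -` T)" if "closed T" for T
    using continuous_on_closed_vimage[OF closed_atLeastAtMost, of 0 1 \<gamma>] cont that by (metis Int_commute)
  have Nopen: "open ?N" by (rule open_coord_preimage[OF c open_ball])
  \<comment> \<open>As the image of a compact ball \<open>?K\<close> is compact, hence closed in the
    Hausdorff surface. Closedness relative to the chart domain would not place the first exit point
    in the chart.\<close>
  have "?K = inv_into (fst c) (snd c) ` cball ?y \<rho>"
  proof (intro equalityI subsetI)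
    fix p assume "p \<in> ?K"
    then show "p \<in> inv_into (fst c) (snd c) ` cball ?y \<rho>"
      using chart_inverse(1)[OF c, of p] by (metis (mono_tags, lifting) imageI mem_Collect_eq)
  next
    fix p assume "p \<in> inv_into (fst c) (snd c) ` cball ?y \<rho>"
    then obtain z where "z \<in> cball ?y \<rho>" "p = inv_into (fst c) (snd c) z" by blast
    then show "p \<in> ?K" using chart_inverse(2,3)[OF c, of z] \<rho>(2) by auto
  qed
  then have "compact ?K"
    using compact_continuous_image[OF continuous_on_subset[OF chart_continuous(2)[OF c] \<rho>(2)] compact_cball] by simp
  then have Kclosed: "closed ?K" by (rule compact_imp_closed)
  \<comment> \<open>The parameters at which the curve is outside the open ball; the least of them is
    the first exit.\<close>
  define B where "B = {0..1} \<inter> \<gamma> -` (- ?N)"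
  have B: "closed B" unfolding B_def using Nopen by (intro cv closed_Compl)
  have "t \<in> B" using out t by (auto simp: B_def)
  moreover have bdd: "bdd_below B" by (auto simp: B_def bdd_below_def)
  ultimately have s: "Inf B \<in> B" using closed_contains_Inf B by blast
  define s where "s = Inf B"
  have s01: "s \<in> {0..1}" and sN: "\<gamma> s \<notin> ?N" using \<open>Inf B \<in> B\<close> by (auto simp: B_def s_def)
  have below: "\<gamma> r \<in> ?N" if "0 \<le> r" "r < s" for r
  proof (rule ccontr)
    assume "\<gamma> r \<notin> ?N"
    then have "r \<in> B" using that s01 by (auto simp: B_def)
    then show False using cInf_lower[OF _ bdd, of r] that(2) by (simp add: s_def)
  qed
  have s0: "0 < s" using sN \<gamma>0 \<rho>(1) s01 by (cases "s = 0") auto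
  have sK: "\<gamma> s \<in> ?K"
  proof -
    have cl: "closed ({0..1} \<inter> \<gamma> -` ?K)"
      by (rule cv[OF Kclosed])
    have "{0..<s} \<subseteq> {0..1} \<inter> \<gamma> -` ?K"
    proof
      fix r assume r: "r \<in> {0..<s}"
      then have "\<gamma> r \<in> ?N" using below by auto
      then show "r \<in> {0..1} \<inter> \<gamma> -` ?K" using r s01 by auto
    qed
    then have "closure {0..<s} \<subseteq> {0..1} \<inter> \<gamma> -` ?K" using cl by (rule closure_minimal)
    moreover have "s \<in> closure {0..<s}" using s0 by (simp add: closure_atLeastLessThan)
    ultimately show ?thesis by blast
  qed
  have im: "\<gamma> ` {0..s} \<subseteq> ?K"
  proof
    fix p assume "p \<in> \<gamma> ` {0..s}"
    then obtain r where r: "r \<in> {0..s}" "p = \<gamma> r" by blast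
    show "p \<in> ?K"
    proof (cases "r = s")
      case True
      then show ?thesis using sK r(2) by simp
    next
      case False
      then have "\<gamma> r \<in> ?N" using below r(1) by auto
      then show ?thesis using r(2) by auto
    qed
  qed
  have "\<rho> \<le> norm (snd c (\<gamma> s) - ?y)" using sN sK by (auto simp: dist_norm norm_minus_commute)
  then have "a * \<rho> \<le> a * norm (snd c (\<gamma> s) - ?y)" using a(1) by simp
  also have "\<dots> \<le> integral {0..s} (speed M \<gamma>)"
    by (rule chart_length_lower[OF C1 c _ _ im a]) (use s01 in auto)
  also have "\<dots> \<le> integral {0..1} (speed M \<gamma>)"
    by (rule integral_subset_le) (use s01 speed_integrable[OF C1] speed_integrable'[OF C1] speed_nonneg in auto)
  finally show False using short by (simp add: curve_length_eq)
qed

text \<open>Geodesics from \<open>Y\<close> to points of a small coordinate ball are no longer than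
  the coordinate segments, so they stay in one chart and their coordinate speed is at most a
  multiple of the coordinate distance. Thus \<open>sol_with_initial_velocity\<close> applies to
  them.\<close>

lemma geodesic_with_initial_direction:
  assumes Y: "Y \<in> U" and N: "open N" "Y \<in> N"
  shows "\<exists>r>0. \<forall>w. norm w \<le> r \<longrightarrow> (\<exists>Z\<in>U \<inter> N. velocity M (geo Y Z) 0 = w)"
proof -
  let ?c = "chart_at M Y"
  note c = chart_at[of Y]
  let ?y = "snd ?c Y" and ?i = "inv_into (fst ?c) (snd ?c)"
  obtain \<rho> where \<rho>: "0 < \<rho>" "cball ?y \<rho> \<subseteq> snd ?c ` (fst ?c \<inter> (U \<inter> N))" "cball ?y \<rho> \<subseteq> coord_image ?c"
    and ode: "\<exists>K. quadratic_ode (geodesic_rhs (gcoeff M ?c)) (cball ?y \<rho>) K"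
    by (rule chart_ball[OF c(1) open_Int[OF open_U N(1)] _ c(2)]) (use Y N in auto)
  then obtain K where K: "quadratic_ode (geodesic_rhs (gcoeff M ?c)) (cball ?y \<rho>) K" by blast
  interpret quadratic_ode "geodesic_rhs (gcoeff M ?c)" "cball ?y \<rho>" K by (rule K)
  obtain a b where ab: "0 < a" "0 < b" "\<And>p w. p \<in> cball ?y \<rho> \<Longrightarrow> a * norm w \<le> gnorm M ?c p w"
    "\<And>p w. p \<in> cball ?y \<rho> \<Longrightarrow> gnorm M ?c p w \<le> b * norm w"
    using gnorm_comparable[OF c(1) compact_cball \<rho>(3)] by blast
  \<comment> \<open>The first bound keeps the points in the given ball; the second makes each
    geodesic shorter than a rho, so that it cannot leave that ball; the third is the smallness
    condition of \<open>sol_speed_bound\<close>.\<close>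
  define q where "q = min (\<rho> / 2) (min (a * \<rho> / (2 * b)) (a / (2 * b * (K + 1))))"
  have q: "0 < q" "q < \<rho>" "b * q < a * \<rho>" "K * (b / a * q) \<le> 1/2"
  proof -
    show "0 < q" using ab \<rho>(1) K_nonneg by (simp add: q_def)
    show "q < \<rho>" using \<rho>(1) unfolding q_def by linarith
    have "q \<le> a * \<rho> / (2 * b)" unfolding q_def by linarith
    then have "b * q \<le> a * \<rho> / 2" using ab by (simp add: field_simps)
    then show "b * q < a * \<rho>" using ab \<rho>(1) by (smt (verit) field_sum_of_halves mult_pos_pos)
    have "q \<le> a / (2 * b * (K + 1))" unfolding q_def by linarith
    moreover have "0 < 2 * b * (K + 1)" using ab K_nonneg by simp
    ultimately have "q * (2 * b * (K + 1)) \<le> a" using pos_le_divide_eq by blast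
    then have "(K + 1) * (b / a * q) \<le> 1/2" using ab(1) by (simp add: field_simps)
    moreover have "0 \<le> b / a * q" using ab \<open>0 < q\<close> by simp
    moreover have "(K + 1) * (b / a * q) = K * (b / a * q) + b / a * q"
      by (simp only: distrib_right mult_1)
    ultimately show "K * (b / a * q) \<le> 1/2" by linarith
  qed
  have Zin: "?i z \<in> U" "?i z \<in> N" "?i z \<in> fst ?c" "snd ?c (?i z) = z" if z: "z \<in> cball ?y \<rho>" for z
  proof -
    obtain p where p: "p \<in> fst ?c" "p \<in> U" "p \<in> N" "z = snd ?c p" using \<rho>(2) z by blast
    then show "?i z \<in> U" "?i z \<in> N" "?i z \<in> fst ?c" "snd ?c (?i z) = z"
      using chart_inverse(1)[OF c(1) p(1)] by auto
  qed
  have "\<exists>v. sol 0 1 (snd ?c \<circ> geo Y (?i z)) v \<and> (\<forall>r\<in>{0..1}. norm (v r) \<le> (2 * (b / a)) * norm (z - ?y)) \<and>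
      velocity M (geo Y (?i z)) 0 = v 0" if z: "z \<in> cball ?y q" for z
  proof -
    let ?\<gamma> = "geo Y (?i z)"
    have z\<rho>: "z \<in> cball ?y \<rho>" using z q(2) by auto
    note g = geo[OF Y Zin(1)[OF z\<rho>]]
    have "gd (?i ?y) (?i z) \<le> b * norm (z - ?y)"
    proof (rule gd_le_segment[OF c(1)])
      have "closed_segment ?y z \<subseteq> cball ?y \<rho>" using z\<rho> \<rho>(1) by (simp add: closed_segment_subset)
      then show "closed_segment ?y z \<subseteq> snd ?c ` (fst ?c \<inter> U)"
        "\<And>p. p \<in> closed_segment ?y z \<Longrightarrow> gnorm M ?c p (z - ?y) \<le> b * norm (z - ?y)"
        using \<rho>(2) ab(4) by blast+
    qed
    then have len: "curve_length M ?\<gamma> \<le> b * norm (z - ?y)"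
      using chart_inverse(1)[OF c] by (simp add: gd_def)
    have nz: "norm (z - ?y) \<le> q" using z by (simp add: dist_norm norm_minus_commute)
    then have "b * norm (z - ?y) \<le> b * q" using ab by simp
    then have short: "curve_length M ?\<gamma> < a * \<rho>" using len q(3) by linarith
    have stay: "?\<gamma> r \<in> fst ?c \<and> snd ?c (?\<gamma> r) \<in> ball ?y \<rho>" if "r \<in> {0..1}" for r
      using short_curve_in_ball[OF g(5) c(1), of \<rho> a r] g(2) c(2) \<rho>(1,3) ab(1,3) short that by simp
    then have im: "?\<gamma> ` {0..1} \<subseteq> fst ?c" by blast
    obtain v where v: "chart_geodesic M ?c (snd ?c \<circ> ?\<gamma>) v 0 1"
      using geodesic_onD[OF g(1)[unfolded geodesic_iff] c(1) order_refl zero_less_one order_refl im] by blast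
    have sol: "sol 0 1 (snd ?c \<circ> ?\<gamma>) v"
      unfolding sol_def
    proof (intro ballI conjI)
      fix r :: real assume r: "r \<in> {0..1}"
      show "(snd ?c \<circ> ?\<gamma>) r \<in> cball ?y \<rho>" using stay[OF r] by simp
    qed (use v in \<open>auto simp: chart_geodesic_def\<close>)
    have der: "(snd ?c \<circ> ?\<gamma> has_vector_derivative v r) (at r within {0..1})" if "r \<in> {0..1}" for r
      using v that unfolding chart_geodesic_def by blast
    have contv: "continuous_on {0..1} v" by (rule sol_cont(2)[OF sol])
    have cont\<gamma>: "continuous_on {0..1} ?\<gamma>" using g(5) by (simp add: C1_curve_on_def)
    have "integral {0..1} (\<lambda>r. norm (v r)) \<le> integral {0..1} (\<lambda>r. (1 / a) * speed M ?\<gamma> r)"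
    proof (rule integral_le)
      show "(\<lambda>r. norm (v r)) integrable_on {0..1}"
        by (intro integrable_continuous_real continuous_intros contv)
      show "(\<lambda>r. (1 / a) * speed M ?\<gamma> r) integrable_on {0..1}"
        using speed_integrable[OF g(5)] by (rule integrable_on_mult_right)
      fix r :: real assume r: "r \<in> {0..1}"
      have "speed M ?\<gamma> r = gnorm M ?c (snd ?c (?\<gamma> r)) (v r)"
        by (rule speed_eq[OF c(1) r _ cont\<gamma> der[OF r]]) (use stay[OF r] in blast)
      moreover have "snd ?c (?\<gamma> r) \<in> cball ?y \<rho>" using stay[OF r] by auto
      ultimately have "a * norm (v r) \<le> speed M ?\<gamma> r" using ab(3) by simp
      then show "norm (v r) \<le> (1 / a) * speed M ?\<gamma> r" using ab(1) by (simp add: field_simps)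
    qed
    also have "\<dots> = (1 / a) * curve_length M ?\<gamma>" by (simp add: curve_length_eq)
    also have "\<dots> \<le> (1 / a) * (b * norm (z - ?y))" using len ab by (intro mult_left_mono) auto
    finally have l: "integral {0..1} (\<lambda>r. norm (v r)) \<le> b / a * norm (z - ?y)" by simp
    have "K * (b / a * norm (z - ?y)) \<le> K * (b / a * q)"
      using nz ab K_nonneg by (intro mult_left_mono) auto
    then have Kl: "K * (b / a * norm (z - ?y)) \<le> 1/2" using q(4) by linarith
    have "\<forall>r\<in>{0..1}. norm (v r) \<le> (2 * (b / a)) * norm (z - ?y)"
      using sol_speed_bound[OF sol l Kl] by (simp only: mult.assoc) blast
    moreover have "velocity M ?\<gamma> 0 = v 0"
      using velocity_eq[of 0 ?\<gamma> "v 0"] der[of 0] g(2) by simp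
    ultimately show ?thesis using sol by blast
  qed
  then obtain v where v: "\<And>z. z \<in> cball ?y q \<Longrightarrow> sol 0 1 (snd ?c \<circ> geo Y (?i z)) (v z) \<and>
      (\<forall>r\<in>{0..1}. norm (v z r) \<le> (2 * (b / a)) * norm (z - ?y)) \<and>
      velocity M (geo Y (?i z)) 0 = v z 0" by metis
  have "\<exists>r>0. \<forall>w. norm w \<le> r \<longrightarrow> (\<exists>z\<in>cball ?y q. v z 0 = w)"
  proof (rule sol_with_initial_velocity)
    fix z assume z: "z \<in> cball ?y q"
    then have "z \<in> cball ?y \<rho>" using q(2) by auto
    note Z = Zin[OF this]
    show "sol 0 1 (snd ?c \<circ> geo Y (?i z)) (v z) \<and> (snd ?c \<circ> geo Y (?i z)) 0 = ?y \<and>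
        (snd ?c \<circ> geo Y (?i z)) 1 = z \<and> (\<forall>r\<in>{0..1}. norm (v z r) \<le> (2 * (b / a)) * norm (z - ?y))"
      using v[OF z] geo(2,3)[OF Y Z(1)] Z(4) by simp
  qed (use q ab in auto)
  then obtain r where r: "0 < r" "\<And>w. norm w \<le> r \<Longrightarrow> \<exists>z\<in>cball ?y q. v z 0 = w" by blast
  have "\<exists>Z\<in>U \<inter> N. velocity M (geo Y Z) 0 = w" if w: "norm w \<le> r" for w
  proof -
    obtain z where z: "z \<in> cball ?y q" "v z 0 = w" using r(2)[OF w] by blast
    then have "z \<in> cball ?y \<rho>" using q(2) by auto
    then show ?thesis using Zin(1,2)[of z] v[OF z(1)] z(2) by blast
  qed
  then show ?thesis using r(1) by blast
qed

lemma geo_initial_derivative: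
  assumes X: "X \<in> U" and P: "P \<in> U"
  shows "(snd (chart_at M X) \<circ> geo X P has_vector_derivative velocity M (geo X P) 0) (at 0 within {0..1})"
proof -
  obtain w where w: "(snd (chart_at M X) \<circ> geo X P has_vector_derivative w) (at 0 within {0..1})"
    using C1_curve_on_derivative[OF geo(5)[OF assms] chart_at(1), of 0 X] geo(2)[OF assms] chart_at(2) by auto
  then show ?thesis using velocity_eq[of 0 "geo X P" w] geo(2)[OF assms] by simp
qed

text \<open>A geodesic from \<open>Y\<close> whose initial velocity is a negative multiple of that
  of the geodesic to \<open>B\<close> continues the geodesic from \<open>B\<close> smoothly.
  Together they form a geodesic in \<open>U\<close> from \<open>B\<close> to \<open>Z\<close>, which
  by uniqueness is the chosen one, and it passes through \<open>Y\<close>.\<close>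

lemma gd_extend:
  assumes B: "B \<in> U" and Y: "Y \<in> U" and ne: "B \<noteq> Y" and N: "open N" "Y \<in> N"
  shows "\<exists>Z\<in>U \<inter> N. Z \<noteq> Y \<and> gd B Z = gd B Y + gd Y Z"
proof -
  let ?c = "chart_at M Y"
  note c = chart_at[of Y]
  define u where "u = velocity M (geo Y B) 0"
  have u: "u \<noteq> 0" unfolding u_def using velocity_geo_nonzero[OF Y B] ne by metis
  obtain r where r: "0 < r" "\<And>w. norm w \<le> r \<Longrightarrow> \<exists>Z\<in>U \<inter> N. velocity M (geo Y Z) 0 = w"
    using geodesic_with_initial_direction[OF Y N] by blast
  define \<mu> where "\<mu> = r / norm u"
  have \<mu>: "0 < \<mu>" using r(1) u by (simp add: \<mu>_def)
  have "norm (- \<mu> *\<^sub>R u) \<le> r" using u r(1) by (simp add: \<mu>_def)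
  then obtain Z where Z: "Z \<in> U" "Z \<in> N" "velocity M (geo Y Z) 0 = - \<mu> *\<^sub>R u" using r(2) by blast
  have ZY: "Z \<noteq> Y"
  proof
    assume "Z = Y"
    moreover have "speed M (geo Y Y) 0 = speed M (\<lambda>r. Y) 0"
      by (rule speed_cong) (use geo_const[OF Y] in auto)
    moreover have "geodesic M (\<lambda>r. Y)" by (simp add: geodesic_iff geodesic_on_const)
    ultimately have "velocity M (geo Y Z) 0 = 0"
      using speed_zero_iff[OF geo(5)[OF Y Y], of 0] speed_zero_iff[OF geodesic_C1, of "\<lambda>r. Y" 0] velocity_const by simp
    then show False using Z(3) u \<mu> by simp
  qed
  note gB = geo[OF B Y] and gZ = geo[OF Y Z(1)]
  \<comment> \<open>Times in the proportion 1 to mu make the velocities match at the joint: the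
    first piece, run in time l, arrives with velocity -(1 + mu) u, and the second, sped up by m,
    starts with m (-mu u), which is the same.\<close>
  define l where "l = 1 / (1 + \<mu>)"
  define m where "m = (1 + \<mu>) / \<mu>"
  have l: "0 < l" "l < 1" "(1 + \<mu>) * l = 1" using \<mu> by (simp_all add: l_def)
  have m: "0 < m" "m * l + (- 1 / \<mu>) = 0" "m * 1 + (- 1 / \<mu>) = 1"
    using \<mu> unfolding m_def l_def by (simp_all add: field_simps)
  define \<sigma> where "\<sigma> t = (if t \<le> l then geo B Y ((1 + \<mu>) * t + 0) else geo Y Z (m * t + (- 1 / \<mu>)))" for t
  have \<sigma>1: "\<sigma> t = geo B Y ((1 + \<mu>) * t + 0)" if "t \<in> {0..l}" for t using that by (simp add: \<sigma>_def)
  have \<sigma>l: "\<sigma> l = Y" using l(3) gB(3) by (simp add: \<sigma>_def)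
  have \<sigma>2: "\<sigma> t = geo Y Z (m * t + (- 1 / \<mu>))" if "t \<in> {l..1}" for t
    using that m(2) gZ(2) \<sigma>l by (cases "t = l") (auto simp: \<sigma>_def)
  have mem1: "(1 + \<mu>) * t + 0 \<in> {0..1}" if t: "t \<in> {0..l}" for t
  proof -
    have "(1 + \<mu>) * t \<le> (1 + \<mu>) * l" using t \<mu> by (intro mult_left_mono) auto
    then show ?thesis using t \<mu> l(3) by auto
  qed
  have mem2: "m * t + (- 1 / \<mu>) \<in> {0..1}" if t: "t \<in> {l..1}" for t
  proof -
    have "m * l \<le> m * t" "m * t \<le> m * 1" using t m(1) by (auto intro: mult_left_mono)
    then show ?thesis using m(2,3) by auto
  qed
  have "geodesic_on M 0 l (\<lambda>t. geo B Y ((1 + \<mu>) * t + 0))"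
    by (rule geodesic_on_affine[OF gB(1)[unfolded geodesic_iff] _ mem1]) (use \<mu> in auto)
  then have G1: "geodesic_on M 0 l \<sigma>" by (rule geodesic_on_cong) (rule \<sigma>1)
  have "geodesic_on M l 1 (\<lambda>t. geo Y Z (m * t + (- 1 / \<mu>)))"
    by (rule geodesic_on_affine[OF gZ(1)[unfolded geodesic_iff] _ mem2]) (use m(1) in auto)
  then have G2: "geodesic_on M l 1 \<sigma>" by (rule geodesic_on_cong) (rule \<sigma>2)
  let ?k = "1 + \<mu>"
  \<comment> \<open>The derivative at \<open>Y\<close> is read off from the reversed geodesic, whose
    initial velocity is \<open>u\<close>.\<close>
  have e1: "\<sigma> t = geo Y B (- ?k * t + 1)" if "t \<in> {0..l}" for t
  proof -
    have "- ?k * t + 1 = 1 - ((1 + \<mu>) * t + 0)" by (simp add: algebra_simps)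
    then show ?thesis using \<sigma>1[OF that] geo_reverse[OF Y B mem1[OF that]] by (simp only:)
  qed
  have mem1': "- ?k * t + 1 \<in> {0..1}" if "t \<in> {0..l}" for t using mem1[OF that] by (simp add: algebra_simps)
  have "(snd ?c \<circ> geo Y B has_vector_derivative u) (at (- ?k * l + 1) within {0..1})"
  proof -
    have "- ?k * l + 1 = 0" using l(3) by (simp add: algebra_simps)
    then show ?thesis using geo_initial_derivative[OF Y B] by (simp only: u_def)
  qed
  then have "((\<lambda>t. (snd ?c \<circ> geo Y B) (- ?k * t + 1)) has_vector_derivative - ?k *\<^sub>R u) (at l within {0..l})"
    using mem1' by (rule has_vector_derivative_affine)
  then have D1: "(snd ?c \<circ> \<sigma> has_vector_derivative - ?k *\<^sub>R u) (at l within {0..l})"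
    by (rule has_vector_derivative_transform[rotated 2]) (use l(1) e1 in auto)
  have "(snd ?c \<circ> geo Y Z has_vector_derivative - \<mu> *\<^sub>R u) (at (m * l + (- 1 / \<mu>)) within {0..1})"
    unfolding m(2) using geo_initial_derivative[OF Y Z(1)] unfolding Z(3) .
  then have "((\<lambda>t. (snd ?c \<circ> geo Y Z) (m * t + (- 1 / \<mu>))) has_vector_derivative m *\<^sub>R (- \<mu> *\<^sub>R u)) (at l within {l..1})"
    using mem2 by (rule has_vector_derivative_affine)
  moreover have "m *\<^sub>R (- \<mu> *\<^sub>R u) = - ?k *\<^sub>R u"
  proof -
    have "m * - \<mu> = - ?k" using \<mu> by (simp add: m_def)
    then show ?thesis by (simp only: scaleR_scaleR)
  qed
  ultimately have "((\<lambda>t. (snd ?c \<circ> geo Y Z) (m * t + (- 1 / \<mu>))) has_vector_derivative - ?k *\<^sub>R u) (at l within {l..1})"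
    by (simp only:)
  then have D2: "(snd ?c \<circ> \<sigma> has_vector_derivative - ?k *\<^sub>R u) (at l within {l..1})"
    by (rule has_vector_derivative_transform[rotated 2]) (use l(2) \<sigma>2 in auto)
  have "geodesic M \<sigma>"
    unfolding geodesic_iff
    by (rule geodesic_on_join[OF G1 G2 l(1,2) c(1) _ D1 D2]) (simp add: \<sigma>l c(2))
  moreover have "\<sigma> 0 = B" "\<sigma> 1 = Z" using \<sigma>1[of 0] \<sigma>2[of 1] l gB(2) gZ(3) m(3) by auto
  moreover have "\<sigma> t \<in> U" if "t \<in> {0..1}" for t
  proof (cases "t \<le> l")
    case True
    then have "t \<in> {0..l}" using that by auto
    then show ?thesis using \<sigma>1 gB(4)[OF mem1] by simp
  next
    case False
    then have "t \<in> {l..1}" using that by auto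
    then show ?thesis using \<sigma>2 gZ(4)[OF mem2] by simp
  qed
  moreover have l01: "l \<in> {0..1}" using l by auto
  ultimately have "\<sigma> l = geo B Z l" by (intro geo_eq B Z(1))
  then have "gd B Y + gd Y Z = gd B Z" using gd_between[OF B Z(1) l01] \<sigma>l by simp
  then show ?thesis using Z(1,2) ZY by (intro bexI[of _ Z]) auto
qed

section \<open>Balanced points\<close>

text \<open>With \<open>T\<close> at parameter r, both geodesics from \<open>T\<close> are rescaled
  pieces of the one from \<open>A\<close> to \<open>B\<close>, so their initial velocities are 0 - r
  and 1 - r times the same vector.\<close>

lemma dir_opposite:
  assumes A: "A \<in> U" and B: "B \<in> U" and T: "T \<in> path_image (geo A B)" "T \<noteq> A" "T \<noteq> B"
  shows "dir T A = - dir T B" and "T \<in> U"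
proof -
  obtain r where r: "r \<in> {0..1}" "T = geo A B r" using T(1) unfolding path_image_def by blast
  note g = geo[OF A B]
  show TU: "T \<in> U" using g(4)[OF r(1)] r(2) by simp
  have r01: "0 < r" "r < 1" using r T(2,3) g(2,3) by (cases "r = 0"; cases "r = 1"; force)+
  let ?c = "chart_at M T"
  note c = chart_at[of T]
  obtain w where w: "(snd ?c \<circ> geo A B has_vector_derivative w) (at r within {0..1})"
    using C1_curve_on_derivative[OF g(5) c(1) r(1)] c(2) r(2) by metis
  have vel: "velocity M (geo T (geo A B s)) 0 = (s - r) *\<^sub>R w" if s: "s \<in> {0..1}" for s
  proof (rule velocity_eq)
    have T0: "geo T (geo A B s) 0 = T" using geo(2)[OF TU g(4)[OF s]] .
    have "(snd ?c \<circ> geo A B has_vector_derivative w) (at ((s - r) * 0 + r) within {0..1})" using w by simp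
    then have "((\<lambda>q. (snd ?c \<circ> geo A B) ((s - r) * q + r)) has_vector_derivative (s - r) *\<^sub>R w) (at 0 within {0..1})"
      using affine_mem_01[OF r(1) s] by (rule has_vector_derivative_affine)
    then have "(snd ?c \<circ> geo T (geo A B s) has_vector_derivative (s - r) *\<^sub>R w) (at 0 within {0..1})"
      by (rule has_vector_derivative_transform[rotated 2])
        (use geo_subcurve[OF A B r(1) s] r(2) in \<open>auto simp: subcurve_def\<close>)
    then show "(snd (chart_at M (geo T (geo A B s) 0)) \<circ> geo T (geo A B s) has_vector_derivative (s - r) *\<^sub>R w) (at 0 within {0..1})"
      unfolding T0 .
  qed simp
  have vA: "velocity M (geo T A) 0 = (0 - r) *\<^sub>R w" using vel[of 0] g(2) by simp
  have vB: "velocity M (geo T B) 0 = (1 - r) *\<^sub>R w" using vel[of 1] g(3) by simp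
  have wn: "w \<noteq> 0" using vB velocity_geo_nonzero[OF TU B T(3)] by auto
  have n: "0 < tangent_norm M T w" by (rule tangent_norm_pos[OF wn])
  have "dir T A = - ((1 / tangent_norm M T w) *\<^sub>R w)"
    unfolding dir_def vA tangent_norm_scale using r01 by simp
  moreover have "dir T B = (1 / tangent_norm M T w) *\<^sub>R w"
    unfolding dir_def vB tangent_norm_scale using r01 by simp
  ultimately show "dir T A = - dir T B" by simp
qed

lemma tangent_inner_minus: "tangent_inner M X (- u) v = - tangent_inner M X u v"
  using tangent_inner_bilinear(3)[of X "-1" u v] by simp

lemma angle_straight:
  assumes "A \<in> U" "B \<in> U" "T \<in> path_image (geo A B)" "T \<noteq> A" "T \<noteq> B"
  shows "angle M U A T B = pi"
  using dir_opposite[OF assms] dir_unit[of T B] assms by (simp add: angle_eq tangent_inner_minus)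

lemma angle_sym: "angle M U P X Q = angle M U Q X P"
  unfolding angle_eq by (subst tangent_inner_sym) simp

text \<open>A second common point would, by nonbranching, put the end of one side on the other side,
  and the angle at that end would be straight.\<close>

lemma sides_meet_only_at_vertex:
  assumes U: "P \<in> U" "X \<in> U" "Q \<in> U" and ne: "P \<noteq> X" "X \<noteq> Q" "P \<noteq> Q"
    and ang: "angle M U X P Q < pi" "angle M U X Q P < pi"
  shows "path_image (geo P X) \<inter> path_image (geo X Q) = {X}"
proof (intro equalityI subsetI)
  fix Y assume Y: "Y \<in> path_image (geo P X) \<inter> path_image (geo X Q)"
  show "Y \<in> {X}"
  proof (rule ccontr)
    assume "Y \<notin> {X}"
    moreover have "Y \<in> path_image (geo X P)" "Y \<in> path_image (geo X Q)"
      using Y path_image_geo_sym[OF U(1,2)] by auto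
    ultimately have "P \<in> path_image (geo X Q) \<or> Q \<in> path_image (geo X P)"
      using geo_nonbranching[OF U(2,1,3)] by blast
    then show False
    proof
      assume "P \<in> path_image (geo X Q)"
      then show False using angle_straight[OF U(2,3), of P] ne ang by simp
    next
      assume "Q \<in> path_image (geo X P)"
      then show False using angle_straight[OF U(2,1), of Q] ne ang by simp
    qed
  qed
next
  fix Y assume "Y \<in> {X}"
  then show "Y \<in> path_image (geo P X) \<inter> path_image (geo X Q)"
    using geo(2)[OF U(2,3)] geo(3)[OF U(1,2)] pathstart_in_path_image[of "geo X Q"] pathfinish_in_path_image[of "geo P X"]
    by (simp add: pathstart_def pathfinish_def)
qed

text \<open>The first-order condition with \<open>k = 1\<close>, tested on the sum of the two unit
  vectors, bounds its length by 1. The square of this length is 2 + 2 cos of the angle, so the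
  cosine is at most -1/2.\<close>

lemma angle_at_minimizing_vertex:
  assumes U: "P \<in> U" "X \<in> U" "Q \<in> U" and ne: "P \<noteq> X" "Q \<noteq> X" "P \<noteq> Q"
    and min: "\<And>Y. Y \<in> U \<Longrightarrow> gd X P + gd X Q \<le> gd Y X + (gd Y P + gd Y Q)"
  shows "2 * pi / 3 \<le> angle M U P X Q"
proof -
  let ?s = "dir X P + dir X Q" and ?x = "tangent_inner M X (dir X P) (dir X Q)"
  have "tangent_inner M X (\<Sum>R\<in>{P, Q}. dir X R) ?s \<le> 1 * tangent_norm M X ?s"
    by (rule first_order_condition[OF U(2), of _ "\<lambda>R. R"]) (use U ne min in auto)
  then have "(tangent_norm M X ?s)\<^sup>2 \<le> tangent_norm M X ?s"
    using ne by (simp add: tangent_norm_power2)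
  moreover have "0 \<le> tangent_norm M X ?s" using tangent_norm_pos[of ?s X] by (cases "?s = 0") (auto simp: tangent_norm_def tangent_inner_def)
  ultimately have "tangent_norm M X ?s \<le> 1"
    using mult_strict_left_mono[of 1 "tangent_norm M X ?s" "tangent_norm M X ?s"]
    unfolding power2_eq_square by linarith
  then have "(tangent_norm M X ?s)\<^sup>2 \<le> 1" using \<open>0 \<le> tangent_norm M X ?s\<close> by (simp add: power_le_one)
  moreover have "(tangent_norm M X ?s)\<^sup>2 = 2 + 2 * ?x"
    unfolding tangent_norm_power2 tangent_inner_bilinear
    using dir_unit[OF U(2,1) ne(1)] dir_unit[OF U(2,3) ne(2)] tangent_inner_sym[of X "dir X Q" "dir X P"] by simp
  \<comment> \<open>The lower bound keeps the argument within the range where \<open>arccos\<close>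
    is antitone.\<close>
  ultimately have "?x \<le> - (1 / 2)" "- 1 \<le> ?x"
    using zero_le_power2[of "tangent_norm M X ?s"] by linarith+
  then have "arccos (- (1 / 2)) \<le> arccos ?x" by (intro arccos_le_arccos) auto
  then show ?thesis by (simp add: angle_eq)
qed

text \<open>On a side the directions to its two ends cancel, and the condition tested on the
  remaining unit vector would give 1 <= 0.\<close>

lemma minimizer_not_on_side:
  assumes U: "P \<in> U" "Q \<in> U" "R \<in> U" and ne: "P \<noteq> Q" "R \<noteq> P" "R \<noteq> Q"
    and X: "X \<in> path_image (geo P Q)" "X \<noteq> P" "X \<noteq> Q" "X \<noteq> R"
    and min: "\<And>Y. Y \<in> U \<Longrightarrow> gd X P + (gd X Q + gd X R) \<le> gd Y P + (gd Y Q + gd Y R)"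
  shows False
proof -
  note o = dir_opposite[OF U(1,2) X(1,2,3)]
  have "tangent_inner M X (\<Sum>R\<in>{P, Q, R}. dir X R) (dir X R) \<le> 0 * tangent_norm M X (dir X R)"
    by (rule first_order_condition[OF o(2), of _ "\<lambda>R. R"]) (use U ne X min in auto)
  moreover have "(\<Sum>R\<in>{P, Q, R}. dir X R) = dir X R" using ne o(1) by simp
  ultimately show False using dir_unit[OF o(2) U(3)] X(4) by simp
qed

text \<open>The condition tested on the sum of the three unit vectors makes it zero. Then
  \<open>dir X P + dir X Q\<close> has length 1, so 2 + 2 cos = 1.\<close>

lemma angles_at_interior_minimizer:
  assumes X: "X \<in> U" and U: "P \<in> U" "Q \<in> U" "R \<in> U" and ne: "P \<noteq> Q" "R \<noteq> P" "R \<noteq> Q"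
    "X \<noteq> P" "X \<noteq> Q" "X \<noteq> R"
    and min: "\<And>Y. Y \<in> U \<Longrightarrow> gd X P + (gd X Q + gd X R) \<le> gd Y P + (gd Y Q + gd Y R)"
  shows "angle M U P X Q = 2 * pi / 3"
proof -
  let ?s = "dir X P + (dir X Q + dir X R)"
  have "tangent_inner M X (\<Sum>R\<in>{P, Q, R}. dir X R) ?s \<le> 0 * tangent_norm M X ?s"
    by (rule first_order_condition[OF X, of _ "\<lambda>R. R"]) (use U ne min in auto)
  then have "tangent_inner M X ?s ?s \<le> 0" using ne by simp
  then have "?s = 0" using tangent_inner_pos[of ?s X] by fastforce
  then have s: "dir X P + dir X Q = - dir X R" by (metis add.assoc eq_neg_iff_add_eq_0)
  have "tangent_inner M X (dir X P + dir X Q) (dir X P + dir X Q) = tangent_inner M X (dir X R) (dir X R)"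
    unfolding s using tangent_inner_minus tangent_inner_sym by (metis add.inverse_inverse)
  then have "2 + 2 * tangent_inner M X (dir X P) (dir X Q) = 1"
    unfolding tangent_inner_bilinear
    using dir_unit[OF X U(1)] dir_unit[OF X U(2)] dir_unit[OF X U(3)] ne
      tangent_inner_sym[of X "dir X Q" "dir X P"] by simp
  then have "tangent_inner M X (dir X P) (dir X Q) = - (1 / 2)" by simp
  then show ?thesis by (simp only: angle_eq arccos_minus_one_half)
qed

section \<open>Passage to the plane and conclusion\<close>

lemma disk_homeomorphic_plane:
  obtains \<phi> :: "'a \<Rightarrow> complex" and \<psi> where "homeomorphism U UNIV \<phi> \<psi>"
proof -
  have "U homeomorphic ball (0::real^2) 1" using disk by (simp add: geodesic_disk_def)
  also have "ball (0::real^2) 1 homeomorphic (UNIV :: (real^2) set)" by (rule homeomorphic_ball01_UNIV)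
  also have "(UNIV :: (real^2) set) homeomorphic (UNIV :: complex set)"
    by (simp add: homeomorphic_UNIV_UNIV)
  finally have "U homeomorphic (UNIV :: complex set)" .
  then obtain \<phi> and \<psi> where "homeomorphism U (UNIV :: complex set) \<phi> \<psi>"
    unfolding homeomorphic_def by blast
  then show ?thesis by (rule that)
qed

lemma geodesic_plane_of_homeomorphism:
  assumes h: "homeomorphism U (UNIV :: complex set) \<phi> \<psi>"
  shows "geodesic_plane (\<lambda>x y. gd (\<psi> x) (\<psi> y)) (\<lambda>x y. \<phi> \<circ> geo (\<psi> x) (\<psi> y))"
proof -
  have inv: "\<phi> (\<psi> x) = x" "\<psi> x \<in> U" "P \<in> U \<Longrightarrow> \<psi> (\<phi> P) = P" for x P
    using h unfolding homeomorphism_def by auto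
  have cont: "continuous_on U \<phi>" "continuous_on UNIV \<psi>" using h unfolding homeomorphism_def by auto
  have inj: "\<phi> P = \<phi> Q \<longleftrightarrow> P = Q" if "P \<in> U" "Q \<in> U" for P Q using inv(3) that by metis
  have inj\<psi>: "\<psi> x \<noteq> \<psi> y" if "x \<noteq> y" for x y using inv(1) that by metis
  have im: "path_image (\<phi> \<circ> \<gamma>) = \<phi> ` path_image \<gamma>" for \<gamma> by (auto simp: path_image_def)
  have mem: "\<phi> P \<in> \<phi> ` path_image (geo (\<psi> x) (\<psi> y)) \<longleftrightarrow> P \<in> path_image (geo (\<psi> x) (\<psi> y))" if "P \<in> U" for P x y
    using inj that geo(7)[OF inv(2) inv(2), of x y] by blast
  have mem': "z \<in> path_image (\<phi> \<circ> geo (\<psi> x) (\<psi> y)) \<longleftrightarrow> \<psi> z \<in> path_image (geo (\<psi> x) (\<psi> y))" for x y z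
    using mem[OF inv(2), of z x y] by (simp add: im inv(1))
  show ?thesis
  proof
    fix x y z p q :: complex
    show "gd (\<psi> x) (\<psi> x) = 0" by (rule gd_self[OF inv(2)])
    show "0 < gd (\<psi> x) (\<psi> y)" if "x \<noteq> y" by (rule gd_pos[OF inv(2) inv(2) inj\<psi>[OF that]])
    show "gd (\<psi> x) (\<psi> y) = gd (\<psi> y) (\<psi> x)" by (rule gd_sym[OF inv(2) inv(2)])
    show "gd (\<psi> x) (\<psi> z) \<le> gd (\<psi> x) (\<psi> y) + gd (\<psi> y) (\<psi> z)" by (rule gd_triangle[OF inv(2) inv(2) inv(2)])
    show "continuous_on UNIV (\<lambda>y. gd (\<psi> x) (\<psi> y))"
      by (rule continuous_on_compose2[OF gd_continuous[OF inv(2)] cont(2)]) (use inv(2) in blast)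
    show "arc (\<phi> \<circ> geo (\<psi> x) (\<psi> y))" if "x \<noteq> y"
    proof -
      have a: "arc (geo (\<psi> x) (\<psi> y))" by (rule arc_geo[OF inv(2) inv(2) inj\<psi>[OF that]])
      have "path (\<phi> \<circ> geo (\<psi> x) (\<psi> y))"
        by (intro path_continuous_image arc_imp_path[OF a] continuous_on_subset[OF cont(1) geo(7)[OF inv(2) inv(2)]])
      moreover have "inj_on (\<phi> \<circ> geo (\<psi> x) (\<psi> y)) {0..1}"
        using a inj geo(4)[OF inv(2) inv(2)] unfolding arc_def inj_on_def by simp
      ultimately show ?thesis by (simp add: arc_def)
    qed
    show "pathstart (\<phi> \<circ> geo (\<psi> x) (\<psi> y)) = x" "pathfinish (\<phi> \<circ> geo (\<psi> x) (\<psi> y)) = y"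
      using geo(2,3)[OF inv(2) inv(2)] inv(1) by (simp_all add: pathstart_def pathfinish_def)
    show "path_image (\<phi> \<circ> geo (\<psi> x) (\<psi> y)) = path_image (\<phi> \<circ> geo (\<psi> y) (\<psi> x))"
      unfolding im using path_image_geo_sym[OF inv(2) inv(2)] by metis
    show "gd (\<psi> x) (\<psi> z) + gd (\<psi> z) (\<psi> y) = gd (\<psi> x) (\<psi> y)"
      if z: "z \<in> path_image (\<phi> \<circ> geo (\<psi> x) (\<psi> y))"
    proof -
      have "\<psi> z \<in> geo (\<psi> x) (\<psi> y) ` {0..1}" using z mem' unfolding path_image_def by blast
      then obtain r where "r \<in> {0..1}" "\<psi> z = geo (\<psi> x) (\<psi> y) r" by blast
      then show ?thesis using gd_between[OF inv(2) inv(2)] by metis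
    qed
    show "p \<in> path_image (\<phi> \<circ> geo (\<psi> x) (\<psi> q)) \<or> q \<in> path_image (\<phi> \<circ> geo (\<psi> x) (\<psi> p))"
      if y: "y \<in> path_image (\<phi> \<circ> geo (\<psi> x) (\<psi> p))" "y \<in> path_image (\<phi> \<circ> geo (\<psi> x) (\<psi> q))" "y \<noteq> x"
      using y(1,2) unfolding mem' by (intro geo_nonbranching[OF inv(2) inv(2) inv(2) _ _ inj\<psi>[OF y(3)]])
    show "\<exists>y'\<in>N. y' \<noteq> y \<and> gd (\<psi> x) (\<psi> y') = gd (\<psi> x) (\<psi> y) + gd (\<psi> y) (\<psi> y')"
      if y: "x \<noteq> y" "open N" "y \<in> N" for N
    proof -
      \<comment> \<open>The neighbourhood in \<open>gd_extend\<close> is arbitrary, so an open set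
        of the plane may be pulled back to the disk.\<close>
      have 1: "open (U \<inter> \<phi> -` N)" using continuous_open_preimage[OF cont(1) open_U y(2)] .
      have 2: "\<psi> y \<in> U \<inter> \<phi> -` N" using inv y(3) by simp
      obtain Z where Z: "Z \<in> U \<inter> (U \<inter> \<phi> -` N)" "Z \<noteq> \<psi> y"
        "gd (\<psi> x) Z = gd (\<psi> x) (\<psi> y) + gd (\<psi> y) Z"
        using gd_extend[OF inv(2) inv(2) inj\<psi>[OF y(1)] 1 2] by blast
      have "\<psi> (\<phi> Z) = Z" using inv(3) Z(1) by blast
      moreover from this have "\<phi> Z \<noteq> y" using Z(2) by metis
      moreover have "\<phi> Z \<in> N" using Z(1) by blast
      ultimately show ?thesis using Z(3) by (intro bexI[of _ "\<phi> Z"]) simp_all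
    qed
  qed
qed

theorem exists_balanced_point:
  assumes U: "A \<in> U" "B \<in> U" "C \<in> U" and ne: "A \<noteq> B" "B \<noteq> C" "C \<noteq> A"
    and ang: "angle M U B A C < 2 * pi / 3" "angle M U C B A < 2 * pi / 3" "angle M U A C B < 2 * pi / 3"
  shows "\<exists>T. balanced_point M U A B C T"
proof -
  obtain \<phi> :: "'a \<Rightarrow> complex" and \<psi> where h: "homeomorphism U UNIV \<phi> \<psi>"
    by (rule disk_homeomorphic_plane)
  have inv: "\<phi> (\<psi> x) = x" "\<psi> x \<in> U" "P \<in> U \<Longrightarrow> \<psi> (\<phi> P) = P" for x P
    using h unfolding homeomorphism_def by auto
  have cont: "continuous_on U \<phi>" "continuous_on UNIV \<psi>" using h unfolding homeomorphism_def by auto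
  interpret plane: geodesic_plane "\<lambda>x y. gd (\<psi> x) (\<psi> y)" "\<lambda>x y. \<phi> \<circ> geo (\<psi> x) (\<psi> y)"
    by (rule geodesic_plane_of_homeomorphism[OF h])
  have inj: "inj_on \<phi> U" using inv(3) by (metis inj_onI)
  have seg: "path_image (\<phi> \<circ> geo (\<psi> (\<phi> P)) (\<psi> (\<phi> Q))) = \<phi> ` path_image (geo P Q)" if "P \<in> U" "Q \<in> U" for P Q
    using inv(3) that by (auto simp: path_image_def)
  let ?S = "triangle_sides M U A B C"
  have SU: "?S \<subseteq> U" unfolding triangle_sides_def using geo(7) U by blast
  have tri: "path_image (\<phi> \<circ> geo (\<psi> (\<phi> A)) (\<psi> (\<phi> B))) \<union> path_image (\<phi> \<circ> geo (\<psi> (\<phi> B)) (\<psi> (\<phi> C)))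
      \<union> path_image (\<phi> \<circ> geo (\<psi> (\<phi> C)) (\<psi> (\<phi> A))) = \<phi> ` ?S"
    unfolding triangle_sides_def by (simp only: seg U image_Un)
  have lt: "2 * pi / 3 < pi" by simp
  have meetU: "path_image (geo A B) \<inter> path_image (geo B C) = {B}"
    "path_image (geo B C) \<inter> path_image (geo C A) = {C}"
    "path_image (geo C A) \<inter> path_image (geo A B) = {A}"
  proof -
    \<comment> \<open>An angle smaller than 2 pi / 3 is not straight. Each pair of sides uses the
      angles at its two far ends, so every angle is needed in both orders.\<close>
    have a: "angle M U B A C < pi" "angle M U C A B < pi" "angle M U C B A < pi" "angle M U A B C < pi"
      "angle M U A C B < pi" "angle M U B C A < pi"
      using ang lt angle_sym[of C A B] angle_sym[of A B C] angle_sym[of B C A] by linarith+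
    show "path_image (geo A B) \<inter> path_image (geo B C) = {B}"
      by (rule sides_meet_only_at_vertex[OF U(1,2,3) ne(1,2) ne(3)[symmetric] a(1,6)])
    show "path_image (geo B C) \<inter> path_image (geo C A) = {C}"
      by (rule sides_meet_only_at_vertex[OF U(2,3,1) ne(2,3) ne(1)[symmetric] a(3,2)])
    show "path_image (geo C A) \<inter> path_image (geo A B) = {A}"
      by (rule sides_meet_only_at_vertex[OF U(3,1,2) ne(3,1) ne(2)[symmetric] a(5,4)])
  qed
  have meet: "\<phi> ` path_image (geo P X) \<inter> \<phi> ` path_image (geo X Q) = {\<phi> X}"
    if "path_image (geo P X) \<inter> path_image (geo X Q) = {X}" "P \<in> U" "X \<in> U" "Q \<in> U" for P X Q
    using inj_on_image_Int[OF inj geo(7)[OF that(2,3)] geo(7)[OF that(3,4)]] that(1) by simp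
  have "\<exists>q\<in>\<phi> ` ?S \<union> inside (\<phi> ` ?S). \<forall>t. gd (\<psi> q) (\<psi> (\<phi> A)) + gd (\<psi> q) (\<psi> (\<phi> B)) + gd (\<psi> q) (\<psi> (\<phi> C))
      \<le> gd (\<psi> t) (\<psi> (\<phi> A)) + gd (\<psi> t) (\<psi> (\<phi> B)) + gd (\<psi> t) (\<psi> (\<phi> C))"
    unfolding tri[symmetric]
  proof (rule plane.sum_of_distances_minimal_in_triangle)
    show "\<phi> A \<noteq> \<phi> B" "\<phi> B \<noteq> \<phi> C" "\<phi> C \<noteq> \<phi> A" using ne inj U by (auto dest: inj_onD)
  qed (simp_all only: seg U meet meetU)
  then obtain q where q: "q \<in> \<phi> ` ?S \<union> inside (\<phi> ` ?S)"
    and qmin: "\<And>t. gd (\<psi> q) A + gd (\<psi> q) B + gd (\<psi> q) C \<le> gd (\<psi> t) A + gd (\<psi> t) B + gd (\<psi> t) C"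
    using inv(3) U by auto
  define T where "T = \<psi> q"
  have T: "T \<in> U" "\<phi> T = q" using inv by (auto simp: T_def)
  have min: "gd T A + gd T B + gd T C \<le> gd Y A + gd Y B + gd Y C" if "Y \<in> U" for Y
    using qmin[of "\<phi> Y"] inv(3)[OF that] by (simp add: T_def)
  have TA: "T \<noteq> A"
  proof
    assume "T = A"
    then have "2 * pi / 3 \<le> angle M U B A C"
      using min gd_self[OF U(1)] U ne by (intro angle_at_minimizing_vertex) (auto simp: add.assoc)
    then show False using ang(1) by linarith
  qed
  have TB: "T \<noteq> B"
  proof
    assume "T = B"
    then have "2 * pi / 3 \<le> angle M U C B A"
      using min gd_self[OF U(2)] U ne by (intro angle_at_minimizing_vertex) (auto simp: add_ac)
    then show False using ang(2) by linarith
  qed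
  have TC: "T \<noteq> C"
  proof
    assume "T = C"
    then have "2 * pi / 3 \<le> angle M U A C B"
      using min gd_self[OF U(3)] U ne by (intro angle_at_minimizing_vertex) (auto simp: add_ac)
    then show False using ang(3) by linarith
  qed
  have min': "gd T A + (gd T B + gd T C) \<le> gd Y A + (gd Y B + gd Y C)"
    "gd T B + (gd T C + gd T A) \<le> gd Y B + (gd Y C + gd Y A)"
    "gd T C + (gd T A + gd T B) \<le> gd Y C + (gd Y A + gd Y B)" if "Y \<in> U" for Y
    using min[OF that] by linarith+
  have notS: "T \<notin> ?S"
    unfolding triangle_sides_def
    using minimizer_not_on_side[OF U(1,2,3) ne(1,3) ne(2)[symmetric] _ TA TB TC min'(1)]
      minimizer_not_on_side[OF U(2,3,1) ne(2,1) ne(3)[symmetric] _ TB TC TA min'(2)]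
      minimizer_not_on_side[OF U(3,1,2) ne(3,2) ne(1)[symmetric] _ TC TA TB min'(3)] by blast
  have qin: "q \<in> inside (\<phi> ` ?S)"
  proof -
    have "q \<notin> \<phi> ` ?S"
    proof
      assume "q \<in> \<phi> ` ?S"
      then obtain Y where "Y \<in> ?S" "q = \<phi> Y" by blast
      then have "T = Y" using inv(3) SU T_def by blast
      then show False using notS \<open>Y \<in> ?S\<close> by simp
    qed
    then show ?thesis using q by blast
  qed
  have compS: "compact ?S"
    unfolding triangle_sides_def by (intro compact_Un compact_path_image geo(6) U)
  have "compact (\<phi> ` ?S)" using compact_continuous_image[OF continuous_on_subset[OF cont(1) SU] compS] .
  then have "compact (\<phi> ` ?S \<union> inside (\<phi> ` ?S))" by (rule compact_Un_inside)
  then have compK: "compact (\<psi> ` (\<phi> ` ?S \<union> inside (\<phi> ` ?S)))"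
    by (rule compact_continuous_image[OF continuous_on_subset[OF cont(2) subset_UNIV]])
  have comp: "connected_component_set (U - ?S) T \<subseteq> \<psi> ` (\<phi> ` ?S \<union> inside (\<phi> ` ?S))"
  proof
    fix Y assume "Y \<in> connected_component_set (U - ?S) T"
    then obtain W where W: "connected W" "W \<subseteq> U - ?S" "T \<in> W" "Y \<in> W"
      by (auto simp: connected_component_def)
    have "connected (\<phi> ` W)"
      using W by (intro connected_continuous_image continuous_on_subset[OF cont(1)]) auto
    moreover have "\<phi> ` W \<subseteq> - (\<phi> ` ?S)"
    proof -
      have "\<phi> y \<notin> \<phi> ` ?S" if "y \<in> W" for y
      proof
        assume "\<phi> y \<in> \<phi> ` ?S"
        then obtain s where "s \<in> ?S" "\<phi> y = \<phi> s" by blast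
        then have "y = s" using inj that W(2) SU by (metis DiffD1 inj_onD subsetD)
        then show False using W(2) that \<open>s \<in> ?S\<close> by blast
      qed
      then show ?thesis by (metis ComplI image_subsetI)
    qed
    ultimately have "connected_component (- (\<phi> ` ?S)) q (\<phi> Y)"
      unfolding connected_component_def using W(3,4) T(2) by blast
    then have "\<phi> Y \<in> inside (\<phi> ` ?S)" using qin by (rule inside_same_component)
    moreover have "Y = \<psi> (\<phi> Y)" using inv(3) W(2,4) by force
    ultimately show "Y \<in> \<psi> ` (\<phi> ` ?S \<union> inside (\<phi> ` ?S))" by blast
  qed
  have "T \<in> triangle_interior M U A B C"
  proof -
    have "\<psi> ` (\<phi> ` ?S \<union> inside (\<phi> ` ?S)) \<subseteq> U" using inv(2) by blast
    then have "\<exists>K. compact K \<and> K \<subseteq> U \<and> connected_component_set (U - ?S) T \<subseteq> K"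
      using compK comp by blast
    then show ?thesis unfolding triangle_interior_def using T(1) notS by blast
  qed
  moreover have "angle M U A T B = 2 * pi / 3"
    by (rule angles_at_interior_minimizer[OF T(1) U(1,2,3) ne(1,3) ne(2)[symmetric] TA TB TC min'(1)])
  moreover have "angle M U B T C = 2 * pi / 3"
    by (rule angles_at_interior_minimizer[OF T(1) U(2,3,1) ne(2,1) ne(3)[symmetric] TB TC TA min'(2)])
  moreover have "angle M U C T A = 2 * pi / 3"
    by (rule angles_at_interior_minimizer[OF T(1) U(3,1,2) ne(3,2) ne(1)[symmetric] TC TA TB min'(3)])
  ultimately show ?thesis unfolding balanced_point_def by blast
qed

end

theorem theorem1p1:
  fixes M :: "'a::{t2_space, second_countable_topology} surface"
    and U :: "'a set" and A B C :: 'a and R :: real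
  assumes "riemannian_surface M"
    and "R > 0"
    and "curvature_le M (1 / R\<^sup>2)"
    and "geodesic_disk M U"
    and "A \<in> U" "B \<in> U" "C \<in> U"
    and "A \<noteq> B" "B \<noteq> C" "C \<noteq> A"
    and "angle M U B A C < 2 * pi / 3"
    and "angle M U C B A < 2 * pi / 3"
    and "angle M U A C B < 2 * pi / 3"
    and "\<forall>P\<in>triangle_domain M U A B C. \<forall>Q\<in>triangle_domain M U A B C.
           geodesic_dist M P Q < R * pi / 2"
  shows "\<exists>T. balanced_point M U A B C T"
proof -
  interpret geodesic_disk_surface M U
    using assms(1,4) by (simp add: geodesic_disk_surface_def geodesic_disk_surface_axioms_def)
  show ?thesis using assms by (intro exists_balanced_point)
qed

end
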